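(* Let $\phi: F\to F$ be an injective endomorphism and let $\mathcal A$ be the maximal $[\phi]$-fixed free factor system of $F$. Then there is a unique maximal $[\phi]$-invariant free factor system $\mathcal A^* \succeq \mathcal A$ such that $\phi^k(\mathcal A^* )$ is carried by $\mathcal A$ for some $k \ge 0$. Moreover, after replacing the free factors of $\mathcal A$ with conjugates if necessary, one can assume $\mathcal A \subset \mathcal A^*$.
   Context: $F$ is a free group of finite rank at least $2$. A nontrivial free factor system of $F$ is a nonempty finite collection $\mathcal A=\{A_1,\dots,A_l\}$ of nontrivial free factors (its components) which generate their free product $A_1*\cdots*A_l$, with this product a free factor of $F$; the trivial system consists of the trivial subgroup. A collection $\mathcal A$ of subgroups carries a collection $\mathcal B$ if for every $B\in\mathcal B$ there are $A\in\mathcal A$, $x\in F$ with $B\le xAx^{-1}$; for free factor systems this is written $\mathcal B\preceq\mathcal A$. Free factor systems are considered up to the equivalence relation $\mathcal A\preceq\mathcal B$ and $\mathcal B\preceq\mathcal A$; maximality and uniqueness refer to the induced partial order. $\mathcal A$ is $[\phi]$-invariant if it carries $\phi(\mathcal A)=\{\phi(A_1),\dots,\phi(A_l)\}$; it is $[\phi]$-fixed if moreover there is a permutation $\sigma$ of the indices such that $\phi(A_i)$ is conjugate in $F$ to $A_{\sigma(i)}$ for all $i$. The maximal $[\phi]$-fixed free factor system is the unique $[\phi]$-fixed free factor system that carries every $[\phi]$-fixed free factor system (it exists for every injective $\phi$, and may be trivial). *)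

theory Defs
  imports "HOL-Algebra.Algebra"
begin

section \<open>Free groups and internal free products\<close>

text \<open>A letter \<open>(s, True)\<close> stands for the generator \<open>s\<close> and \<open>(s, False)\<close> for its inverse.\<close>

definition letter_value :: "('a, 'm) monoid_scheme \<Rightarrow> 'a \<times> bool \<Rightarrow> 'a" where
  "letter_value F l = (if snd l then fst l else inv\<^bsub>F\<^esub> (fst l))"

definition reduced_words :: "'a set \<Rightarrow> ('a \<times> bool) list set" where
  "reduced_words S =
     {w. set w \<subseteq> S \<times> UNIV \<and> successively (\<lambda>l l'. fst l = fst l' \<longrightarrow> snd l = snd l') w}"

definition word_product :: "('a, 'm) monoid_scheme \<Rightarrow> 'a list \<Rightarrow> 'a" where
  "word_product F w = foldr (\<lambda>x y. x \<otimes>\<^bsub>F\<^esub> y) w \<one>\<^bsub>F\<^esub>"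

definition free_basis :: "('a, 'm) monoid_scheme \<Rightarrow> 'a set \<Rightarrow> bool" where
  "free_basis F S \<longleftrightarrow> S \<subseteq> carrier F \<and>
     bij_betw (\<lambda>w. word_product F (map (letter_value F) w)) (reduced_words S) (carrier F)"

definition free_group_finite_rank_ge2 :: "('a, 'm) monoid_scheme \<Rightarrow> bool" where
  "free_group_finite_rank_ge2 F \<longleftrightarrow>
     group F \<and> (\<exists>S. finite S \<and> 2 \<le> card S \<and> free_basis F S)"

text \<open>Nonempty words whose letters \<open>(i, a)\<close> are nontrivial elements \<open>a\<close> of the \<open>i\<close>-th subgroup,
  with consecutive letters taken from different indices.\<close>

definition alternating_words ::
    "('a, 'm) monoid_scheme \<Rightarrow> 'i set \<Rightarrow> ('i \<Rightarrow> 'a set) \<Rightarrow> ('i \<times> 'a) list set" where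
  "alternating_words F I H =
     {w. w \<noteq> [] \<and> (\<forall>(i, a) \<in> set w. i \<in> I \<and> a \<in> H i \<and> a \<noteq> \<one>\<^bsub>F\<^esub>) \<and>
         successively (\<lambda>p q. fst p \<noteq> fst q) w}"

text \<open>The canonical homomorphism from the free product of the \<open>H i\<close> to \<open>F\<close> is injective,
  so that the subgroup generated by the \<open>H i\<close> is their internal free product.\<close>

definition generate_free_product ::
    "('a, 'm) monoid_scheme \<Rightarrow> 'i set \<Rightarrow> ('i \<Rightarrow> 'a set) \<Rightarrow> bool" where
  "generate_free_product F I H \<longleftrightarrow>
     (\<forall>i\<in>I. subgroup (H i) F) \<and>
     (\<forall>w \<in> alternating_words F I H. word_product F (map snd w) \<noteq> \<one>\<^bsub>F\<^esub>)"

definition free_factor :: "('a, 'm) monoid_scheme \<Rightarrow> 'a set \<Rightarrow> bool" where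
  "free_factor F A \<longleftrightarrow>
     (\<exists>B. generate_free_product F (UNIV :: bool set) (\<lambda>b. if b then A else B) \<and>
          generate F (A \<union> B) = carrier F)"


section \<open>Free factor systems\<close>

text \<open>Collections are sets rather than indexed families: nontrivial subgroups generating their
  free product are pairwise distinct.\<close>

definition nontrivial_free_factor_system :: "('a, 'm) monoid_scheme \<Rightarrow> 'a set set \<Rightarrow> bool" where
  "nontrivial_free_factor_system F \<A> \<longleftrightarrow>
     finite \<A> \<and> \<A> \<noteq> {} \<and>
     (\<forall>A\<in>\<A>. free_factor F A \<and> A \<noteq> {\<one>\<^bsub>F\<^esub>}) \<and>
     generate_free_product F \<A> (\<lambda>A. A) \<and>
     free_factor F (generate F (\<Union>\<A>))"

definition free_factor_system :: "('a, 'm) monoid_scheme \<Rightarrow> 'a set set \<Rightarrow> bool" where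
  "free_factor_system F \<A> \<longleftrightarrow> nontrivial_free_factor_system F \<A> \<or> \<A> = {{\<one>\<^bsub>F\<^esub>}}"

definition conjugate_by :: "('a, 'm) monoid_scheme \<Rightarrow> 'a \<Rightarrow> 'a set \<Rightarrow> 'a set" where
  "conjugate_by F x A = (\<lambda>a. x \<otimes>\<^bsub>F\<^esub> a \<otimes>\<^bsub>F\<^esub> inv\<^bsub>F\<^esub> x) ` A"

definition carries :: "('a, 'm) monoid_scheme \<Rightarrow> 'a set set \<Rightarrow> 'a set set \<Rightarrow> bool" where
  "carries F \<A> \<B> \<longleftrightarrow> (\<forall>B\<in>\<B>. \<exists>A\<in>\<A>. \<exists>x\<in>carrier F. B \<subseteq> conjugate_by F x A)"

definition system_equiv :: "('a, 'm) monoid_scheme \<Rightarrow> 'a set set \<Rightarrow> 'a set set \<Rightarrow> bool" where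
  "system_equiv F \<A> \<B> \<longleftrightarrow> carries F \<A> \<B> \<and> carries F \<B> \<A>"

definition image_system :: "('a \<Rightarrow> 'a) \<Rightarrow> 'a set set \<Rightarrow> 'a set set" where
  "image_system \<phi> \<A> = (\<lambda>A. \<phi> ` A) ` \<A>"

definition invariant_system ::
    "('a, 'm) monoid_scheme \<Rightarrow> ('a \<Rightarrow> 'a) \<Rightarrow> 'a set set \<Rightarrow> bool" where
  "invariant_system F \<phi> \<A> \<longleftrightarrow> carries F \<A> (image_system \<phi> \<A>)"

definition fixed_system ::
    "('a, 'm) monoid_scheme \<Rightarrow> ('a \<Rightarrow> 'a) \<Rightarrow> 'a set set \<Rightarrow> bool" where
  "fixed_system F \<phi> \<A> \<longleftrightarrow> invariant_system F \<phi> \<A> \<and>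
     (\<exists>\<sigma>. bij_betw \<sigma> \<A> \<A> \<and>
          (\<forall>A\<in>\<A>. \<exists>x\<in>carrier F. \<phi> ` A = conjugate_by F x (\<sigma> A)))"

text \<open>The maximal fixed system is determined up to \<^const>\<open>system_equiv\<close>; this predicate
  says that \<open>\<A>\<close> represents it.\<close>

definition maximal_fixed_system ::
    "('a, 'm) monoid_scheme \<Rightarrow> ('a \<Rightarrow> 'a) \<Rightarrow> 'a set set \<Rightarrow> bool" where
  "maximal_fixed_system F \<phi> \<A> \<longleftrightarrow>
     free_factor_system F \<A> \<and> fixed_system F \<phi> \<A> \<and>
     (\<forall>\<B>. free_factor_system F \<B> \<and> fixed_system F \<phi> \<B> \<longrightarrow> carries F \<A> \<B>)"

definition absorbed_system ::
    "('a, 'm) monoid_scheme \<Rightarrow> ('a \<Rightarrow> 'a) \<Rightarrow> 'a set set \<Rightarrow> 'a set set \<Rightarrow> bool" where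
  "absorbed_system F \<phi> \<A> \<B> \<longleftrightarrow>
     free_factor_system F \<B> \<and> invariant_system F \<phi> \<B> \<and> carries F \<B> \<A> \<and>
     (\<exists>k. carries F \<A> (image_system (\<phi> ^^ k) \<B>))"

text \<open>Maximality in the partial order that \<^const>\<open>carries\<close> induces on equivalence classes.\<close>

definition maximal_absorbed_system ::
    "('a, 'm) monoid_scheme \<Rightarrow> ('a \<Rightarrow> 'a) \<Rightarrow> 'a set set \<Rightarrow> 'a set set \<Rightarrow> bool" where
  "maximal_absorbed_system F \<phi> \<A> \<B> \<longleftrightarrow>
     absorbed_system F \<phi> \<A> \<B> \<and>
     (\<forall>\<C>. absorbed_system F \<phi> \<A> \<C> \<and> carries F \<C> \<B> \<longrightarrow> system_equiv F \<C> \<B>)"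

end

theory Submission
  imports Defs
begin

text \<open>Put \<open>\<D>\<^sub>k\<close> for the system of nontrivial preimages under \<open>\<phi> ^^ k\<close> of the conjugates of
  the components of \<open>\<A>\<close>. By Kurosh's theorem for the subgroup \<open>(\<phi> ^^ k) ` carrier F\<close> it is a free
  factor system; it is absorbed, and it carries every system that \<open>\<phi> ^^ k\<close> sends into \<open>\<A>\<close>.
  An absorbed system with the fewest homomorphisms to the group of order two killing it and, subject
  to that, the fewest components is equivalent to \<open>\<D>\<^sub>k\<close> for all large \<open>k\<close>, hence is the greatest
  absorbed system. Malnormality of the components of \<open>\<A>\<close> shows that every absorbed system contains a
  conjugate of each of them.

  Kurosh's theorem is proved by letting the whole group act on the product of the left cosets of the
  subgroup with the normal forms of the expected free product decomposition.\<close>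

section \<open>Words and free products\<close>

text \<open>The systems \<open>\<D>\<^sub>k\<close> increase with \<open>k\<close>; the obstacle is
  to show that they stop growing. A larger system is killed by fewer homomorphisms to the group of
  order two, and there are finitely many of these because the group is finitely generated. This
  count misses the merging of components, since killing two subgroups is the same as killing the
  subgroup they generate; the number of components detects it. When the first count agrees, Kurosh's
  theorem for a component \<open>T\<close> of the larger system yields only conjugates of components
  of the smaller one: any other nontrivial factor is a subgroup of a free group, so it admits a
  nonzero homomorphism to the group of order two, and this extends to the whole group. The second
  count then leaves one conjugate in each \<open>T\<close>. Free products enter through actions on
  sets: actions of the factors on a common set combine to an action of the free product. Two points
  give homomorphisms, cosets times normal forms give Kurosh's theorem, normal forms give the
  refinement of free products.\<close>

definition set_action ::
    "('a, 'm) monoid_scheme \<Rightarrow> 'a set \<Rightarrow> 's set \<Rightarrow> ('a \<Rightarrow> 's \<Rightarrow> 's) \<Rightarrow> bool" where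
  "set_action G K S \<rho> \<longleftrightarrow>
     (\<forall>g\<in>K. \<forall>s\<in>S. \<rho> g s \<in> S) \<and> (\<forall>s\<in>S. \<rho> \<one>\<^bsub>G\<^esub> s = s) \<and>
     (\<forall>g\<in>K. \<forall>h\<in>K. \<forall>s\<in>S. \<rho> (g \<otimes>\<^bsub>G\<^esub> h) s = \<rho> g (\<rho> h s))"

definition nf_words ::
    "('a, 'm) monoid_scheme \<Rightarrow> 'i set \<Rightarrow> ('i \<Rightarrow> 'a set) \<Rightarrow> ('i \<times> 'a) list set" where
  "nf_words G I H = insert [] (alternating_words G I H)"

text \<open>Van der Waerden's permutations: left multiplication by one letter, carried out on normal
  forms. It is defined without knowing that normal forms are determined by their values.\<close>

definition push ::
    "('a, 'm) monoid_scheme \<Rightarrow> 'i \<Rightarrow> 'a \<Rightarrow> ('i \<times> 'a) list \<Rightarrow> ('i \<times> 'a) list" where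
  "push G i a w =
     (if a = \<one>\<^bsub>G\<^esub> then w
      else case w of [] \<Rightarrow> [(i, a)]
        | p # v \<Rightarrow> if fst p = i
                   then if a \<otimes>\<^bsub>G\<^esub> snd p = \<one>\<^bsub>G\<^esub> then v else (i, a \<otimes>\<^bsub>G\<^esub> snd p) # v
                   else (i, a) # w)"

abbreviation word_value :: "('a, 'm) monoid_scheme \<Rightarrow> ('i \<times> 'a) list \<Rightarrow> 'a" where
  "word_value G w \<equiv> word_product G (map snd w)"

abbreviation fold_act :: "('i \<Rightarrow> 'a \<Rightarrow> 's \<Rightarrow> 's) \<Rightarrow> ('i \<times> 'a) list \<Rightarrow> 's \<Rightarrow> 's" where
  "fold_act act w s \<equiv> foldr (\<lambda>p. act (fst p) (snd p)) w s"

lemma word_product_simps [simp]: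
  "word_product G [] = \<one>\<^bsub>G\<^esub>" "word_product G (x # w) = x \<otimes>\<^bsub>G\<^esub> word_product G w"
  by (simp_all add: word_product_def)

lemma nf_words_Nil [simp]: "[] \<in> nf_words G I H"
  by (simp add: nf_words_def)

lemma nf_words_Cons:
  "(i, a) # v \<in> nf_words G I H \<longleftrightarrow>
     i \<in> I \<and> a \<in> H i \<and> a \<noteq> \<one>\<^bsub>G\<^esub> \<and> v \<in> nf_words G I H \<and> (v = [] \<or> fst (hd v) \<noteq> i)"
  by (cases v) (auto simp: nf_words_def alternating_words_def)

lemma nf_words_subset_lists: "nf_words G I H \<subseteq> lists (Sigma I H)"
  by (auto simp: nf_words_def alternating_words_def)

lemma nf_words_mono:
  assumes "w \<in> nf_words G I H" "I \<subseteq> I'" "\<And>i. i \<in> I \<Longrightarrow> H i \<subseteq> H' i"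
  shows "w \<in> nf_words G I' H'"
  using assms by (force simp: nf_words_def alternating_words_def)

lemma alternating_words_iff: "w \<in> alternating_words G I H \<longleftrightarrow> w \<in> nf_words G I H \<and> w \<noteq> []"
  by (auto simp: nf_words_def alternating_words_def)

lemma push_nf_words: "(i, a) # v \<in> nf_words G I H \<Longrightarrow> push G i a v = (i, a) # v"
  by (cases v) (auto simp: nf_words_Cons push_def)

lemma generate_free_product_nf:
  "generate_free_product G I H \<longleftrightarrow>
     (\<forall>i\<in>I. subgroup (H i) G) \<and>
     (\<forall>w \<in> nf_words G I H. word_value G w = \<one>\<^bsub>G\<^esub> \<longrightarrow> w = [])"
  by (auto simp: generate_free_product_def alternating_words_iff)

context group
begin

lemma letters_closed:
  assumes H: "\<forall>j\<in>I. subgroup (H j) G" and "w \<in> lists (Sigma I H)"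
  shows "set (map snd w) \<subseteq> carrier G"
proof -
  have "snd p \<in> carrier G" if "p \<in> Sigma I H" for p
    using that subgroup.mem_carrier[OF bspec[OF H]] by force
  then show ?thesis using assms(2) by (auto simp: in_lists_conv_set)
qed

lemma word_product_closed [intro, simp]:
  "set w \<subseteq> carrier G \<Longrightarrow> word_product G w \<in> carrier G"
  by (induction w) auto

lemma word_product_append:
  "set v \<subseteq> carrier G \<Longrightarrow> set w \<subseteq> carrier G \<Longrightarrow>
   word_product G (v @ w) = word_product G v \<otimes> word_product G w"
  by (induction v) (auto simp: m_assoc)

lemma word_value_append:
  assumes "\<forall>j\<in>I. subgroup (H j) G" "v \<in> lists (Sigma I H)" "w \<in> lists (Sigma I H)"
  shows "word_value G (v @ w) = word_value G v \<otimes> word_value G w"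
  using letters_closed[OF assms(1,2)] letters_closed[OF assms(1,3)]
  by (simp add: word_product_append)

section \<open>The action of a single factor on normal forms\<close>

lemma push_closed:
  assumes "\<forall>j\<in>I. subgroup (H j) G" "i \<in> I" "a \<in> H i" "w \<in> nf_words G I H"
  shows "push G i a w \<in> nf_words G I H"
proof (cases w)
  case Nil
  then show ?thesis using assms by (simp add: push_def nf_words_Cons)
next
  case (Cons p v)
  obtain j b where p: "p = (j, b)" by force
  show ?thesis using assms Cons p subgroup.m_closed[OF bspec[OF assms(1,2)]]
    by (auto simp: push_def nf_words_Cons)
qed

text \<open>Only the first letter of \<open>w\<close> is touched, so the claim reduces to
  associativity within the factor \<open>H i\<close>.\<close>

lemma push_push:
  assumes "\<forall>j\<in>I. subgroup (H j) G" "i \<in> I" "a \<in> H i" "b \<in> H i" "w \<in> nf_words G I H"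
  shows "push G i a (push G i b w) = push G i (a \<otimes> b) w"
proof -
  have ab: "a \<in> carrier G" "b \<in> carrier G"
    using assms(3,4) subgroup.mem_carrier[OF bspec[OF assms(1,2)]] by blast+
  show ?thesis
  proof (cases w)
    case Nil
    then show ?thesis using ab by (simp add: push_def)
  next
    case (Cons p v)
    obtain j c where p: "p = (j, c)" by force
    have c: "j \<in> I" "c \<in> carrier G" "c \<noteq> \<one>" "v \<in> nf_words G I H" "v = [] \<or> fst (hd v) \<noteq> j"
      using assms(5) Cons p subgroup.mem_carrier[OF bspec[OF assms(1)]]
      by (auto simp: nf_words_Cons)
    show ?thesis
    proof (cases "j = i")
      case False
      then show ?thesis using ab c Cons p by (simp add: push_def)
    next
      case True
      \<comment> \<open>Split off the first letter \<open>c\<close>: pushing \<open>x\<close> on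
        \<open>w\<close> is pushing \<open>x \<otimes> c\<close> on \<open>v\<close>, which starts
        with another factor, so that nothing merges there.\<close>
      have v: "push G i x v = (if x = \<one> then v else (i, x) # v)" for x
        using c True by (cases v) (auto simp: push_def)
      have *: "push G i x w = push G i (x \<otimes> c) v" if "x \<in> carrier G" for x
        using c that Cons p True by (auto simp: v) (auto simp: push_def)
      show ?thesis
      proof (cases "b \<otimes> c = \<one>")
        case True
        then have "a \<otimes> b \<otimes> c = a" using ab c by (simp add: m_assoc)
        then show ?thesis using * ab c True by (simp add: v)
      next
        case False
        then have "push G i b w = (i, b \<otimes> c) # v" using *[OF ab(2)] v by simp
        then have "push G i a (push G i b w) = push G i (a \<otimes> (b \<otimes> c)) v"
          using ab c False v[of "a \<otimes> (b \<otimes> c)"] by (cases "a = \<one>") (auto simp: push_def)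
        then show ?thesis using * ab c by (simp add: m_assoc)
      qed
    qed
  qed
qed

lemma push_one [simp]: "push G i \<one> w = w"
  by (simp add: push_def)

end

section \<open>Actions of all factors on a common set\<close>

text \<open>No compatibility between different factors is asked for: these are exactly the data that
  determine an action of their free product.\<close>

definition family_action ::
    "('a, 'm) monoid_scheme \<Rightarrow> 'i set \<Rightarrow> ('i \<Rightarrow> 'a set) \<Rightarrow> 's set \<Rightarrow> ('i \<Rightarrow> 'a \<Rightarrow> 's \<Rightarrow> 's) \<Rightarrow> bool" where
  "family_action G I H S act \<longleftrightarrow> (\<forall>i\<in>I. set_action G (H i) S (act i))"

lemma family_actionD:
  assumes "family_action G I H S act" "i \<in> I" "s \<in> S"
  shows "a \<in> H i \<Longrightarrow> act i a s \<in> S"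
    and "act i \<one>\<^bsub>G\<^esub> s = s"
    and "a \<in> H i \<Longrightarrow> b \<in> H i \<Longrightarrow> act i (a \<otimes>\<^bsub>G\<^esub> b) s = act i a (act i b s)"
  using assms by (auto simp: family_action_def set_action_def)

lemma fold_act_closed:
  "family_action G I H S act \<Longrightarrow> w \<in> lists (Sigma I H) \<Longrightarrow> s \<in> S \<Longrightarrow> fold_act act w s \<in> S"
  by (induction w) (auto intro: family_actionD)

context group
begin

text \<open>The cases of \<open>push\<close> reflect relations valid in every family action: the
  identity acts trivially and letters of one factor multiply. Hence passing to normal forms does not
  change how a word acts.\<close>

lemma fold_act_push:
  assumes H: "\<forall>j\<in>I. subgroup (H j) G" and act: "family_action G I H S act"
    and "i \<in> I" "a \<in> H i" "w \<in> nf_words G I H" "s \<in> S"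
  shows "fold_act act (push G i a w) s = act i a (fold_act act w s)"
proof (cases w)
  case Nil
  then show ?thesis using family_actionD[OF act] assms by (simp add: push_def)
next
  case (Cons p v)
  obtain j b where p: "p = (j, b)" by force
  have b: "j \<in> I" "b \<in> H j" "v \<in> nf_words G I H"
    using assms Cons p by (auto simp: nf_words_Cons)
  have v: "fold_act act v s \<in> S"
    using fold_act_closed[OF act] b nf_words_subset_lists assms by blast
  have vs: "act i (a \<otimes> b) (fold_act act v s) = act i a (act j b (fold_act act v s))" if "i = j"
    using family_actionD(3)[OF act \<open>i \<in> I\<close> v] that b assms by blast
  have one: "act i \<one> t = t" if "t \<in> S" for t
    using family_actionD(2)[OF act \<open>i \<in> I\<close> that] .
  have bv: "act j b (fold_act act v s) \<in> S"
    using family_actionD(1)[OF act b(1) v b(2)] .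
  show ?thesis
  proof (cases "a = \<one>")
    case True
    then show ?thesis using one[OF bv] Cons p by (simp add: push_def)
  next
    case False
    then show ?thesis using vs one[OF v] Cons p by (cases "a \<otimes> b = \<one>") (auto simp: push_def)
  qed
qed

text \<open>Pushing the letters of \<open>w\<close> onto the empty word from right to left computes
  its normal form.\<close>

lemma normal_form:
  assumes "\<forall>j\<in>I. subgroup (H j) G" "w \<in> lists (Sigma I H)"
  shows "fold_act (push G) w [] \<in> nf_words G I H"
  using assms(2)
proof (induction w)
  case (Cons p w)
  then show ?case using push_closed[OF assms(1)] by (cases p) auto
qed simp

lemma fold_act_normal_form:
  assumes H: "\<forall>j\<in>I. subgroup (H j) G" and act: "family_action G I H S act"
    and "w \<in> lists (Sigma I H)" "s \<in> S"
  shows "fold_act act (fold_act (push G) w []) s = fold_act act w s"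
  using assms(3)
proof (induction w)
  case (Cons p w)
  then show ?case
    using fold_act_push[OF H act _ _ normal_form[OF H Cons(2)] \<open>s \<in> S\<close>] by (cases p) simp
qed simp

text \<open>The left regular action. The value of a word is the result of its action on the
  identity, so facts about all family actions specialise to values.\<close>

lemma left_mult_family_action:
  assumes H: "\<forall>j\<in>I. subgroup (H j) G"
  shows "family_action G I H (carrier G) (\<lambda>i a x. a \<otimes> x)"
proof -
  have "a \<in> carrier G" if "i \<in> I" "a \<in> H i" for i a
    using that subgroup.mem_carrier[OF bspec[OF H]] by blast
  then show ?thesis by (simp add: family_action_def set_action_def m_assoc)
qed

lemma word_value_fold_act: "word_value G w = fold_act (\<lambda>i a x. a \<otimes> x) w \<one>"
  by (induction w) auto

lemma word_value_normal_form:
  assumes H: "\<forall>j\<in>I. subgroup (H j) G" and "w \<in> lists (Sigma I H)"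
  shows "word_value G (fold_act (push G) w []) = word_value G w"
  unfolding word_value_fold_act
  by (rule fold_act_normal_form[OF H left_mult_family_action[OF H] assms(2)]) auto

lemma inverse_word:
  assumes H: "\<forall>j\<in>I. subgroup (H j) G" and "w \<in> lists (Sigma I H)"
  shows "\<exists>w' \<in> lists (Sigma I H). word_value G w' = inv (word_value G w)"
  using assms(2)
proof (induction w)
  case Nil
  then show ?case by (auto intro: bexI[of _ "[]"])
next
  case (Cons p w)
  then obtain w' where w': "w' \<in> lists (Sigma I H)" "word_value G w' = inv (word_value G w)"
    by auto
  obtain i a where p: "p = (i, a)" by force
  then have i: "i \<in> I" "a \<in> H i" "a \<in> carrier G"
    using Cons.hyps subgroup.mem_carrier[OF bspec[OF H]] by auto
  have "inv a \<in> H i" using subgroup.m_inv_closed[OF bspec[OF H]] i by blast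
  then have l: "w' @ [(i, inv a)] \<in> lists (Sigma I H)" using w'(1) i by simp
  have c: "word_value G w \<in> carrier G" "set (map snd w') \<subseteq> carrier G"
    using letters_closed[OF H Cons(2)] letters_closed[OF H w'(1)] by auto
  have "word_value G (w' @ [(i, inv a)]) = word_value G w' \<otimes> word_product G [inv a]"
    unfolding map_append by (subst word_product_append[OF c(2)]) (use i in simp_all)
  also have "\<dots> = inv (word_value G (p # w))"
    using i c(1) p w'(2) by (simp add: inv_mult_group)
  finally show ?case using l by blast
qed

section \<open>Generated subgroups in terms of words\<close>

lemma generate_words:
  fixes I :: "'i set"
  assumes H: "\<forall>j\<in>I. subgroup (H j) G"
  shows "generate G (\<Union>i\<in>I. H i) = word_value G ` lists (Sigma I H)"
proof
  have sub: "i \<in> I \<Longrightarrow> H i \<subseteq> carrier G" for i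
    using subgroup.subset[OF bspec[OF H]] .
  show "word_value G ` lists (Sigma I H) \<subseteq> generate G (\<Union>i\<in>I. H i)"
  proof (rule image_subsetI)
    fix w :: "('i \<times> 'a) list"
    assume "w \<in> lists (Sigma I H)"
    then show "word_value G w \<in> generate G (\<Union>i\<in>I. H i)"
    proof induction
      case (Cons p w)
      then have "snd p \<in> generate G (\<Union>i\<in>I. H i)"
        by (intro generate.incl) auto
      then show ?case using generate.eng[OF _ Cons.IH] by simp
    qed (simp add: generate.one)
  qed
  show "generate G (\<Union>i\<in>I. H i) \<subseteq> word_value G ` lists (Sigma I H)"
  proof
    fix g assume "g \<in> generate G (\<Union>i\<in>I. H i)"
    then show "g \<in> word_value G ` lists (Sigma I H)"
    proof (induction rule: generate.induct)
      case one
      then show ?case by (auto intro: image_eqI[of _ _ "[]"])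
    next
      case (incl h)
      then obtain i where "i \<in> I" "h \<in> H i" by auto
      moreover then have "h \<in> carrier G" using sub by blast
      ultimately show ?case by (intro image_eqI[of _ _ "[(i, h)]"]) auto
    next
      case (inv h)
      then obtain i where "i \<in> I" "h \<in> H i" by auto
      moreover then have "h \<in> carrier G" "inv h \<in> H i"
        using sub subgroup.m_inv_closed[OF bspec[OF H]] by blast+
      ultimately show ?case by (intro image_eqI[of _ _ "[(i, inv h)]"]) auto
    next
      case (eng g h)
      then obtain v w where v: "v \<in> lists (Sigma I H)" "g = word_value G v"
        and w: "w \<in> lists (Sigma I H)" "h = word_value G w" by (elim imageE)
      have "g \<otimes> h = word_value G (v @ w)"
        unfolding v(2) w(2) by (rule word_value_append[OF H v(1) w(1), symmetric])
      moreover have "v @ w \<in> lists (Sigma I H)" using v(1) w(1) by simp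
      ultimately show ?case by (rule image_eqI)
    qed
  qed
qed

lemma generate_nf_words:
  assumes H: "\<forall>j\<in>I. subgroup (H j) G" and "g \<in> generate G (\<Union>i\<in>I. H i)"
  obtains w where "w \<in> nf_words G I H" "word_value G w = g"
proof -
  obtain w where "w \<in> lists (Sigma I H)" "g = word_value G w"
    using assms(2) generate_words[OF H] by auto
  then show ?thesis
    using that[OF normal_form[OF H]] word_value_normal_form[OF H] by simp
qed

text \<open>Elements are built from the identity by letters on the left; inverses are covered
  because each \<open>H i\<close> is closed under them.\<close>

lemma generate_family_induct [consumes 2, case_names one mult]:
  assumes H: "\<forall>j\<in>I. subgroup (H j) G" and "g \<in> generate G (\<Union>i\<in>I. H i)"
    and "P \<one>" and "\<And>i a g. i \<in> I \<Longrightarrow> a \<in> H i \<Longrightarrow> g \<in> generate G (\<Union>i\<in>I. H i) \<Longrightarrow> P g \<Longrightarrow> P (a \<otimes> g)"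
  shows "P g"
proof -
  obtain w where w: "w \<in> lists (Sigma I H)" and g: "g = word_value G w"
    using assms(2) generate_words[OF H] by auto
  have "P (word_value G w)" using w
  proof (induction w)
    case (Cons p w)
    then show ?case using assms(4)[of "fst p" "snd p" "word_value G w"] generate_words[OF H] by auto
  qed (simp add: assms(3))
  then show ?thesis by (simp add: g)
qed

lemma free_product_subgroup: "generate_free_product G I H \<Longrightarrow> \<forall>i\<in>I. subgroup (H i) G"
  by (simp add: generate_free_product_def)

section \<open>The universal property and van der Waerden's criterion\<close>

text \<open>A word of value one has empty normal form, so it acts trivially. The composite of
  \<open>w\<close>, an inverse word of \<open>w\<close> and \<open>v\<close> therefore acts both as
  \<open>v\<close> and as \<open>w\<close>.\<close>

lemma free_product_word_unique_action:
  assumes fp: "generate_free_product G I H" and act: "family_action G I H S act"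
    and v: "v \<in> lists (Sigma I H)" and w: "w \<in> lists (Sigma I H)"
    and eq: "word_value G v = word_value G w" and s: "s \<in> S"
  shows "fold_act act v s = fold_act act w s"
proof -
  note H = free_product_subgroup[OF fp]
  have triv: "fold_act act u t = t"
    if u: "u \<in> lists (Sigma I H)" and "word_value G u = \<one>" "t \<in> S" for u t
  proof -
    have "word_value G (fold_act (push G) u []) = \<one>"
      using word_value_normal_form[OF H u] that by simp
    then have "fold_act (push G) u [] = []"
      using fp normal_form[OF H u] by (simp add: generate_free_product_nf)
    then show ?thesis using fold_act_normal_form[OF H act u, of t] that by simp
  qed
  obtain w' where w': "w' \<in> lists (Sigma I H)" "word_value G w' = inv (word_value G w)"
    using inverse_word[OF H w] by auto
  note c = letters_closed[OF H]
  have "fold_act act w (fold_act act (w' @ v) s) = fold_act act w s"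
    using triv[of "w' @ v" s] w' v c[OF w] s eq word_value_append[OF H w'(1) v] by simp
  moreover have "fold_act act (w @ w') (fold_act act v s) = fold_act act v s"
    using triv[of "w @ w'" "fold_act act v s"] w' w c[OF w] fold_act_closed[OF act v s]
      word_value_append[OF H w w'(1)] by simp
  ultimately show ?thesis by simp
qed

text \<open>The universal property of a free product, phrased for actions on a set instead of
  homomorphisms into a group.\<close>

theorem free_product_action_extend:
  assumes fp: "generate_free_product G I H" and act: "family_action G I H S act"
  obtains \<rho> where "set_action G (generate G (\<Union>i\<in>I. H i)) S \<rho>"
    and "\<And>i a s. i \<in> I \<Longrightarrow> a \<in> H i \<Longrightarrow> s \<in> S \<Longrightarrow> \<rho> a s = act i a s"
proof -
  note H = free_product_subgroup[OF fp]
  \<comment> \<open>Any word of value \<open>g\<close> will do, because its action depends on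
    \<open>g\<close> alone.\<close>
  define wd where "wd g = (SOME w. w \<in> lists (Sigma I H) \<and> word_value G w = g)" for g
  define \<rho> where "\<rho> g s = fold_act act (wd g) s" for g s
  have wd: "wd g \<in> lists (Sigma I H) \<and> word_value G (wd g) = g"
    if g: "g \<in> generate G (\<Union>i\<in>I. H i)" for g
  proof -
    obtain w where "w \<in> lists (Sigma I H)" "g = word_value G w"
      using g generate_words[OF H] by auto
    then have "\<exists>w. w \<in> lists (Sigma I H) \<and> word_value G w = g" by blast
    then show ?thesis unfolding wd_def by (rule someI_ex)
  qed
  have \<rho>: "\<rho> (word_value G w) s = fold_act act w s" if "w \<in> lists (Sigma I H)" "s \<in> S" for w s
    unfolding \<rho>_def
    by (rule free_product_word_unique_action[OF fp act])
      (use that wd[of "word_value G w"] generate_words[OF H] in auto)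
  note c = letters_closed[OF H]
  show ?thesis
  proof
    show "set_action G (generate G (\<Union>i\<in>I. H i)) S \<rho>"
      unfolding set_action_def
    proof (intro conjI ballI)
      fix g s assume "g \<in> generate G (\<Union>i\<in>I. H i)" "s \<in> S"
      then show "\<rho> g s \<in> S" unfolding \<rho>_def using wd fold_act_closed[OF act] by blast
    next
      fix s assume "s \<in> S"
      then show "\<rho> \<one> s = s" using \<rho>[of "[]" s] by simp
    next
      fix g h s assume *: "g \<in> generate G (\<Union>i\<in>I. H i)" "h \<in> generate G (\<Union>i\<in>I. H i)" "s \<in> S"
      have "word_value G (wd g @ wd h) = g \<otimes> h"
        using wd[OF *(1)] wd[OF *(2)] word_value_append[OF H] by simp
      then show "\<rho> (g \<otimes> h) s = \<rho> g (\<rho> h s)"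
        using \<rho>[of "wd g @ wd h" s] wd[OF *(1)] wd[OF *(2)] * by (simp add: \<rho>_def)
    qed
    fix i a s assume *: "i \<in> I" "a \<in> H i" "s \<in> S"
    then have "a \<in> carrier G" using subgroup.mem_carrier[OF bspec[OF H]] by blast
    then show "\<rho> a s = act i a s" using \<rho>[of "[(i, a)]" s] * by simp
  qed
qed

text \<open>Van der Waerden's trick. The letter groups \<open>L j\<close> are allowed to live in another group, so
  that the infinite cyclic factors appearing in Kurosh's theorem can be modelled by the integers.\<close>

theorem free_product_criterion:
  fixes M :: "('l, 'n) monoid_scheme"
  assumes M: "group M" and L: "\<forall>j\<in>J. subgroup (L j) M"
    and H: "\<forall>j\<in>J. subgroup (H j) G" and K: "\<And>j. j \<in> J \<Longrightarrow> H j \<subseteq> K" "subgroup K G"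
    and \<rho>: "set_action G K (nf_words M J L) \<rho>"
    and H_eq: "\<And>j. j \<in> J \<Longrightarrow> H j = \<iota> j ` L j"
    and one: "\<And>j. j \<in> J \<Longrightarrow> \<iota> j \<one>\<^bsub>M\<^esub> = \<one>"
    and \<rho>_push: "\<And>j l w. j \<in> J \<Longrightarrow> l \<in> L j \<Longrightarrow> w \<in> nf_words M J L \<Longrightarrow> \<rho> (\<iota> j l) w = push M j l w"
  shows "generate_free_product G J H"
  unfolding generate_free_product_nf
proof (intro conjI ballI impI)
  fix w assume w: "w \<in> nf_words G J H" and w1: "word_value G w = \<one>"
  \<comment> \<open>The value of \<open>w\<close>, acting on the empty word, produces a normal form
    with the same sequence of indices as \<open>w\<close>. If the value is one, this sequence is
    empty.\<close>
  have "\<exists>v \<in> nf_words M J L. map fst v = map fst w \<and> \<rho> (word_value G w) [] = v \<and> word_value G w \<in> K"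
    using w
  proof (induction w)
    case Nil
    then show ?case using \<rho> subgroup.one_closed[OF K(2)] by (auto simp: set_action_def)
  next
    case (Cons p w)
    obtain j h where p: "p = (j, h)" by force
    with Cons have j: "j \<in> J" "h \<in> H j" "h \<noteq> \<one>" "w \<in> nf_words G J H" "w = [] \<or> fst (hd w) \<noteq> j"
      by (auto simp: nf_words_Cons)
    obtain v where v: "v \<in> nf_words M J L" "map fst v = map fst w" "\<rho> (word_value G w) [] = v"
      "word_value G w \<in> K" using Cons.IH[OF j(4)] by auto
    obtain l where l: "l \<in> L j" "h = \<iota> j l" using H_eq j by blast
    have "(j, l) # v \<in> nf_words M J L"
      unfolding nf_words_Cons using v j l one[OF j(1)] by (cases v; cases w) auto
    moreover have "\<rho> (h \<otimes> word_value G w) [] = \<rho> h v"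
      using \<rho> K(1)[OF j(1)] j(2) v(3,4) by (auto simp: set_action_def)
    ultimately show ?case
      using \<rho>_push[OF j(1) l(1) v(1)] l(2) push_nf_words v p subgroup.m_closed[OF K(2)] K(1)[OF j(1)] j(2)
      by (intro bexI[of _ "(j, l) # v"]) (auto simp: push_nf_words)
  qed
  then show "w = []" using w1 \<rho> by (auto simp: set_action_def)
qed (use H in auto)

lemma push_family_action:
  assumes "\<forall>j\<in>J. subgroup (L j) G"
  shows "family_action G J L (nf_words G J L) (push G)"
  using push_closed[of J L] push_push[of J L] assms by (auto simp: family_action_def set_action_def)

end

section \<open>Kurosh's subgroup theorem\<close>

lemma set_actionD:
  assumes "set_action G K S \<rho>"
  shows "g \<in> K \<Longrightarrow> s \<in> S \<Longrightarrow> \<rho> g s \<in> S" "s \<in> S \<Longrightarrow> \<rho> \<one>\<^bsub>G\<^esub> s = s"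
    "g \<in> K \<Longrightarrow> h \<in> K \<Longrightarrow> s \<in> S \<Longrightarrow> \<rho> (g \<otimes>\<^bsub>G\<^esub> h) s = \<rho> g (\<rho> h s)"
  using assms by (auto simp: set_action_def)

lemma (in group) inv_cancel_left:
  "x \<in> carrier G \<Longrightarrow> y \<in> carrier G \<Longrightarrow> inv x \<otimes> (x \<otimes> y) = y"
  "x \<in> carrier G \<Longrightarrow> y \<in> carrier G \<Longrightarrow> x \<otimes> (inv x \<otimes> y) = y"
  by (simp_all flip: m_assoc)

locale kurosh = group G for G (structure) +
  fixes I :: "'i set" and A :: "'i \<Rightarrow> 'a set" and K :: "'a set"
  assumes fp: "generate_free_product G I A"
    and gen: "generate G (\<Union>i\<in>I. A i) = carrier G"
    and K: "subgroup K G"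
begin

section \<open>The coset graph, its spanning tree and the candidate factors\<close>

definition cosets where "cosets = (\<lambda>g. g <# K) ` carrier G"

text \<open>The distance from \<open>K\<close> when cosets are joined by left multiplication with
  letters of the factors.\<close>

definition depth :: "'a set \<Rightarrow> nat" where
  "depth c = (LEAST n. \<exists>w \<in> lists (Sigma I A). length w = n \<and> word_value G w \<in> c)"

text \<open>The orbits of \<open>A i\<close> on the left cosets are the double cosets of
  \<open>A i\<close> and \<open>K\<close>.\<close>

definition orb where "orb i c = (\<lambda>a. a <# c) ` A i"

text \<open>The choice looks at the orbit only, so all cosets of an orbit share it; minimal depth
  directs it towards \<open>K\<close>.\<close>

definition base where "base i c = (ARG_MIN depth b. b \<in> orb i c)"

text \<open>An element of \<open>A i\<close> leading from the base coset to \<open>c\<close>. Its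
  value one at the base coset itself makes \<open>erep i c\<close> agree with \<open>rep c\<close>
  there.\<close>

definition shift where
  "shift i c = (if base i c = c then \<one> else SOME a. a \<in> A i \<and> a <# base i c = c)"

text \<open>A factor whose orbit leads from \<open>c\<close> to a coset nearer to \<open>K\<close>.
  For \<open>c = K\<close> the value is arbitrary.\<close>

definition parent where "parent c = (SOME i. i \<in> I \<and> depth (base i c) < depth c)"

text \<open>The cosets of \<open>K\<close> and the orbits of the factors on them are the vertices of a graph, whose
  edges are the pairs \<open>(i, c)\<close>. The recursion follows the spanning tree of the edges \<open>(i, base i c)\<close>
  and \<open>(parent c, c)\<close>.\<close>

function rep :: "'a set \<Rightarrow> 'a" where
  "rep c = (if depth (base (parent c) c) < depth c
            then shift (parent c) c \<otimes> rep (base (parent c) c) else \<one>)"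
  by auto
text \<open>The depth test belongs to the recursion equation, so termination holds whatever
  \<open>parent\<close> returns. On cosets other than \<open>K\<close> the test succeeds, and at
  \<open>K\<close> the default is one.\<close>

termination by (relation "measure depth") auto

declare rep.simps [simp del]

text \<open>The representative of \<open>c\<close> obtained by entering \<open>c\<close> from the
  base coset of its \<open>i\<close>-orbit; along a tree edge it agrees with
  \<open>rep c\<close>.\<close>

definition erep where "erep i c = shift i c \<otimes> rep (base i c)"

text \<open>The closed path at \<open>K\<close> through the edge \<open>(i, c)\<close>, as a group
  element: the discrepancy between two representatives of \<open>c\<close>, which therefore lies in
  \<open>K\<close>.\<close>

definition circuit where "circuit i c = inv (erep i c) \<otimes> rep c"

definition tree where "tree i c \<longleftrightarrow> c \<noteq> K \<and> i = parent c"

text \<open>One index for each edge off the spanning tree, and one for each orbit vertex,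
  represented by the edge to its base coset.\<close>

definition index where "index = {(i, c). i \<in> I \<and> c \<in> cosets \<and> \<not> (tree i c \<and> base i c \<noteq> c)}"

definition roots where "roots = {(i, c). i \<in> I \<and> c \<in> cosets \<and> base i c = c}"

text \<open>The stabiliser of the coset \<open>c\<close> in \<open>A i\<close>, conjugated into
  \<open>K\<close> by \<open>rep c\<close>; at a root it is the vertex group of the orbit.\<close>

definition stab where "stab i c = {k \<in> K. rep c \<otimes> k \<otimes> inv (rep c) \<in> A i}"

definition factor where
  "factor p = (if p \<in> roots then stab (fst p) (snd p)
               else range (\<lambda>n::int. circuit (fst p) (snd p) [^] n))"

section \<open>Left cosets and the action on them\<close>

lemma A_subgroup: "i \<in> I \<Longrightarrow> subgroup (A i) G"
  using free_product_subgroup[OF fp] by blast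

lemma A_closed: "i \<in> I \<Longrightarrow> a \<in> A i \<Longrightarrow> a \<in> carrier G"
  using A_subgroup subgroup.mem_carrier by metis

lemma K_closed: "k \<in> K \<Longrightarrow> k \<in> carrier G"
  using K subgroup.mem_carrier by metis

lemma K_sub: "K \<subseteq> carrier G"
  using K_closed by blast

lemma coset_sub: "c \<in> cosets \<Longrightarrow> c \<subseteq> carrier G"
  unfolding cosets_def using l_coset_subset_G[OF K_sub] by blast

lemma coset_closed: "c \<in> cosets \<Longrightarrow> g \<in> c \<Longrightarrow> g \<in> carrier G"
  using coset_sub by blast

lemma coset_act: "c \<in> cosets \<Longrightarrow> g \<in> carrier G \<Longrightarrow> g <# c \<in> cosets"
  unfolding cosets_def by (auto simp: lcos_m_assoc[OF K_sub])

lemma coset_act_mult: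
  "c \<in> cosets \<Longrightarrow> g \<in> carrier G \<Longrightarrow> h \<in> carrier G \<Longrightarrow> (g \<otimes> h) <# c = g <# (h <# c)"
  using coset_sub lcos_m_assoc by metis

lemma coset_act_one [simp]: "c \<in> cosets \<Longrightarrow> \<one> <# c = c"
  using coset_sub lcos_mult_one by metis

lemma K_coset: "K \<in> cosets"
  unfolding cosets_def using lcos_mult_one[OF K_sub] by (metis image_eqI one_closed)

lemma coset_eq: "c \<in> cosets \<Longrightarrow> g \<in> c \<Longrightarrow> g <# K = c"
  unfolding cosets_def using l_repr_independence[OF _ _ K] by force

lemma coset_ex: "c \<in> cosets \<Longrightarrow> \<exists>g. g \<in> c"
proof -
  assume "c \<in> cosets"
  then obtain g where "g \<in> carrier G" "c = g <# K" unfolding cosets_def by blast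
  then show ?thesis using subgroup.one_closed[OF K] by (auto simp: l_coset_def)
qed

lemma act_mem: "g \<in> c \<Longrightarrow> x \<otimes> g \<in> x <# c"
  by (auto simp: l_coset_def)

lemma same_coset: "c \<in> cosets \<Longrightarrow> g \<in> c \<Longrightarrow> h \<in> c \<Longrightarrow> inv g \<otimes> h \<in> K"
proof -
  assume *: "c \<in> cosets" "g \<in> c" "h \<in> c"
  then have "h \<in> g <# K" using coset_eq by simp
  then obtain k where "k \<in> K" "h = g \<otimes> k" by (auto simp: l_coset_def)
  then show ?thesis using coset_closed[OF *(1,2)] K_closed
    by (simp add: m_assoc[symmetric])
qed

section \<open>Orbits of the factors and their base cosets\<close>

lemma orb_mem: "i \<in> I \<Longrightarrow> c \<in> cosets \<Longrightarrow> c \<in> orb i c"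
  unfolding orb_def using subgroup.one_closed[OF A_subgroup] by (metis coset_act_one image_eqI)

lemma orb_eq:
  assumes "i \<in> I" "c \<in> cosets" "a \<in> A i"
  shows "orb i (a <# c) = orb i c"
proof
  note sg = A_subgroup[OF assms(1)]
  note cl = A_closed[OF assms(1)]
  show "orb i (a <# c) \<subseteq> orb i c"
  proof
    fix d assume "d \<in> orb i (a <# c)"
    then obtain b where "b \<in> A i" "d = b <# (a <# c)" by (auto simp: orb_def)
    then have "d = (b \<otimes> a) <# c" "b \<otimes> a \<in> A i"
      using coset_act_mult[OF assms(2)] cl assms(3) subgroup.m_closed[OF sg] by auto
    then show "d \<in> orb i c" unfolding orb_def by (rule image_eqI)
  qed
  show "orb i c \<subseteq> orb i (a <# c)"
  proof
    fix d assume "d \<in> orb i c"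
    then obtain b where b: "b \<in> A i" "d = b <# c" by (auto simp: orb_def)
    have "b = (b \<otimes> inv a) \<otimes> a" using b cl assms(3) by (simp add: m_assoc)
    then have "d = (b \<otimes> inv a) <# (a <# c)"
      using coset_act_mult[OF assms(2) m_closed[OF cl[OF b(1)] inv_closed[OF cl[OF assms(3)]]] cl[OF assms(3)]]
        b(2) by simp
    moreover have "b \<otimes> inv a \<in> A i"
      using b assms(3) subgroup.m_closed[OF sg] subgroup.m_inv_closed[OF sg] by simp
    ultimately show "d \<in> orb i (a <# c)" unfolding orb_def by (rule image_eqI)
  qed
qed

lemma base_act:
  "i \<in> I \<Longrightarrow> c \<in> cosets \<Longrightarrow> a \<in> A i \<Longrightarrow> base i (a <# c) = base i c"
  by (simp add: base_def orb_eq)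

lemma base_min:
  assumes "i \<in> I" "c \<in> cosets"
  shows "base i c \<in> orb i c" "b \<in> orb i c \<Longrightarrow> depth (base i c) \<le> depth b"
proof -
  show "base i c \<in> orb i c" unfolding base_def
    by (rule arg_min_natI[of "\<lambda>b. b \<in> orb i c", OF orb_mem[OF assms]])
  show "b \<in> orb i c \<Longrightarrow> depth (base i c) \<le> depth b" unfolding base_def
    by (rule arg_min_nat_le[of "\<lambda>b. b \<in> orb i c"])
qed

lemma base_coset: "i \<in> I \<Longrightarrow> c \<in> cosets \<Longrightarrow> base i c \<in> cosets"
proof -
  assume i: "i \<in> I" and c: "c \<in> cosets"
  obtain a where "a \<in> A i" "base i c = a <# c"
    using base_min(1)[OF i c] unfolding orb_def by blast
  then show ?thesis using coset_act[OF c A_closed[OF i]] by simp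
qed

lemma base_obtain:
  assumes "i \<in> I" "c \<in> cosets"
  obtains a where "a \<in> A i" "base i c = a <# c" "inv a \<in> A i" "(inv a) <# base i c = c"
proof -
  obtain a where a: "a \<in> A i" "base i c = a <# c"
    using base_min(1)[OF assms] unfolding orb_def by blast
  have "(inv a) <# base i c = c"
    using a A_closed[OF assms(1) a(1)] coset_act_mult[OF assms(2), of "inv a" a] assms by simp
  then show ?thesis
    using that[OF a subgroup.m_inv_closed[OF A_subgroup[OF assms(1)] a(1)]] by simp
qed

lemma base_base: "i \<in> I \<Longrightarrow> c \<in> cosets \<Longrightarrow> base i (base i c) = base i c"
proof -
  assume i: "i \<in> I" and c: "c \<in> cosets"
  obtain a where "a \<in> A i" "base i c = a <# c" "inv a \<in> A i" "(inv a) <# base i c = c"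
    using base_obtain[OF i c] .
  then show ?thesis using base_act[OF i c] by simp
qed

lemma base_root: "i \<in> I \<Longrightarrow> c \<in> cosets \<Longrightarrow> (i, base i c) \<in> roots"
  by (simp add: roots_def base_base base_coset)

lemma shift:
  assumes "i \<in> I" "c \<in> cosets"
  shows "shift i c \<in> A i" "shift i c <# base i c = c"
proof -
  have "shift i c \<in> A i \<and> shift i c <# base i c = c"
  proof (cases "base i c = c")
    case True
    then show ?thesis
      using subgroup.one_closed[OF A_subgroup[OF assms(1)]] assms by (simp add: shift_def)
  next
    case False
    obtain a where "a \<in> A i" "base i c = a <# c" "inv a \<in> A i" "(inv a) <# base i c = c"
      using base_obtain[OF assms] .
    then have "\<exists>a. a \<in> A i \<and> a <# base i c = c" by blast
    from someI_ex[OF this] show ?thesis unfolding shift_def using False by simp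
  qed
  then show "shift i c \<in> A i" "shift i c <# base i c = c" by auto
qed

section \<open>Depth, parents and representatives\<close>

lemma depth_K: "depth K = 0"
  unfolding depth_def using subgroup.one_closed[OF K]
  by (intro Least_equality) (auto intro!: bexI[of _ "[]"])

lemma depth_le: "w \<in> lists (Sigma I A) \<Longrightarrow> word_value G w \<in> c \<Longrightarrow> depth c \<le> length w"
  unfolding depth_def by (rule Least_le) blast

lemma depth_obtain:
  assumes "c \<in> cosets"
  obtains w where "w \<in> lists (Sigma I A)" "length w = depth c" "word_value G w \<in> c"
proof -
  obtain g where g: "g \<in> c" using coset_ex[OF assms] by blast
  then have "g \<in> generate G (\<Union>i\<in>I. A i)" using coset_closed[OF assms] gen by simp
  then obtain w where "w \<in> lists (Sigma I A)" "g = word_value G w"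
    using generate_words[OF free_product_subgroup[OF fp]] by auto
  then have "\<exists>n. \<exists>w \<in> lists (Sigma I A). length w = n \<and> word_value G w \<in> c" using g by blast
  then have "\<exists>w \<in> lists (Sigma I A). length w = depth c \<and> word_value G w \<in> c"
    unfolding depth_def by (rule LeastI_ex)
  then show ?thesis using that by blast
qed

text \<open>Deleting the first letter of a shortest word for \<open>c\<close> gives a coset of
  smaller depth in the orbit of \<open>c\<close> under the factor of that letter.\<close>

lemma parent:
  assumes c: "c \<in> cosets" "c \<noteq> K"
  shows "parent c \<in> I" "depth (base (parent c) c) < depth c"
proof -
  obtain w where w: "w \<in> lists (Sigma I A)" "length w = depth c" "word_value G w \<in> c"
    using depth_obtain[OF c(1)] .
  have "w \<noteq> []"
  proof
    assume "w = []"
    then have "\<one> \<in> c" using w by simp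
    then show False using coset_eq[OF c(1)] c(2) lcos_mult_one[OF K_sub] by metis
  qed
  then obtain i a v where v: "w = (i, a) # v" by (metis list.exhaust surj_pair)
  then have i: "i \<in> I" "a \<in> A i" "v \<in> lists (Sigma I A)" using w by auto
  have a: "a \<in> carrier G" "word_value G v \<in> carrier G" "inv a \<in> A i"
    using A_closed[OF i(1,2)] letters_closed[OF free_product_subgroup[OF fp] i(3)]
      subgroup.m_inv_closed[OF A_subgroup[OF i(1)] i(2)] by auto
  have "inv a \<otimes> word_value G w \<in> (inv a) <# c" using w(3) by (rule act_mem)
  then have "word_value G v \<in> (inv a) <# c" using v a by (simp add: m_assoc[symmetric])
  then have "depth ((inv a) <# c) < depth c" using depth_le[OF i(3)] w(2) v by fastforce
  moreover have "depth (base i c) \<le> depth ((inv a) <# c)"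
    using base_min(2)[OF i(1) c(1)] a(3) by (auto simp: orb_def)
  ultimately have "\<exists>i. i \<in> I \<and> depth (base i c) < depth c" using i(1) by fastforce
  then have "parent c \<in> I \<and> depth (base (parent c) c) < depth c"
    unfolding parent_def by (rule someI_ex)
  then show "parent c \<in> I" "depth (base (parent c) c) < depth c" by auto
qed

lemma rep_K: "rep K = \<one>"
  by (subst rep.simps) (simp add: depth_K)

lemma rep_parent: "c \<in> cosets \<Longrightarrow> c \<noteq> K \<Longrightarrow> rep c = erep (parent c) c"
  by (subst rep.simps) (simp add: parent erep_def)

lemma rep_mem: "c \<in> cosets \<Longrightarrow> rep c \<in> c"
proof (induction "depth c" arbitrary: c rule: less_induct)
  case less
  show ?case
  proof (cases "c = K")
    case True
    then show ?thesis using subgroup.one_closed[OF K] by (simp add: rep_K)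
  next
    case False
    note p = parent[OF less(2) False]
    have "rep (base (parent c) c) \<in> base (parent c) c"
      using less(1)[OF p(2)] base_coset[OF p(1) less(2)] by blast
    then show ?thesis
      unfolding rep_parent[OF less(2) False] erep_def using shift(2)[OF p(1) less(2)] act_mem by metis
  qed
qed

lemma rep_closed: "c \<in> cosets \<Longrightarrow> rep c \<in> carrier G"
  using rep_mem coset_closed by blast

lemma erep_mem: "i \<in> I \<Longrightarrow> c \<in> cosets \<Longrightarrow> erep i c \<in> c"
  unfolding erep_def using shift(2) act_mem rep_mem base_coset by metis

lemma erep_closed: "i \<in> I \<Longrightarrow> c \<in> cosets \<Longrightarrow> erep i c \<in> carrier G"
  using erep_mem coset_closed by blast

lemma erep_root: "c \<in> cosets \<Longrightarrow> base i c = c \<Longrightarrow> erep i c = rep c"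
  by (simp add: erep_def shift_def rep_closed)

section \<open>Circuits and stabilisers inside \<open>K\<close>\<close>

lemma circuit_K: "i \<in> I \<Longrightarrow> c \<in> cosets \<Longrightarrow> circuit i c \<in> K"
  unfolding circuit_def using same_coset erep_mem rep_mem by blast

text \<open>At a base coset the shift is one, and at a tree edge \<open>rep c\<close> was defined
  through that very edge.\<close>

lemma circuit_trivial:
  assumes "i \<in> I" "c \<in> cosets" "(i, c) \<in> roots \<or> (i, c) \<notin> index"
  shows "circuit i c = \<one>"
proof -
  consider "base i c = c" | "c \<noteq> K" "i = parent c"
    using assms by (auto simp: roots_def index_def tree_def)
  then have "erep i c = rep c"
    using erep_root[OF assms(2)] rep_parent[OF assms(2)] by cases auto
  then show ?thesis using rep_closed[OF assms(2)] by (simp add: circuit_def)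
qed

lemma roots_index: "roots \<subseteq> index"
  by (auto simp: roots_def index_def)

lemma stab_subgroup: "i \<in> I \<Longrightarrow> c \<in> cosets \<Longrightarrow> subgroup (stab i c) G"
proof -
  assume i: "i \<in> I" and c: "c \<in> cosets"
  note r = rep_closed[OF c]
  note sg = A_subgroup[OF i]
  show ?thesis
  proof (rule subgroup.intro)
    show "stab i c \<subseteq> carrier G" using K_sub by (auto simp: stab_def)
    show "\<one> \<in> stab i c"
      using r subgroup.one_closed[OF sg] subgroup.one_closed[OF K] by (simp add: stab_def)
    fix x assume x: "x \<in> stab i c"
    then have x': "x \<in> carrier G" using K_closed by (simp add: stab_def)
    have "inv (rep c \<otimes> x \<otimes> inv (rep c)) = rep c \<otimes> inv x \<otimes> inv (rep c)"
      using r x' by (simp add: inv_mult_group m_assoc)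
    then show "inv x \<in> stab i c"
      using x subgroup.m_inv_closed[OF sg] subgroup.m_inv_closed[OF K]
      unfolding stab_def by (metis (mono_tags, lifting) mem_Collect_eq)
    fix y assume y: "y \<in> stab i c"
    then have y': "y \<in> carrier G" using K_closed by (simp add: stab_def)
    have "(rep c \<otimes> x \<otimes> inv (rep c)) \<otimes> (rep c \<otimes> y \<otimes> inv (rep c))
        = rep c \<otimes> (x \<otimes> y) \<otimes> inv (rep c)"
      using r x' y' by (simp add: m_assoc inv_cancel_left)
    then show "x \<otimes> y \<in> stab i c"
      using x y subgroup.m_closed[OF sg] subgroup.m_closed[OF K]
      unfolding stab_def by (metis (mono_tags, lifting) mem_Collect_eq)
  qed
qed

lemma factor_subgroup: "p \<in> index \<Longrightarrow> subgroup (factor p) G"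
proof -
  assume p: "p \<in> index"
  then have p': "fst p \<in> I" "snd p \<in> cosets" by (auto simp: index_def)
  have "subgroup (range (\<lambda>n::int. x [^] n)) G" if x: "x \<in> carrier G" for x
  proof (rule subgroup.intro)
    show "\<one> \<in> range (\<lambda>n::int. x [^] n)" by (metis int_pow_0 rangeI)
  qed (use x in \<open>auto simp flip: int_pow_mult int_pow_neg\<close>)
  then show ?thesis
    using stab_subgroup[OF p'] K_closed[OF circuit_K[OF p']] by (simp add: factor_def)
qed

lemma factor_K: "p \<in> index \<Longrightarrow> factor p \<subseteq> K"
  using subgroup_int_pow_closed[OF K circuit_K]
  by (auto simp: factor_def stab_def index_def)

section \<open>Schreier's rewriting and generation of \<open>K\<close>\<close>

text \<open>Schreier's cocycle for the representatives \<open>erep i\<close>: it satisfies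
  \<open>a \<otimes> erep i c = erep i (a <# c) \<otimes> ret i a c\<close>.\<close>

definition ret where "ret i a c = inv (erep i (a <# c)) \<otimes> a \<otimes> erep i c"

text \<open>Both representatives run through the same base coset, so after conjugation by its
  \<open>rep\<close> only elements of \<open>A i\<close> remain.\<close>

lemma ret_stab:
  assumes "i \<in> I" "c \<in> cosets" "a \<in> A i"
  shows "ret i a c \<in> stab i (base i c)"
proof -
  note cl = A_closed[OF assms(1)]
  have ac: "a <# c \<in> cosets" using coset_act assms cl by blast
  note b = base_coset[OF assms(1,2)]
  define r where "r = rep (base i c)"
  define s where "s = shift i c"
  define s' where "s' = shift i (a <# c)"
  have e: "erep i c = s \<otimes> r" "erep i (a <# c) = s' \<otimes> r"
    using base_act[OF assms] by (simp_all add: erep_def r_def s_def s'_def)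
  have sA: "s \<in> A i" "s' \<in> A i" using shift(1) assms ac by (auto simp: s_def s'_def)
  have c: "s \<in> carrier G" "s' \<in> carrier G" "r \<in> carrier G" "a \<in> carrier G"
    using cl sA assms(3) rep_closed[OF b] by (auto simp: r_def)
  have "r \<otimes> ret i a c \<otimes> inv r = inv s' \<otimes> a \<otimes> s"
    unfolding ret_def e using c by (simp add: inv_mult_group m_assoc inv_cancel_left)
  also have "\<dots> \<in> A i"
    using sA assms(3) subgroup.m_closed[OF A_subgroup[OF assms(1)]]
      subgroup.m_inv_closed[OF A_subgroup[OF assms(1)]] by simp
  finally have "r \<otimes> ret i a c \<otimes> inv r \<in> A i" .
  moreover have "ret i a c \<in> K"
    unfolding ret_def using same_coset[OF ac erep_mem[OF assms(1) ac], of "a \<otimes> erep i c"]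
      act_mem[OF erep_mem[OF assms(1,2)]] c erep_closed assms ac by (simp add: m_assoc)
  ultimately show ?thesis by (simp add: stab_def r_def)
qed

lemma ret_mult:
  assumes "i \<in> I" "c \<in> cosets" "a \<in> A i" "b \<in> A i"
  shows "ret i (a \<otimes> b) c = ret i a (b <# c) \<otimes> ret i b c"
proof -
  have c: "a \<in> carrier G" "b \<in> carrier G" using A_closed assms by auto
  have bc: "b <# c \<in> cosets" "a <# (b <# c) \<in> cosets" using coset_act c assms by auto
  show ?thesis
    unfolding ret_def coset_act_mult[OF assms(2) c]
    using c bc erep_closed assms by (simp add: m_assoc inv_cancel_left)
qed

lemma ret_one: "i \<in> I \<Longrightarrow> c \<in> cosets \<Longrightarrow> ret i \<one> c = \<one>"
  using erep_closed by (simp add: ret_def)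

text \<open>A letter times \<open>rep c\<close> is \<open>rep\<close> of the new coset times
  elements of the factors. Hence every \<open>g\<close> is \<open>rep (g <# K)\<close> times an
  element of the generated subgroup, and \<open>rep K\<close> is one.\<close>

lemma generate_factors: "generate G (\<Union>p\<in>index. factor p) = K"
proof
  define K' where "K' = generate G (\<Union>p\<in>index. factor p)"
  have sub: "(\<Union>p\<in>index. factor p) \<subseteq> K" using factor_K by blast
  show "K' \<subseteq> K" unfolding K'_def by (rule generate_subgroup_incl[OF sub K])
  have K': "subgroup K' G" unfolding K'_def
    using sub K_sub by (intro generate_is_subgroup) blast
  have fac: "factor p \<subseteq> K'" if "p \<in> index" for p
    unfolding K'_def using that by (auto intro: generate.incl)
  have cyc: "circuit i c \<in> K'" if "i \<in> I" "c \<in> cosets" for i c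
  proof (cases "(i, c) \<in> index - roots")
    case True
    then have "circuit i c \<in> factor (i, c)"
      using K_closed[OF circuit_K[OF that]] by (auto simp: factor_def intro!: range_eqI[of _ _ 1])
    then show ?thesis using fac True by blast
  next
    case False
    then show ?thesis using circuit_trivial[OF that] subgroup.one_closed[OF K'] by auto
  qed
  have ret: "ret i a c \<in> K'" if "i \<in> I" "c \<in> cosets" "a \<in> A i" for i a c
    using ret_stab[OF that] base_root[OF that(1,2)] fac[of "(i, base i c)"] roots_index
    by (auto simp: factor_def)
  have step: "\<exists>k\<in>K'. a \<otimes> rep c = rep (a <# c) \<otimes> k" if "i \<in> I" "c \<in> cosets" "a \<in> A i" for i a c
  proof -
    have a: "a \<in> carrier G" using A_closed that by blast
    have ac: "a <# c \<in> cosets" using coset_act a that by blast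
    note cl = a rep_closed[OF that(2)] rep_closed[OF ac] erep_closed[OF that(1,2)] erep_closed[OF that(1) ac]
    \<comment> \<open>Passing from \<open>rep\<close> to \<open>erep\<close> costs one circuit at
      each end; between them stands the cocycle.\<close>
    have "rep (a <# c) \<otimes> (inv (circuit i (a <# c)) \<otimes> ret i a c \<otimes> circuit i c)
      = a \<otimes> rep c"
      unfolding circuit_def ret_def using cl by (simp add: m_assoc inv_mult_group inv_cancel_left)
    then show ?thesis
      using cyc[OF that(1,2)] cyc[OF that(1) ac] ret[OF that] subgroup.m_closed[OF K']
        subgroup.m_inv_closed[OF K'] by (metis (no_types, lifting))
  qed
  have all: "\<exists>k\<in>K'. g = rep (g <# K) \<otimes> k" if "g \<in> generate G (\<Union>i\<in>I. A i)" for g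
    using free_product_subgroup[OF fp] that
  proof (induction g rule: generate_family_induct)
    case one
    then show ?case
      using subgroup.one_closed[OF K'] lcos_mult_one[OF K_sub]
      by (auto simp: rep_K intro!: bexI[of _ \<one>])
  next
    case (mult i a g)
    then obtain k where k: "k \<in> K'" "g = rep (g <# K) \<otimes> k" by blast
    have c: "a \<in> carrier G" "g \<in> carrier G" "k \<in> carrier G"
      using A_closed mult gen subgroup.mem_carrier[OF K' k(1)] by auto
    have gK: "g <# K \<in> cosets" "a <# (g <# K) \<in> cosets" using c coset_act K_coset by auto
    obtain k' where k': "k' \<in> K'" "a \<otimes> rep (g <# K) = rep (a <# (g <# K)) \<otimes> k'"
      using step mult gK by blast
    have "a \<otimes> g = a \<otimes> rep (g <# K) \<otimes> k"
      using k(2) c rep_closed[OF gK(1)] by (metis m_assoc)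
    also have "\<dots> = rep ((a \<otimes> g) <# K) \<otimes> (k' \<otimes> k)"
      unfolding k'(2) using c rep_closed[OF gK(2)] subgroup.mem_carrier[OF K' k'(1)]
      by (simp add: m_assoc coset_act_mult[OF K_coset])
    finally show ?case using subgroup.m_closed[OF K' k'(1) k(1)] by blast
  qed
  show "K \<subseteq> K'"
  proof
    fix g assume g: "g \<in> K"
    then have "g <# K = K" using coset_eq[OF K_coset] by blast
    then obtain k where "k \<in> K'" "g = \<one> \<otimes> k" using all[of g] g K_closed gen rep_K by metis
    then show "g \<in> K'" using subgroup.mem_carrier[OF K'] by simp
  qed
qed

section \<open>The induced action on cosets and normal forms\<close>

text \<open>A group containing all letter groups. The integers stand in for the cyclic factors,
  whose generators are not yet known to have infinite order.\<close>

abbreviation "model \<equiv> G \<times>\<times> integer_group"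

definition letters where
  "letters p = (if p \<in> roots then stab (fst p) (snd p) \<times> {0::int} else {\<one>} \<times> UNIV)"

abbreviation "states \<equiv> nf_words model index letters"

text \<open>The intended action of the \<open>n\<close>-th power of \<open>circuit i c\<close> on
  states; it is trivial for tree edges and base edges, where the circuit is one.\<close>

definition twist where
  "twist i c n w = (if (i, c) \<in> index - roots then push model (i, c) (\<one>, n::int) w else w)"

text \<open>The action induced from \<open>K\<close>. It imitates \<open>a \<otimes> rep c = rep (a
  <# c) \<otimes> inv (circuit i (a <# c)) \<otimes> ret i a c \<otimes> circuit i c\<close>, with
  the last three elements acting on the state.\<close>

definition coset_action where
  "coset_action i a = (\<lambda>(c, w). (a <# c, twist i (a <# c) (- 1)
     (push model (i, base i c) (ret i a c, 0) (twist i c 1 w))))"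

lemma group_model: "group model"
  using DirProd_group[OF is_group group_integer_group] .

lemma letters_subgroup: "p \<in> index \<Longrightarrow> subgroup (letters p) model"
proof -
  assume p: "p \<in> index"
  then have p': "fst p \<in> I" "snd p \<in> cosets" by (auto simp: index_def)
  have Z: "subgroup {0::int} integer_group" "subgroup (UNIV :: int set) integer_group"
    using group.triv_subgroup[OF group_integer_group] group.subgroup_self[OF group_integer_group]
    by simp_all
  show ?thesis
    unfolding letters_def
    using DirProd_subgroups[OF is_group stab_subgroup[OF p'] group_integer_group Z(1)]
      DirProd_subgroups[OF is_group triv_subgroup group_integer_group Z(2)] by simp
qed

lemma push_action: "p \<in> index \<Longrightarrow> set_action model (letters p) states (push model p)"
  using group.push_family_action[OF group_model, of index letters] letters_subgroup
  by (simp add: family_action_def)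

lemma twist_closed: "w \<in> states \<Longrightarrow> twist i c n w \<in> states"
  using set_actionD(1)[OF push_action[of "(i, c)"], of "(\<one>, n)" w]
  by (auto simp: twist_def letters_def)

lemma twist_twist: "w \<in> states \<Longrightarrow> twist i c m (twist i c n w) = twist i c (m + n) w"
  using set_actionD(3)[OF push_action[of "(i, c)"], of "(\<one>, m)" "(\<one>, n)" w]
  by (auto simp: twist_def letters_def)

lemma twist_zero: "w \<in> states \<Longrightarrow> twist i c 0 w = w"
  using set_actionD(2)[OF push_action[of "(i, c)"], of w] by (auto simp: twist_def)

lemma twist_trivial: "(i, c) \<in> roots \<or> (i, c) \<notin> index \<Longrightarrow> twist i c n w = w"
  by (auto simp: twist_def)

lemma push_stab:
  assumes "i \<in> I" "c \<in> cosets" "h \<in> stab i (base i c)" "w \<in> states"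
  shows "push model (i, base i c) (h, 0) w \<in> states"
    "push model (i, base i c) (\<one>, 0) w = w"
    "h' \<in> stab i (base i c) \<Longrightarrow> push model (i, base i c) (h', 0) (push model (i, base i c) (h, 0) w) =
      push model (i, base i c) (h' \<otimes> h, 0) w"
proof -
  have r: "(i, base i c) \<in> roots" using base_root assms by blast
  note act = push_action[OF subsetD[OF roots_index r]]
  show "push model (i, base i c) (h, 0) w \<in> states"
    using set_actionD(1)[OF act, of "(h, 0)" w] r assms by (simp add: letters_def)
  show "push model (i, base i c) (\<one>, 0) w = w"
    using set_actionD(2)[OF act, of w] r assms by simp
  show "push model (i, base i c) (h', 0) (push model (i, base i c) (h, 0) w) =
      push model (i, base i c) (h' \<otimes> h, 0) w" if "h' \<in> stab i (base i c)"
    using set_actionD(3)[OF act, of "(h', 0)" "(h, 0)" w] r assms that by (simp add: letters_def)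
qed

text \<open>In a composite, the two twists at the intermediate coset cancel, and the cocycle
  identity \<open>ret_mult\<close> merges the stabiliser letters, which belong to the same base
  coset.\<close>

lemma coset_family_action: "family_action G I A (cosets \<times> states) coset_action"
  unfolding family_action_def set_action_def
proof (intro ballI conjI)
  fix i assume i: "i \<in> I"
  note cl = A_closed[OF i]
  show "coset_action i a s \<in> cosets \<times> states" if a: "a \<in> A i" and ss: "s \<in> cosets \<times> states" for a s
  proof -
    obtain c w where s: "s = (c, w)" "c \<in> cosets" "w \<in> states" using ss by auto
    show ?thesis unfolding s(1) coset_action_def
      using twist_closed push_stab(1)[OF i s(2) ret_stab[OF i s(2) a]] coset_act[OF s(2) cl[OF a]] s(3)
      by simp
  qed
  show "coset_action i \<one> s = s" if ss: "s \<in> cosets \<times> states" for s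
  proof -
    obtain c w where s: "s = (c, w)" "c \<in> cosets" "w \<in> states" using ss by auto
    have "\<one> \<in> A i" using subgroup.one_closed[OF A_subgroup[OF i]] .
    then have "\<one> \<in> stab i (base i c)" using ret_stab[OF i s(2)] ret_one[OF i s(2)] by metis
    then show ?thesis unfolding s(1) coset_action_def
      using twist_closed s push_stab(2)[OF i s(2), of \<one> "twist i c 1 w"]
      by (simp add: ret_one[OF i s(2)] twist_twist twist_zero)
  qed
  show "coset_action i (a \<otimes> b) s = coset_action i a (coset_action i b s)"
    if a: "a \<in> A i" and b: "b \<in> A i" and ss: "s \<in> cosets \<times> states" for a b s
  proof -
    obtain c w where s: "s = (c, w)" "c \<in> cosets" "w \<in> states" using ss by auto
    have bc: "b <# c \<in> cosets" using coset_act[OF s(2) cl[OF b]] .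
    have base: "base i (b <# c) = base i c" using base_act[OF i s(2) b] .
    define w1 where "w1 = twist i c 1 w"
    define w2 where "w2 = push model (i, base i c) (ret i b c, 0) w1"
    have w1: "w1 \<in> states" unfolding w1_def by (rule twist_closed[OF s(3)])
    have w2: "w2 \<in> states" unfolding w2_def by (rule push_stab(1)[OF i s(2) ret_stab[OF i s(2) b] w1])
    have "coset_action i a (coset_action i b s) = (a <# (b <# c), twist i (a <# (b <# c)) (- 1)
       (push model (i, base i c) (ret i a (b <# c), 0) w2))"
      unfolding s(1) coset_action_def using base w2
      by (simp add: w1_def[symmetric] w2_def[symmetric] twist_twist twist_zero)
    also have "push model (i, base i c) (ret i a (b <# c), 0) w2 =
        push model (i, base i c) (ret i (a \<otimes> b) c, 0) w1"
      unfolding w2_def ret_mult[OF i s(2) a b]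
      by (rule push_stab(3)[OF i s(2) ret_stab[OF i s(2) b] w1])
        (use ret_stab[OF i bc a] base in simp)
    finally show ?thesis
      unfolding s(1) coset_action_def using coset_act_mult[OF s(2) cl[OF a] cl[OF b]]
      by (simp add: w1_def[symmetric])
  qed
qed

text \<open>The actions of the \<open>A i\<close> extend to \<open>G\<close> by the universal
  property. Elements of \<open>K\<close> fix the coset \<open>K\<close>, so \<open>K\<close> acts on
  the states; each factor acts there by \<open>push\<close>, as van der Waerden's criterion
  requires.\<close>

theorem free_product_factors: "generate_free_product G index factor"
  and circuit_infinite_order:
    "\<And>i c n. (i, c) \<in> index - roots \<Longrightarrow> circuit i c [^] (n::int) = \<one> \<Longrightarrow> n = 0"
proof -
  obtain \<rho> where \<rho>: "set_action G (carrier G) (cosets \<times> states) \<rho>"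
    and \<rho>_act: "\<And>i a s. i \<in> I \<Longrightarrow> a \<in> A i \<Longrightarrow> s \<in> cosets \<times> states \<Longrightarrow> \<rho> a s = coset_action i a s"
    using free_product_action_extend[OF fp coset_family_action] unfolding gen by blast
  note \<rho>_closed = set_actionD(1)[OF \<rho>] and \<rho>_mult = set_actionD(3)[OF \<rho>]
  have fst_\<rho>: "fst (\<rho> g s) = g <# fst s" if g: "g \<in> carrier G" and s: "s \<in> cosets \<times> states" for g s
  proof -
    have "g \<in> generate G (\<Union>i\<in>I. A i)" using g gen by simp
    with free_product_subgroup[OF fp] show ?thesis
    proof (induction g rule: generate_family_induct)
      case one
      then show ?case using set_actionD(2)[OF \<rho> s] s by auto
    next
      case (mult i a g)
      have c: "a \<in> carrier G" "g \<in> carrier G" using A_closed mult gen by auto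
      have "\<rho> (a \<otimes> g) s = coset_action i a (\<rho> g s)"
        using \<rho>_mult[OF c s] \<rho>_act[OF mult(1,2) \<rho>_closed[OF c(2) s]] by simp
      then show ?case
        using mult(4) s coset_act_mult[OF _ c, of "fst s"] by (auto simp: coset_action_def split: prod.splits)
    qed
  qed
  \<comment> \<open>The assumption on the base coset is discharged twice: by the induction on depth
    in \<open>\<rho>_rep\<close>, and after it for all cosets.\<close>
  have \<rho>_erep0: "\<rho> (erep i c) (K, w) = (c, twist i c (- 1) w)"
    if i: "i \<in> I" and c: "c \<in> cosets" and w: "w \<in> states"
      and b: "\<rho> (rep (base i c)) (K, w) = (base i c, w)" for i c w
  proof -
    note bc = base_coset[OF i c]
    note sh = shift[OF i c]
    have "\<rho> (erep i c) (K, w) = coset_action i (shift i c) (base i c, w)"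
      unfolding erep_def
      using \<rho>_mult[OF A_closed[OF i sh(1)] rep_closed[OF bc]] \<rho>_act[OF i sh(1)] b w K_coset bc by simp
    also have "ret i (shift i c) (base i c) = \<one>"
      unfolding ret_def sh(2) erep_root[OF bc base_base[OF i c]]
      using A_closed[OF i sh(1)] rep_closed[OF bc] unfolding erep_def by (simp add: m_assoc)
    then have "coset_action i (shift i c) (base i c, w) = (c, twist i c (- 1) w)"
      unfolding coset_action_def
      using sh(2) base_base[OF i c] twist_trivial[OF disjI1[OF base_root[OF i c]]]
      using push_stab(2)[OF i c _ w, of \<one>] subgroup.one_closed[OF stab_subgroup[OF i bc]] by simp
    finally show ?thesis .
  qed
  \<comment> \<open>Representatives leave the state unchanged: they are built along tree edges,
    which carry no twist, and \<open>shift\<close> has trivial cocycle at the base coset.\<close>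
  have \<rho>_rep: "\<rho> (rep c) (K, w) = (c, w)" if "c \<in> cosets" and w: "w \<in> states" for c w
    using that(1)
  proof (induction "depth c" arbitrary: c rule: less_induct)
    case less
    show ?case
    proof (cases "c = K")
      case True
      then show ?thesis using set_actionD(2)[OF \<rho>] w K_coset by (simp add: rep_K)
    next
      case False
      note p = parent[OF less(2) False]
      have "\<rho> (erep (parent c) c) (K, w) = (c, twist (parent c) c (- 1) w)"
        using \<rho>_erep0[OF p(1) less(2) w] less(1)[OF p(2) base_coset[OF p(1) less(2)]] .
      moreover have "base (parent c) c \<noteq> c" using p(2) by auto
      then have "(parent c, c) \<notin> index" using False by (auto simp: index_def tree_def)
      ultimately show ?thesis using twist_trivial rep_parent[OF less(2) False] by simp
    qed
  qed
  have \<rho>_erep: "\<rho> (erep i c) (K, w) = (c, twist i c (- 1) w)"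
    if "i \<in> I" "c \<in> cosets" "w \<in> states" for i c w
    using \<rho>_erep0[OF that] \<rho>_rep[OF base_coset[OF that(1,2)] that(3)] .
  define \<psi> where "\<psi> k w = snd (\<rho> k (K, w))" for k w
  have \<psi>: "\<rho> k (K, w) = (K, \<psi> k w)" "\<psi> k w \<in> states" if k: "k \<in> K" and w: "w \<in> states" for k w
  proof -
    have s: "(K, w) \<in> cosets \<times> states" using K_coset w by simp
    have "fst (\<rho> k (K, w)) = K"
      using fst_\<rho>[OF K_closed[OF k] s] coset_eq[OF K_coset k] by simp
    then show "\<rho> k (K, w) = (K, \<psi> k w)" by (simp add: \<psi>_def prod_eq_iff)
    show "\<psi> k w \<in> states" using \<rho>_closed[OF K_closed[OF k] s] by (auto simp: \<psi>_def)
  qed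
  have \<psi>_action: "set_action G K states \<psi>"
    unfolding set_action_def
  proof (intro conjI ballI)
    show "\<psi> k w \<in> states" if "k \<in> K" "w \<in> states" for k w using \<psi>(2) that .
    show "\<psi> \<one> w = w" if "w \<in> states" for w
      using set_actionD(2)[OF \<rho>] K_coset that by (simp add: \<psi>_def)
    show "\<psi> (k \<otimes> l) w = \<psi> k (\<psi> l w)" if k: "k \<in> K" and l: "l \<in> K" and w: "w \<in> states" for k l w
      using \<rho>_mult[OF K_closed[OF k] K_closed[OF l], of "(K, w)"] \<psi>(1)[OF l w]
        \<psi>(1)[OF k \<psi>(2)[OF l w]] \<psi>(1)[OF subgroup.m_closed[OF K k l] w] K_coset w
      by simp
  qed
  \<comment> \<open>Evaluate \<open>\<rho>\<close> at
    \<open>rep b \<otimes> h = a \<otimes> rep b\<close> in two ways.\<close>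
  have \<psi>_stab: "\<psi> h w = push model p (h, 0) w"
    if p: "p \<in> roots" and h: "h \<in> stab (fst p) (snd p)" and w: "w \<in> states" for p h w
  proof -
    obtain i b where ib: "p = (i, b)" by force
    then have i: "i \<in> I" "b \<in> cosets" "base i b = b" and h: "h \<in> stab i b"
      using p h by (auto simp: roots_def)
    have hK: "h \<in> K" using h by (simp add: stab_def)
    define a where "a = rep b \<otimes> h \<otimes> inv (rep b)"
    have a: "a \<in> A i" using h by (simp add: stab_def a_def)
    note cl = K_closed[OF hK] rep_closed[OF i(2)] A_closed[OF i(1) a]
    have ah: "a \<otimes> rep b = rep b \<otimes> h" unfolding a_def using cl by (simp add: m_assoc)
    have "rep b \<otimes> h \<in> b"
      using coset_eq[OF i(2) rep_mem[OF i(2)]] hK by (auto simp: l_coset_def)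
    moreover have "a \<otimes> rep b \<in> a <# b" using act_mem[OF rep_mem[OF i(2)]] .
    ultimately have ab: "a <# b = b"
      using coset_eq[OF i(2)] coset_eq[OF coset_act[OF i(2) cl(3)]] ah by metis
    have r: "ret i a b = h"
      unfolding ret_def ab erep_root[OF i(2,3)]
      using cl ah by (simp add: m_assoc inv_cancel_left)
    have "\<rho> (a \<otimes> rep b) (K, w) = coset_action i a (b, w)"
      using \<rho>_mult[OF cl(3,2), of "(K, w)"] \<rho>_rep[OF i(2) w] \<rho>_act[OF i(1) a] K_coset w i(2) by simp
    also have "\<dots> = (b, push model (i, b) (h, 0) w)"
      unfolding coset_action_def using ab i(3) r p ib by (simp add: twist_trivial)
    finally have "\<rho> (rep b \<otimes> h) (K, w) = (b, push model (i, b) (h, 0) w)" by (simp add: ah)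
    moreover have "\<rho> (rep b \<otimes> h) (K, w) = (b, \<psi> h w)"
      using \<rho>_mult[OF cl(2,1), of "(K, w)"] \<psi>[OF hK w] \<rho>_rep[OF i(2)] K_coset w by simp
    ultimately show ?thesis by (simp add: ib)
  qed
  \<comment> \<open>Evaluate \<open>\<rho>\<close> at
    \<open>erep i c \<otimes> circuit i c = rep c\<close>: the twist by minus one undoes the action
    of the circuit.\<close>
  have \<psi>_circuit: "\<psi> (circuit i c) w = twist i c 1 w" if i: "i \<in> I" and c: "c \<in> cosets" and w: "w \<in> states" for i c w
  proof -
    note cK = circuit_K[OF i c]
    define w' where "w' = \<psi> (circuit i c) w"
    have w': "w' \<in> states" unfolding w'_def by (rule \<psi>(2)[OF cK w])
    have "erep i c \<otimes> circuit i c = rep c"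
      unfolding circuit_def using erep_closed[OF i c] rep_closed[OF c] by (simp add: inv_cancel_left)
    then have "(c, w) = \<rho> (erep i c \<otimes> circuit i c) (K, w)" using \<rho>_rep[OF c w] by simp
    also have "\<dots> = (c, twist i c (- 1) w')"
      using \<rho>_mult[OF erep_closed[OF i c] K_closed[OF cK], of "(K, w)"] \<psi>(1)[OF cK w]
        \<rho>_erep[OF i c w'] K_coset w by (simp add: w'_def)
    finally have "w = twist i c (- 1) w'" by simp
    then have "twist i c 1 w = twist i c 1 (twist i c (- 1) w')" by (rule arg_cong)
    then show ?thesis using w' by (simp add: twist_twist twist_zero w'_def)
  qed
  have \<psi>_pow: "\<psi> (circuit i c [^] n) w = twist i c n w"
    if i: "i \<in> I" and c: "c \<in> cosets" and w: "w \<in> states" for i c w and n :: int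
  proof -
    note cK = circuit_K[OF i c] K_closed[OF circuit_K[OF i c]]
    note pK = subgroup_int_pow_closed[OF K cK(1)]
    have step: "\<psi> (circuit i c [^] (m + 1)) w = \<psi> (circuit i c) (\<psi> (circuit i c [^] m) w)" for m :: int
      using set_actionD(3)[OF \<psi>_action cK(1) pK w] cK(2) int_pow_mult[of "circuit i c" 1 m]
      by (simp add: add.commute)
    show ?thesis
    proof (induction n rule: int_induct[where k = 0])
      case base
      then show ?case using set_actionD(2)[OF \<psi>_action w] w by (simp add: twist_zero)
    next
      case (step1 n)
      then show ?case using step[of n] \<psi>_circuit[OF i c twist_closed[OF w]] w
        by (simp add: twist_twist add.commute)
    next
      case (step2 n)
      have v: "\<psi> (circuit i c [^] (n - 1)) w \<in> states" using \<psi>(2)[OF pK w] .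
      have "twist i c 1 (\<psi> (circuit i c [^] (n - 1)) w) = twist i c n w"
        using step[of "n - 1"] \<psi>_circuit[OF i c v] step2(2) by simp
      then have "twist i c (- 1) (twist i c 1 (\<psi> (circuit i c [^] (n - 1)) w)) = twist i c (- 1) (twist i c n w)"
        by simp
      then show ?case using v w by (simp add: twist_twist twist_zero)
    qed
  qed
  define \<iota> where "\<iota> p l = (if p \<in> roots then fst l else circuit (fst p) (snd p) [^] (snd l :: int))" for p l
  show "n = 0" if p: "(i, c) \<in> index - roots" and n: "circuit i c [^] n = \<one>" for i c and n :: int
  proof (rule ccontr)
    assume "n \<noteq> 0"
    have "i \<in> I" "c \<in> cosets" using p by (auto simp: index_def)
    \<comment> \<open>A nonzero power of the circuit turns the empty state into a one-letter word,
      while the identity leaves it empty.\<close>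
    then have "\<psi> \<one> [] = twist i c n []" using \<psi>_pow[of i c "[]" n] n by simp
    then show False
      using set_actionD(2)[OF \<psi>_action, of "[]"] p \<open>n \<noteq> 0\<close> by (simp add: twist_def push_def)
  qed
  show "generate_free_product G index factor"
  proof (rule free_product_criterion[OF group_model _ _ _ K \<psi>_action])
    show "\<forall>p\<in>index. subgroup (letters p) model" using letters_subgroup by blast
    show "\<forall>p\<in>index. subgroup (factor p) G" using factor_subgroup by blast
    show "factor p \<subseteq> K" if "p \<in> index" for p using factor_K that .
    show "factor p = \<iota> p ` letters p" if "p \<in> index" for p
      unfolding factor_def letters_def \<iota>_def by (auto simp: image_iff)
    show "\<iota> p \<one>\<^bsub>model\<^esub> = \<one>" if "p \<in> index" for p by (simp add: \<iota>_def)
    show "\<psi> (\<iota> p l) w = push model p l w" if p: "p \<in> index" and l: "l \<in> letters p" and w: "w \<in> states" for p l w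
    proof (cases "p \<in> roots")
      case True
      then show ?thesis using \<psi>_stab[OF True _ w, of "fst l"] l by (auto simp: \<iota>_def letters_def)
    next
      case False
      have "fst p \<in> I" "snd p \<in> cosets" using p by (auto simp: index_def)
      then show ?thesis
        using \<psi>_pow[of "fst p" "snd p" w "snd l"] p l w False
        by (auto simp: \<iota>_def letters_def twist_def)
    qed
  qed
qed

section \<open>Intersections with conjugates and double cosets\<close>

lemma stab_conjugate:
  assumes "i \<in> I" "c \<in> cosets"
  shows "stab i c = K \<inter> conjugate_by G (inv (rep c)) (A i)"
proof (intro equalityI subsetI)
  note r = rep_closed[OF assms(2)]
  show "k \<in> K \<inter> conjugate_by G (inv (rep c)) (A i)" if "k \<in> stab i c" for k
  proof -
    have k: "k \<in> K" "rep c \<otimes> k \<otimes> inv (rep c) \<in> A i" using that by (auto simp: stab_def)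
    have "k = inv (rep c) \<otimes> (rep c \<otimes> k \<otimes> inv (rep c)) \<otimes> inv (inv (rep c))"
      using K_closed[OF k(1)] r by (simp add: m_assoc inv_cancel_left)
    then show ?thesis using k unfolding conjugate_by_def by blast
  qed
  show "k \<in> stab i c" if k: "k \<in> K \<inter> conjugate_by G (inv (rep c)) (A i)" for k
  proof -
    obtain a where a: "a \<in> A i" "k = inv (rep c) \<otimes> a \<otimes> inv (inv (rep c))"
      using k unfolding conjugate_by_def by blast
    have "rep c \<otimes> k \<otimes> inv (rep c) = a"
      using a A_closed[OF assms(1) a(1)] r by (simp add: m_assoc inv_cancel_left)
    then show ?thesis using k a by (simp add: stab_def)
  qed
qed

text \<open>Inversion turns orbits of \<open>A i\<close> on left cosets into double cosets
  \<open>K g (A i)\<close>; the root for \<open>g\<close> is the base of the orbit of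
  \<open>(inv g) <# K\<close>.\<close>

lemma root_double_coset:
  assumes i: "i \<in> I" and g: "g \<in> carrier G"
  shows "\<exists>c. (i, c) \<in> roots \<and> (\<exists>k\<in>K. \<exists>a\<in>A i. g = k \<otimes> inv (rep c) \<otimes> a)"
proof -
  define c where "c = (inv g) <# K"
  have c: "c \<in> cosets" using g by (simp add: cosets_def c_def)
  obtain a where a: "a \<in> A i" "base i c = a <# c" "inv a \<in> A i" "(inv a) <# base i c = c"
    using base_obtain[OF i c] .
  note ac = A_closed[OF i a(1)]
  have "inv g \<in> c" using subgroup.one_closed[OF K] g
    by (auto simp: c_def l_coset_def intro!: bexI[of _ \<one>])
  then have "a \<otimes> inv g \<in> base i c" unfolding a(2) by (rule act_mem)
  then have k: "inv (a \<otimes> inv g) \<otimes> rep (base i c) \<in> K" (is "?k \<in> K")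
    using same_coset[OF base_coset[OF i c] _ rep_mem[OF base_coset[OF i c]]] by blast
  have "g = ?k \<otimes> inv (rep (base i c)) \<otimes> a"
    using g ac rep_closed[OF base_coset[OF i c]] by (simp add: m_assoc inv_mult_group inv_cancel_left)
  then show ?thesis using k a(1) base_root[OF i c] by blast
qed

text \<open>The equation puts \<open>rep d\<close> into a coset of the orbit of \<open>c\<close>,
  and an orbit has a single base coset.\<close>

lemma root_unique:
  assumes c: "(i, c) \<in> roots" and d: "(i, d) \<in> roots" and k: "k \<in> K" and a: "a \<in> A i"
    and eq: "inv (rep d) = k \<otimes> inv (rep c) \<otimes> a"
  shows "c = d"
proof -
  have i: "i \<in> I" and cd: "c \<in> cosets" "d \<in> cosets" "base i c = c" "base i d = d"
    using c d by (auto simp: roots_def)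
  note cl = A_closed[OF i a] K_closed[OF k] rep_closed[OF cd(1)] rep_closed[OF cd(2)]
  have "rep d = inv (k \<otimes> inv (rep c) \<otimes> a)" using eq cl by (metis inv_inv)
  also have "\<dots> = inv a \<otimes> (rep c \<otimes> inv k)" using cl by (simp add: inv_mult_group m_assoc)
  finally have "rep d = inv a \<otimes> (rep c \<otimes> inv k)" .
  moreover have "rep c \<otimes> inv k \<in> c"
    using coset_eq[OF cd(1) rep_mem[OF cd(1)]] subgroup.m_inv_closed[OF K k]
    by (auto simp: l_coset_def)
  ultimately have "rep d \<in> (inv a) <# c" using act_mem by simp
  then have "d = (inv a) <# c"
    using coset_eq[OF cd(2) rep_mem[OF cd(2)]] coset_eq[OF coset_act[OF cd(1), of "inv a"]] cl by simp
  then show ?thesis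
    using base_act[OF i cd(1) subgroup.m_inv_closed[OF A_subgroup[OF i] a]] cd by simp
qed

end

text \<open>The members of \<open>R\<close> index the double cosets of \<open>K\<close> and the factors.\<close>

theorem (in group) kurosh_subgroup:
  fixes I :: "'i set"
  assumes "generate_free_product G I A" "generate G (\<Union>i\<in>I. A i) = carrier G" "subgroup K G"
  obtains R J :: "('i \<times> 'a set) set" and H x where
    "R \<subseteq> J" "generate_free_product G J H" "generate G (\<Union>p\<in>J. H p) = K"
    "\<And>i c. (i, c) \<in> R \<Longrightarrow> i \<in> I \<and> x c \<in> carrier G \<and> H (i, c) = K \<inter> conjugate_by G (x c) (A i)"
    "\<And>i g. i \<in> I \<Longrightarrow> g \<in> carrier G \<Longrightarrow>
       \<exists>c. (i, c) \<in> R \<and> (\<exists>k\<in>K. \<exists>a\<in>A i. g = k \<otimes> x c \<otimes> a)"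
    "\<And>i c d k a. (i, c) \<in> R \<Longrightarrow> (i, d) \<in> R \<Longrightarrow> k \<in> K \<Longrightarrow> a \<in> A i \<Longrightarrow>
       x d = k \<otimes> x c \<otimes> a \<Longrightarrow> c = d"
    "\<And>p. p \<in> J - R \<Longrightarrow> \<exists>t\<in>carrier G. H p = range (\<lambda>n::int. t [^] n) \<and>
       (\<forall>n::int. t [^] n = \<one> \<longrightarrow> n = 0)"
proof -
  interpret kurosh G I A K using assms by (intro kurosh.intro kurosh_axioms.intro is_group)
  show ?thesis
  proof (rule that[OF roots_index free_product_factors generate_factors, of "\<lambda>c. inv (rep c)"])
    show "i \<in> I \<and> inv (rep c) \<in> carrier G \<and> factor (i, c) = K \<inter> conjugate_by G (inv (rep c)) (A i)"
      if "(i, c) \<in> roots" for i c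
      using that stab_conjugate[of i c] rep_closed[of c] by (auto simp: roots_def factor_def)
    show "\<exists>t\<in>carrier G. factor p = range (\<lambda>n::int. t [^] n) \<and> (\<forall>n::int. t [^] n = \<one> \<longrightarrow> n = 0)"
      if "p \<in> index - roots" for p
    proof -
      obtain i c where p: "p = (i, c)" by force
      have "i \<in> I" "c \<in> cosets" using that p by (auto simp: index_def)
      then have "circuit i c \<in> carrier G" using K_closed[OF circuit_K] by simp
      then show ?thesis using circuit_infinite_order[of i c] that p by (auto simp: factor_def)
    qed
  qed (use root_double_coset root_unique in auto)
qed

section \<open>Operations on free products\<close>

text \<open>Inequality of truth values is addition modulo two, so this is a homomorphism from
  \<open>K\<close> to the group of order two, with \<open>False\<close> as identity.\<close>

definition bool_hom :: "('a, 'm) monoid_scheme \<Rightarrow> 'a set \<Rightarrow> ('a \<Rightarrow> bool) \<Rightarrow> bool" where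
  "bool_hom G K h \<longleftrightarrow> (\<forall>x\<in>K. \<forall>y\<in>K. h (x \<otimes>\<^bsub>G\<^esub> y) = (h x \<noteq> h y))"

lemma nf_words_append:
  assumes "v \<in> nf_words G I H" "w \<in> nf_words G I H" "v \<noteq> [] \<Longrightarrow> w \<noteq> [] \<Longrightarrow> fst (last v) \<noteq> fst (hd w)"
  shows "v @ w \<in> nf_words G I H"
  using assms by (auto simp: nf_words_def alternating_words_def successively_append_iff)

context group
begin

lemma generate_closed_family:
  assumes "\<forall>j\<in>J. subgroup (H j) G"
  shows "(\<Union>j\<in>J. H j) \<subseteq> carrier G"
proof
  fix x assume "x \<in> (\<Union>j\<in>J. H j)"
  then obtain j where "j \<in> J" "x \<in> H j" by blast
  then show "x \<in> carrier G" using subgroup.mem_carrier[OF bspec[OF assms]] by simp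
qed

text \<open>Pushing the letters of a normal form onto the empty word rebuilds it, and the action of
  a word depends on its value alone.\<close>

lemma nf_words_unique:
  assumes fp: "generate_free_product G I H" and v: "v \<in> nf_words G I H" and w: "w \<in> nf_words G I H"
    and eq: "word_value G v = word_value G w"
  shows "v = w"
proof -
  have id: "fold_act (push G) u [] = u" if "u \<in> nf_words G I H" for u
    using that
  proof (induction u)
    case (Cons p u)
    then show ?case using push_nf_words[of "fst p" "snd p" u G I H] by (cases p) (simp add: nf_words_Cons)
  qed simp
  have "fold_act (push G) v [] = fold_act (push G) w []"
    using free_product_word_unique_action[OF fp push_family_action[OF free_product_subgroup[OF fp]]
      subsetD[OF nf_words_subset_lists v] subsetD[OF nf_words_subset_lists w] eq] by simp
  then show ?thesis using id v w by simp
qed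

lemma word_value_push:
  assumes "generate_free_product G I H" "i \<in> I" "a \<in> H i" "w \<in> nf_words G I H"
  shows "word_value G (push G i a w) = a \<otimes> word_value G w"
  using fold_act_push[OF free_product_subgroup[OF assms(1)]
      left_mult_family_action[OF free_product_subgroup[OF assms(1)]] assms(2-4) one_closed]
  unfolding word_value_fold_act by simp

section \<open>Coarsening and refining free products\<close>

text \<open>Each coarse letter expands to a normal form within its block. Neighbouring coarse
  letters come from different blocks, so the expansions concatenate without cancellation.\<close>

lemma free_product_group:
  fixes f :: "'j \<Rightarrow> 'k"
  assumes fp: "generate_free_product G J H"
  shows "generate_free_product G M (\<lambda>m. generate G (\<Union>j\<in>{j\<in>J. f j = m}. H j))"
proof -
  define B where "B m = generate G (\<Union>j\<in>{j\<in>J. f j = m}. H j)" for m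
  note H = free_product_subgroup[OF fp]
  have Hm: "\<forall>j\<in>{j\<in>J. f j = m}. subgroup (H j) G" for m using H by simp
  have expand: "\<exists>w' \<in> nf_words G J H. w' \<noteq> [] \<and> word_value G w' = word_value G w \<and> f (fst (hd w')) = fst (hd w)"
    if "w \<in> nf_words G M B" "w \<noteq> []" for w
    using that
  proof (induction w)
    case (Cons p v)
    obtain m b where p: "p = (m, b)" by force
    have b: "b \<in> B m" "b \<noteq> \<one>" and v: "v \<in> nf_words G M B" "v = [] \<or> fst (hd v) \<noteq> m"
      using Cons(2) p by (auto simp: nf_words_Cons)
    obtain u where u: "u \<in> nf_words G {j\<in>J. f j = m} H" "word_value G u = b"
      using generate_nf_words[OF Hm b(1)[unfolded B_def]] .
    have u': "u \<noteq> []" "u \<in> nf_words G J H" using u b nf_words_mono[OF u(1)] by auto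
    have fu: "f (fst x) = m" if "x \<in> set u" for x
      using that subsetD[OF nf_words_subset_lists u(1)] by (auto simp: in_lists_conv_set)
    show ?case
    proof (cases "v = []")
      case True
      have "b \<in> carrier G" using u' letters_closed[OF H subsetD[OF nf_words_subset_lists u'(2)]] u(2) by force
      then show ?thesis using True u u' fu[of "hd u"] p by (intro bexI[of _ u]) auto
    next
      case False
      then obtain v' where v': "v' \<in> nf_words G J H" "v' \<noteq> []" "word_value G v' = word_value G v"
        "f (fst (hd v')) = fst (hd v)" using Cons.IH v by blast
      have "fst (last u) \<noteq> fst (hd v')" using fu[of "last u"] v' v False u' by auto
      then have "u @ v' \<in> nf_words G J H" using nf_words_append u' v' by blast
      moreover have "word_value G (u @ v') = word_value G u \<otimes> word_value G v'"
        using word_value_append[OF H] u' v' nf_words_subset_lists by blast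
      ultimately show ?thesis using u u' v' p fu[of "hd u"] by (intro bexI[of _ "u @ v'"]) auto
    qed
  qed simp
  have "w = []" if w: "w \<in> nf_words G M B" "word_value G w = \<one>" for w
  proof (rule ccontr)
    assume "w \<noteq> []"
    then obtain w' where "w' \<in> nf_words G J H" "w' \<noteq> []" "word_value G w' = \<one>"
      using expand[OF w(1)] w(2) by auto
    then show False using fp unfolding generate_free_product_nf by blast
  qed
  moreover have "subgroup (B m) G" for m
    unfolding B_def by (rule generate_is_subgroup[OF generate_closed_family[OF Hm]])
  ultimately have "generate_free_product G M B" by (simp add: generate_free_product_nf)
  then show ?thesis by (simp add: B_def[abs_def])
qed

text \<open>By uniqueness of normal forms, the word for \<open>h\<close> over \<open>J0\<close> is
  the single letter \<open>(j, h)\<close>.\<close>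

lemma free_product_generate_mem:
  assumes fp: "generate_free_product G J H" and j: "j \<in> J" "h \<in> H j" "h \<noteq> \<one>"
    and h: "h \<in> generate G (\<Union>i\<in>J0. H i)" and J0: "J0 \<subseteq> J"
  shows "j \<in> J0"
proof -
  have H: "\<forall>j\<in>J0. subgroup (H j) G" using free_product_subgroup[OF fp] J0 by blast
  obtain w where w: "w \<in> nf_words G J0 H" "word_value G w = h" using generate_nf_words[OF H h] .
  have "h \<in> carrier G" using subgroup.mem_carrier[OF bspec[OF free_product_subgroup[OF fp] j(1)] j(2)] .
  then have "w = [(j, h)]"
    using nf_words_unique[OF fp nf_words_mono[OF w(1) J0], of "[(j, h)]"] j w(2) by (simp add: nf_words_Cons)
  then show ?thesis using w(1) by (simp add: nf_words_Cons)
qed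

lemma free_product_reindex:
  assumes fp: "generate_free_product G J H" and f: "inj_on f J'" "f ` J' \<subseteq> J"
  shows "generate_free_product G J' (\<lambda>j. H (f j))"
  unfolding generate_free_product_nf
proof (intro conjI ballI impI)
  show "subgroup (H (f j)) G" if "j \<in> J'" for j
    using that f free_product_subgroup[OF fp] by blast
  fix w assume w: "w \<in> nf_words G J' (\<lambda>j. H (f j))" "word_value G w = \<one>"
  have "map (apfst f) w \<in> nf_words G J H \<and> word_value G (map (apfst f) w) = word_value G w"
    using w(1)
  proof (induction w)
    case (Cons p w)
    obtain i a where p: "p = (i, a)" by force
    then show ?case using f Cons by (cases w) (auto simp: nf_words_Cons inj_on_def)
  qed simp
  then show "w = []" using fp w(2) by (auto simp: generate_free_product_nf)
qed

text \<open>Each \<open>B m\<close> acts on the fine normal forms by its own universal property, and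
  these actions combine because the \<open>B m\<close> form a free product. On fine letters the
  result is \<open>push\<close>, so van der Waerden's criterion applies.\<close>

lemma free_product_refine:
  assumes fp: "generate_free_product G M B"
    and fps: "\<And>m. m \<in> M \<Longrightarrow> generate_free_product G (J m) (H m)"
    and gen: "\<And>m. m \<in> M \<Longrightarrow> generate G (\<Union>j\<in>J m. H m j) = B m"
  shows "generate_free_product G (Sigma M J) (\<lambda>(m, j). H m j)"
proof -
  define H' where "H' = (\<lambda>(m, j). H m j)"
  have H': "\<forall>p\<in>Sigma M J. subgroup (H' p) G"
    using free_product_subgroup[OF fps] by (auto simp: H'_def)
  define S where "S = nf_words G (Sigma M J) H'"
  have "\<exists>\<rho>. set_action G (B m) S \<rho> \<and> (\<forall>j\<in>J m. \<forall>h\<in>H m j. \<forall>s\<in>S. \<rho> h s = push G (m, j) h s)"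
    if m: "m \<in> M" for m
  proof -
    have "family_action G (J m) (H m) S (\<lambda>j. push G (m, j))"
      using push_family_action[OF H'] m by (auto simp: family_action_def S_def H'_def)
    from free_product_action_extend[OF fps[OF m] this] gen[OF m] show ?thesis by metis
  qed
  then obtain \<rho> where \<rho>: "\<And>m. m \<in> M \<Longrightarrow> set_action G (B m) S (\<rho> m)"
    "\<And>m j h s. m \<in> M \<Longrightarrow> j \<in> J m \<Longrightarrow> h \<in> H m j \<Longrightarrow> s \<in> S \<Longrightarrow> \<rho> m h s = push G (m, j) h s"
    by metis
  have "family_action G M B S \<rho>" using \<rho>(1) by (simp add: family_action_def)
  then obtain \<sigma> where \<sigma>: "set_action G (generate G (\<Union>m\<in>M. B m)) S \<sigma>"
    "\<And>m b s. m \<in> M \<Longrightarrow> b \<in> B m \<Longrightarrow> s \<in> S \<Longrightarrow> \<sigma> b s = \<rho> m b s"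
    using free_product_action_extend[OF fp] by blast
  have HB: "H m j \<subseteq> B m" if "m \<in> M" "j \<in> J m" for m j
    using gen[OF that(1)] that(2) by (auto intro: generate.incl)
  have "generate_free_product G (Sigma M J) H'"
  proof (rule free_product_criterion[OF is_group H' H', where \<iota> = "\<lambda>_ x. x"])
    show "subgroup (generate G (\<Union>m\<in>M. B m)) G"
      by (rule generate_is_subgroup[OF generate_closed_family[OF free_product_subgroup[OF fp]]])
    show "set_action G (generate G (\<Union>m\<in>M. B m)) (nf_words G (Sigma M J) H') \<sigma>"
      using \<sigma>(1) by (simp add: S_def)
    show "H' p \<subseteq> generate G (\<Union>m\<in>M. B m)" if "p \<in> Sigma M J" for p
      using that HB by (auto simp: H'_def intro!: generate.incl)
    show "\<sigma> l w = push G p l w" if asm: "p \<in> Sigma M J" "l \<in> H' p" "w \<in> nf_words G (Sigma M J) H'" for p l w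
    proof -
      obtain m j where p: "p = (m, j)" "m \<in> M" "j \<in> J m" using asm(1) by auto
      have l: "l \<in> H m j" "l \<in> B m" "w \<in> S" using asm HB p by (auto simp: H'_def S_def)
      show ?thesis using \<sigma>(2)[OF p(2) l(2,3)] \<rho>(2)[OF p(2,3) l(1,3)] p(1) by simp
    qed
  qed auto
  then show ?thesis by (simp add: H'_def)
qed

section \<open>Malnormality of the factors\<close>

text \<open>A trailing letter of \<open>g\<close> from \<open>H i\<close> is absorbed into
  \<open>a\<close>, which leaves a prefix \<open>v\<close> not ending in \<open>i\<close>. Then
  \<open>b\<close> times \<open>v\<close> equals \<open>v\<close> times \<open>a'\<close>; pushing
  one letter on the left cannot amount to appending one on the right unless \<open>v\<close> is
  empty.\<close>

lemma free_product_malnormal: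
  assumes fp: "generate_free_product G J H" and gen: "generate G (\<Union>j\<in>J. H j) = carrier G"
    and ij: "i \<in> J" "j \<in> J" and g: "g \<in> carrier G" and a: "a \<in> H i" "a \<noteq> \<one>"
    and b: "g \<otimes> a \<otimes> inv g \<in> H j"
  shows "i = j \<and> g \<in> H i"
proof -
  note H = free_product_subgroup[OF fp]
  note sg = bspec[OF H ij(1)]
  note cl = subgroup.mem_carrier[OF sg]
  obtain w where w: "w \<in> nf_words G J H" "word_value G w = g"
    using generate_nf_words[OF H, of g] gen g by blast
  obtain v c where v: "v \<in> nf_words G J H" "v = [] \<or> fst (last v) \<noteq> i" and c: "c \<in> H i"
    and gvc: "g = word_value G v \<otimes> c"
  proof (cases "w = [] \<or> fst (last w) \<noteq> i")
    case True
    then show ?thesis using that[OF w(1) _ subgroup.one_closed[OF sg]] w(2) g by simp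
  next
    case False
    define v where "v = butlast w"
    obtain c where wv: "w = v @ [(i, c)]" unfolding v_def
      using False append_butlast_last_id[of w] by (metis prod.collapse)
    have v: "v \<in> nf_words G J H" "v = [] \<or> fst (last v) \<noteq> i" and c: "c \<in> H i"
      using w(1) unfolding wv by (auto simp: nf_words_def alternating_words_def successively_append_iff)
    have "g = word_value G v \<otimes> c"
      using word_value_append[OF H, of v "[(i, c)]"] w(2) subsetD[OF nf_words_subset_lists v(1)] c ij(1) cl[OF c]
      by (simp add: wv)
    then show ?thesis using that v c by blast
  qed
  have vc: "word_value G v \<in> carrier G"
    using letters_closed[OF H subsetD[OF nf_words_subset_lists v(1)]] by simp
  define a' where "a' = c \<otimes> a \<otimes> inv c"
  have a': "a' \<in> H i" unfolding a'_def
    using a c subgroup.m_closed[OF sg] subgroup.m_inv_closed[OF sg] by simp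
  have "a' \<noteq> \<one>"
  proof
    assume "a' = \<one>"
    then have "inv c \<otimes> a' \<otimes> c = \<one>" using cl[OF c] by simp
    then show False using cl[OF c] cl[OF a(1)] a(2) by (simp add: a'_def m_assoc inv_cancel_left)
  qed
  define b where "b = g \<otimes> a \<otimes> inv g"
  have "b \<otimes> word_value G v = word_value G v \<otimes> a'"
    unfolding b_def a'_def gvc using cl[OF c] cl[OF a(1)] vc
    by (simp add: m_assoc inv_mult_group inv_cancel_left)
  moreover have "word_value G (v @ [(i, a')]) = word_value G v \<otimes> a'"
    using word_value_append[OF H subsetD[OF nf_words_subset_lists v(1)], of "[(i, a')]"] ij(1) a' cl[OF a'] by simp
  moreover have bj: "b \<in> H j" using assms(8) by (simp add: b_def)
  moreover have va: "v @ [(i, a')] \<in> nf_words G J H"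
    using v a' \<open>a' \<noteq> \<one>\<close> ij(1) by (intro nf_words_append) (auto simp: nf_words_Cons)
  ultimately have eq: "push G j b v = v @ [(i, a')]"
    using word_value_push[OF fp ij(2) bj v(1)]
    by (intro nf_words_unique[OF fp push_closed[OF H ij(2) bj v(1)] va]) simp
  have "b \<noteq> \<one>" using eq by (auto simp: push_def)
  \<comment> \<open>Merging or cancelling does not lengthen \<open>v\<close>, and prepending
    \<open>(j, b)\<close> would make it equal to the first letter of \<open>v\<close>, whose index
    is then different from \<open>j\<close>.\<close>
  have "v = []"
  proof (cases v)
    case (Cons p u)
    then show ?thesis using eq \<open>b \<noteq> \<one>\<close>
      by (cases p; cases "fst p = j"; cases "b \<otimes> snd p = \<one>") (auto simp: push_def dest: arg_cong[of _ _ length])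
  qed simp
  then show ?thesis using eq \<open>b \<noteq> \<one>\<close> gvc c cl[OF c] by (auto simp: push_def)
qed

section \<open>Homomorphisms to the group of order two and finite generation\<close>

text \<open>Let each factor translate a two-point set. The extended action is again by translations,
  and the image of \<open>False\<close> records the translation.\<close>

lemma free_product_bool_hom_extend:
  assumes fp: "generate_free_product G I H" and f: "\<And>i. i \<in> I \<Longrightarrow> bool_hom G (H i) (f i)"
  obtains h where "bool_hom G (generate G (\<Union>i\<in>I. H i)) h" "\<And>i a. i \<in> I \<Longrightarrow> a \<in> H i \<Longrightarrow> h a = f i a"
proof -
  note H = free_product_subgroup[OF fp]
  have f1: "\<not> f i \<one>" if "i \<in> I" for i
    using f[OF that] subgroup.one_closed[OF bspec[OF H that]] unfolding bool_hom_def by (metis l_one one_closed)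
  have fam: "family_action G I H UNIV (\<lambda>i a s. f i a \<noteq> s)"
    unfolding family_action_def set_action_def
  proof (intro ballI conjI)
    fix i s assume i: "i \<in> I"
    show "(f i \<one> \<noteq> s) = s" using f1[OF i] by simp
    fix a b assume "a \<in> H i" "b \<in> H i"
    then have "f i (a \<otimes> b) = (f i a \<noteq> f i b)" using f[OF i] by (simp add: bool_hom_def)
    then show "(f i (a \<otimes> b) \<noteq> s) = (f i a \<noteq> (f i b \<noteq> s))" by blast
  qed (rule UNIV_I)
  obtain \<rho> where \<rho>: "set_action G (generate G (\<Union>i\<in>I. H i)) (UNIV :: bool set) \<rho>"
    "\<And>i a s. i \<in> I \<Longrightarrow> a \<in> H i \<Longrightarrow> \<rho> a s = (f i a \<noteq> s)"
    using free_product_action_extend[OF fp fam] by (metis UNIV_I)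
  have tr: "\<rho> g s = (\<rho> g False \<noteq> s)" if "g \<in> generate G (\<Union>i\<in>I. H i)" for g s
    using H that
  proof (induction g arbitrary: s rule: generate_family_induct)
    case one
    then show ?case using set_actionD(2)[OF \<rho>(1)] by simp
  next
    case (mult i a g)
    then have "a \<in> generate G (\<Union>i\<in>I. H i)" by (auto intro: generate.incl)
    then have "\<rho> (a \<otimes> g) s = (f i a \<noteq> \<rho> g s)" for s
      using set_actionD(3)[OF \<rho>(1) _ mult(3)] \<rho>(2)[OF mult(1,2)] by simp
    then show ?case using mult.IH by metis
  qed
  show ?thesis
  proof
    show "bool_hom G (generate G (\<Union>i\<in>I. H i)) (\<lambda>g. \<rho> g False)"
      unfolding bool_hom_def
    proof (intro ballI)
      fix x y assume "x \<in> generate G (\<Union>i\<in>I. H i)" "y \<in> generate G (\<Union>i\<in>I. H i)"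
      then show "\<rho> (x \<otimes> y) False = (\<rho> x False \<noteq> \<rho> y False)"
        using set_actionD(3)[OF \<rho>(1)] tr by (metis UNIV_I)
    qed
    show "\<rho> a False = f i a" if "i \<in> I" "a \<in> H i" for i a using \<rho>(2)[OF that] by simp
  qed
qed

lemma bool_hom_one: "subgroup K G \<Longrightarrow> bool_hom G K h \<Longrightarrow> \<not> h \<one>"
  using subgroup.one_closed[of K G] unfolding bool_hom_def by (metis l_one one_closed)

lemma bool_hom_inv: "subgroup K G \<Longrightarrow> bool_hom G K h \<Longrightarrow> x \<in> K \<Longrightarrow> h (inv x) = h x"
proof -
  assume *: "subgroup K G" "bool_hom G K h" "x \<in> K"
  have "h (x \<otimes> inv x) = (h x \<noteq> h (inv x))"
    using * subgroup.m_inv_closed[OF *(1,3)] unfolding bool_hom_def by blast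
  then show ?thesis using bool_hom_one[OF *(1,2)] subgroup.mem_carrier[OF *(1,3)] by simp
qed

text \<open>Each generator involves finitely many factors, so finitely many factors generate the
  group, and a nontrivial factor cannot lie in the subgroup generated by others.\<close>

lemma finitely_generated_free_product:
  assumes S: "finite S" "generate G S = carrier G" "S \<subseteq> carrier G"
    and fp: "generate_free_product G J H" and gen: "generate G (\<Union>j\<in>J. H j) = carrier G"
  shows "finite {j\<in>J. H j \<noteq> {\<one>}}"
proof -
  note H = free_product_subgroup[OF fp]
  have "\<exists>T. finite T \<and> T \<subseteq> J \<and> s \<in> generate G (\<Union>j\<in>T. H j)" if "s \<in> S" for s
  proof -
    have "s \<in> generate G (\<Union>j\<in>J. H j)" using S that gen by blast
    then obtain w where w: "w \<in> lists (Sigma J H)" "word_value G w = s"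
      using generate_words[OF H] by auto
    have "fst ` set w \<subseteq> J" using w(1) by (auto simp: in_lists_conv_set)
    moreover have "w \<in> lists (Sigma (fst ` set w) H)" using w(1) by (force simp: in_lists_conv_set)
    moreover have "\<forall>j\<in>fst ` set w. subgroup (H j) G" using H calculation(1) by blast
    ultimately show ?thesis using generate_words[of "fst ` set w" H] w(2) by (intro exI[of _ "fst ` set w"]) auto
  qed
  then obtain T where T: "\<And>s. s \<in> S \<Longrightarrow> finite (T s) \<and> T s \<subseteq> J \<and> s \<in> generate G (\<Union>j\<in>T s. H j)" by metis
  define J0 where "J0 = (\<Union>s\<in>S. T s)"
  have J0: "finite J0" "J0 \<subseteq> J" using T S(1) by (auto simp: J0_def)
  have "S \<subseteq> generate G (\<Union>j\<in>J0. H j)"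
  proof
    fix s assume s: "s \<in> S"
    then have "(\<Union>j\<in>T s. H j) \<subseteq> (\<Union>j\<in>J0. H j)" unfolding J0_def by blast
    from mono_generate[OF this] show "s \<in> generate G (\<Union>j\<in>J0. H j)" using T[OF s] by blast
  qed
  moreover have "\<forall>j\<in>J0. subgroup (H j) G" using H J0 by blast
  ultimately have all: "carrier G \<subseteq> generate G (\<Union>j\<in>J0. H j)"
    using generate_subgroup_incl[OF _ generate_is_subgroup[OF generate_closed_family]] S(2) by blast
  have "{j\<in>J. H j \<noteq> {\<one>}} \<subseteq> J0"
  proof
    fix j assume "j \<in> {j\<in>J. H j \<noteq> {\<one>}}"
    then have j: "j \<in> J" "H j \<noteq> {\<one>}" by auto
    note sg = bspec[OF H j(1)]
    obtain h where h: "h \<in> H j" "h \<noteq> \<one>" using j(2) subgroup.one_closed[OF sg] by auto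
    then show "j \<in> J0"
      using free_product_generate_mem[OF fp j(1) h _ J0(2)] all subgroup.mem_carrier[OF sg h(1)] by blast
  qed
  then show ?thesis using J0(1) finite_subset by blast
qed

text \<open>A homomorphism is determined by its values on \<open>S\<close>; prescribing
  \<open>False\<close> outside the carrier determines it as a function as well.\<close>

lemma finite_bool_homs:
  assumes S: "finite S" "generate G S = carrier G" "S \<subseteq> carrier G"
  shows "finite {h. bool_hom G (carrier G) h \<and> (\<forall>x. x \<notin> carrier G \<longrightarrow> \<not> h x)}" (is "finite ?X")
proof (rule finite_imageD)
  show "finite ((\<lambda>h. {s\<in>S. h s}) ` ?X)"
    by (rule finite_subset[of _ "Pow S"]) (use S in auto)
  show "inj_on (\<lambda>h. {s\<in>S. h s}) ?X"
  proof (rule inj_onI)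
    fix h k assume h: "h \<in> ?X" and k: "k \<in> ?X" and eq: "{s\<in>S. h s} = {s\<in>S. k s}"
    have hk: "bool_hom G (carrier G) h" "bool_hom G (carrier G) k" using h k by auto
    have S_eq: "h s = k s" if "s \<in> S" for s using eq that by blast
    have "h x = k x" if "x \<in> generate G S" for x
      using that
    proof (induction rule: generate.induct)
      case one
      show ?case using bool_hom_one[OF subgroup_self hk(1)] bool_hom_one[OF subgroup_self hk(2)] by simp
    next
      case (incl x)
      then show ?case by (rule S_eq)
    next
      case (inv x)
      then have "x \<in> carrier G" using S(3) by blast
      then show ?case
        using bool_hom_inv[OF subgroup_self hk(1)] bool_hom_inv[OF subgroup_self hk(2)] S_eq[OF inv] by simp
    next
      case (eng x y)
      then have "x \<in> carrier G" "y \<in> carrier G" using S(2) by auto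
      then show ?case using hk eng by (simp add: bool_hom_def)
    qed
    moreover have "h x = k x" if "x \<notin> carrier G" for x using h k that by simp
    ultimately show "h = k" using S(2) by (intro ext) blast
  qed
qed

end

section \<open>Subgroups of free groups\<close>

context group
begin

text \<open>The least positive exponent \<open>m\<close> of a power of \<open>t\<close> in
  \<open>H\<close> divides all other exponents; the homomorphism is the parity of the exponent
  divided by \<open>m\<close>.\<close>

lemma infinite_cyclic_bool_hom:
  assumes t: "t \<in> carrier G" and inf: "\<And>n::int. t [^] n = \<one> \<Longrightarrow> n = 0"
    and H: "subgroup H G" "H \<subseteq> range (\<lambda>n::int. t [^] n)" "H \<noteq> {\<one>}"
  shows "\<exists>h. bool_hom G H h \<and> (\<exists>x\<in>H. h x)"
proof -
  have inj: "a = b" if "t [^] a = t [^] b" for a b :: int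
    using inf[of "a - b"] that t by (simp add: int_pow_diff)
  obtain x where "x \<in> H" "x \<noteq> \<one>" using H(3) subgroup.one_closed[OF H(1)] by auto
  moreover from \<open>x \<in> H\<close> obtain n :: int where "x = t [^] n" using H(2) by blast
  ultimately have n: "t [^] n \<in> H" "n \<noteq> 0" by auto
  \<comment> \<open>With both signs available, some positive exponent occurs, hence a least
    one.\<close>
  have "t [^] (- n) \<in> H" using subgroup.m_inv_closed[OF H(1) n(1)] t by (simp add: int_pow_neg)
  then have "\<exists>m::nat. 0 < m \<and> t [^] int m \<in> H"
    using n by (cases "n > 0") (auto intro: exI[of _ "nat n"] exI[of _ "nat (- n)"])
  then obtain m :: nat where m: "0 < m" "t [^] int m \<in> H"
    and least: "\<And>k. k < m \<Longrightarrow> \<not> (0 < k \<and> t [^] int k \<in> H)"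
    using exists_least_iff[of "\<lambda>m. 0 < m \<and> t [^] int m \<in> H"] by auto
  have dvd: "int m dvd n" if "t [^] n \<in> H" for n :: int
  proof -
    have "t [^] (n mod int m) = t [^] n \<otimes> inv ((t [^] int m) [^] (n div int m))"
      using t by (simp add: int_pow_pow int_pow_diff minus_div_mult_eq_mod[symmetric] mult.commute)
    also have "\<dots> \<in> H"
      using subgroup.m_closed[OF H(1) that] subgroup.m_inv_closed[OF H(1)]
        subgroup_int_pow_closed[OF H(1) m(2)] by simp
    finally have mem: "t [^] int (nat (n mod int m)) \<in> H" using m(1) by simp
    have "nat (n mod int m) < m" using m(1) by (simp add: nat_less_iff)
    have "\<not> 0 < nat (n mod int m)"
      by (rule notI) (rule notE[OF least[OF \<open>nat (n mod int m) < m\<close>]], rule conjI[OF _ mem])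
    moreover have "0 \<le> n mod int m" using m(1) by simp
    ultimately have "n mod int m = 0" by linarith
    then show ?thesis by (rule dvd_eq_mod_eq_0[THEN iffD2])
  qed
  define h where "h x = odd ((THE n::int. t [^] n = x) div int m)" for x
  have h: "h (t [^] n) = odd (n div int m)" for n :: int
  proof -
    have "(THE k::int. t [^] k = t [^] n) = n" by (rule the_equality) (auto dest: inj)
    then show ?thesis by (simp add: h_def)
  qed
  have "bool_hom G H h"
    unfolding bool_hom_def
  proof (intro ballI)
    fix x y assume xy: "x \<in> H" "y \<in> H"
    obtain a b :: int where a: "x = t [^] a" and b: "y = t [^] b" using H(2) xy by blast
    have "int m dvd a" using dvd xy a by simp
    then have "(a + b) div int m = a div int m + b div int m" by (rule div_plus_div_distrib_dvd_left)
    then show "h (x \<otimes> y) = (h x \<noteq> h y)"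
      unfolding a b int_pow_mult[OF t, symmetric] h by simp
  qed
  moreover have "h (t [^] int m)" unfolding h using m(1) by simp
  ultimately show ?thesis using m(2) by blast
qed

lemma conjugate_int_pow:
  assumes "x \<in> carrier G" "t \<in> carrier G"
  shows "(x \<otimes> t \<otimes> inv x) [^] (n::int) = x \<otimes> t [^] n \<otimes> inv x"
proof -
  have "(\<lambda>g. x \<otimes> g \<otimes> inv x) \<in> hom G G"
    using assms(1) by (auto simp: hom_def m_assoc inv_cancel_left)
  from hom_int_pow[OF this assms(2) is_group is_group] show ?thesis by simp
qed

lemma conjugate_by_cyclic:
  assumes "x \<in> carrier G" "t \<in> carrier G"
  shows "conjugate_by G x (range (\<lambda>n::int. t [^] n)) = range (\<lambda>n::int. (x \<otimes> t \<otimes> inv x) [^] n)"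
  using conjugate_int_pow[OF assms] by (auto simp: conjugate_by_def image_iff)

section \<open>A free basis as a free product of infinite cyclic groups\<close>

lemma letter_value_closed: "s \<in> carrier G \<Longrightarrow> letter_value G (s, b) \<in> carrier G"
  by (simp add: letter_value_def)

lemma word_product_replicate:
  "x \<in> carrier G \<Longrightarrow> word_product G (replicate k x) = x [^] k"
proof (induction k)
  case (Suc k)
  then show ?case using nat_pow_Suc2[of x k] by simp
qed simp

definition cyclic where "cyclic s = range (\<lambda>n::int. s [^] n)"

definition power_letters :: "'a \<Rightarrow> int \<Rightarrow> ('a \<times> bool) list" where
  "power_letters s n = replicate (nat \<bar>n\<bar>) (s, 0 < n)"

lemma word_product_power_letters:
  assumes "s \<in> carrier G"
  shows "word_product G (map (letter_value G) (power_letters s n)) = s [^] n"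
proof (cases "0 < n")
  case True
  then show ?thesis using assms
    by (simp add: power_letters_def letter_value_def word_product_replicate int_pow_def2 del: pow_nat)
next
  case False
  then show ?thesis using assms
    by (simp add: power_letters_def letter_value_def word_product_replicate int_pow_def2 nat_pow_inv del: pow_nat)
qed

lemma cyclic_subgroup: "s \<in> carrier G \<Longrightarrow> subgroup (cyclic s) G"
  unfolding cyclic_def
proof (rule subgroup.intro)
  show "\<one> \<in> range (\<lambda>n::int. s [^] n)" by (metis int_pow_0 rangeI)
qed (auto simp flip: int_pow_mult int_pow_neg)

context
  fixes S assumes S: "free_basis G S"
begin

lemma free_basis_closed: "s \<in> S \<Longrightarrow> s \<in> carrier G"
  using S by (auto simp: free_basis_def)

lemma reduced_word_trivial:
  "r \<in> reduced_words S \<Longrightarrow> word_product G (map (letter_value G) r) = \<one> \<Longrightarrow> r = []"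
proof -
  assume r: "r \<in> reduced_words S" "word_product G (map (letter_value G) r) = \<one>"
  have "inj_on (\<lambda>w. word_product G (map (letter_value G) w)) (reduced_words S)"
    using S by (simp add: free_basis_def bij_betw_def)
  from inj_onD[OF this, of r "[]"] show ?thesis using r by (simp add: reduced_words_def)
qed

lemma reduced_power_letters: "s \<in> S \<Longrightarrow> power_letters s n \<in> reduced_words S"
proof -
  have "successively (\<lambda>l l'. fst l = fst l' \<longrightarrow> snd l = snd l') (replicate k (s, b))" for k b
  proof (induction k)
    case (Suc k)
    then show ?case by (cases k) simp_all
  qed simp
  then show "s \<in> S \<Longrightarrow> ?thesis" by (auto simp: reduced_words_def power_letters_def)
qed

lemma free_basis_infinite_order: "s \<in> S \<Longrightarrow> s [^] (n::int) = \<one> \<Longrightarrow> n = 0"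
proof -
  assume s: "s \<in> S" "s [^] n = \<one>"
  have "power_letters s n = []"
    using reduced_word_trivial[OF reduced_power_letters[OF s(1)]]
      word_product_power_letters[OF free_basis_closed[OF s(1)]] s(2) by simp
  then show ?thesis by (simp add: power_letters_def)
qed

text \<open>A nontrivial power of a basis element expands to a nonempty constant word. Neighbouring
  powers belong to different basis elements, so nothing cancels at the joints.\<close>

lemma free_basis_free_product: "generate_free_product G S cyclic"
proof -
  have expand: "\<exists>r \<in> reduced_words S. word_product G (map (letter_value G) r) = word_value G w \<and>
      (w \<noteq> [] \<longrightarrow> r \<noteq> [] \<and> fst (hd r) = fst (hd w))" if "w \<in> nf_words G S cyclic" for w
    using that
  proof (induction w)
    case Nil
    show ?case by (intro bexI[of _ "[]"]) (simp_all add: reduced_words_def)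
  next
    case (Cons p v)
    obtain s b where p: "p = (s, b)" by force
    have s: "s \<in> S" "b \<in> cyclic s" "b \<noteq> \<one>" and v: "v \<in> nf_words G S cyclic" "v = [] \<or> fst (hd v) \<noteq> s"
      using Cons(2) p by (auto simp: nf_words_Cons)
    obtain n :: int where "b = s [^] n" using s(2) unfolding cyclic_def by blast
    with s(3) have n: "b = s [^] n" "n \<noteq> 0" by auto
    obtain r where r: "r \<in> reduced_words S" "word_product G (map (letter_value G) r) = word_value G v"
      "v \<noteq> [] \<longrightarrow> r \<noteq> [] \<and> fst (hd r) = fst (hd v)" using Cons.IH v by blast
    \<comment> \<open>For the joint: if no power follows, no letter follows either.\<close>
    have r0: "r = []" if "v = []" using reduced_word_trivial[OF r(1)] r(2) that by simp
    define q where "q = power_letters s n"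
    have q: "q \<in> reduced_words S" "q \<noteq> []" "\<forall>x\<in>set q. fst x = s"
      unfolding q_def using reduced_power_letters[OF s(1)] n(2) by (auto simp: power_letters_def)
    have "fst (last q) = s" "fst (hd q) = s" using q(2,3) by auto
    then have "q @ r \<in> reduced_words S"
      using q r r0 v(2) by (auto simp: reduced_words_def successively_append_iff)
    moreover have "set (map (letter_value G) u) \<subseteq> carrier G" if "u \<in> reduced_words S" for u
      using that letter_value_closed[OF free_basis_closed] by (force simp: reduced_words_def)
    then have "word_product G (map (letter_value G) (q @ r)) = b \<otimes> word_value G v"
      using word_product_append[of "map (letter_value G) q" "map (letter_value G) r"] q(1) r(1,2)
        word_product_power_letters[OF free_basis_closed[OF s(1)], of n] n(1) by (simp add: q_def)
    ultimately show ?case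
      using q(2) \<open>fst (hd q) = s\<close> p by (intro bexI[of _ "q @ r"]) auto
  qed
  have "w = []" if w: "w \<in> nf_words G S cyclic" "word_value G w = \<one>" for w
  proof -
    obtain r where "r \<in> reduced_words S" "word_product G (map (letter_value G) r) = \<one>"
      "w \<noteq> [] \<longrightarrow> r \<noteq> []" using expand[OF w(1)] w(2) by auto
    then show ?thesis using reduced_word_trivial by blast
  qed
  then show ?thesis
    using cyclic_subgroup[OF free_basis_closed] by (simp add: generate_free_product_nf)
qed

lemma free_basis_generate: "generate G S = carrier G"
proof
  show "generate G S \<subseteq> carrier G" using free_basis_closed by (intro generate_incl) blast
  show "carrier G \<subseteq> generate G S"
  proof
    fix g assume "g \<in> carrier G"
    then obtain w where w: "w \<in> reduced_words S" "g = word_product G (map (letter_value G) w)"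
      using S by (auto simp: free_basis_def bij_betw_def)
    have "set w \<subseteq> S \<times> UNIV" using w(1) by (simp add: reduced_words_def)
    then have "word_product G (map (letter_value G) w) \<in> generate G S"
    proof (induction w)
      case (Cons p w)
      then have "letter_value G p \<in> generate G S"
        by (auto simp: letter_value_def intro: generate.incl generate.inv)
      then show ?case using generate.eng Cons by simp
    qed (simp add: generate.one)
    then show "g \<in> generate G S" using w(2) by simp
  qed
qed

lemma free_basis_cyclic_generate: "generate G (\<Union>s\<in>S. cyclic s) = carrier G"
proof
  show "generate G (\<Union>s\<in>S. cyclic s) \<subseteq> carrier G"
    using generate_incl[OF generate_closed_family[OF free_product_subgroup[OF free_basis_free_product]]] .
  have "s \<in> cyclic s" if "s \<in> S" for s
    unfolding cyclic_def using free_basis_closed[OF that] by (intro range_eqI[of _ _ 1]) simp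
  then have "S \<subseteq> (\<Union>s\<in>S. cyclic s)" by blast
  from mono_generate[OF this] show "carrier G \<subseteq> generate G (\<Union>s\<in>S. cyclic s)"
    by (simp add: free_basis_generate)
qed

text \<open>A weak form of the Nielsen--Schreier theorem.\<close>

theorem nontrivial_subgroup_bool_hom:
  assumes K: "subgroup K G" "K \<noteq> {\<one>}"
  shows "\<exists>h. bool_hom G K h \<and> (\<exists>k\<in>K. h k)"
proof -
  obtain R J :: "('a \<times> 'a set) set" and H x where k: "R \<subseteq> J" "generate_free_product G J H"
    "generate G (\<Union>p\<in>J. H p) = K"
    "\<And>i c. (i, c) \<in> R \<Longrightarrow> i \<in> S \<and> x c \<in> carrier G \<and> H (i, c) = K \<inter> conjugate_by G (x c) (cyclic i)"
    "\<And>i g. i \<in> S \<Longrightarrow> g \<in> carrier G \<Longrightarrow>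
       \<exists>c. (i, c) \<in> R \<and> (\<exists>k\<in>K. \<exists>a\<in>cyclic i. g = k \<otimes> x c \<otimes> a)"
    "\<And>i c d k a. (i, c) \<in> R \<Longrightarrow> (i, d) \<in> R \<Longrightarrow> k \<in> K \<Longrightarrow> a \<in> cyclic i \<Longrightarrow>
       x d = k \<otimes> x c \<otimes> a \<Longrightarrow> c = d"
    "\<And>p. p \<in> J - R \<Longrightarrow> \<exists>t\<in>carrier G. H p = range (\<lambda>n::int. t [^] n) \<and>
       (\<forall>n::int. t [^] n = \<one> \<longrightarrow> n = 0)"
    apply (rule kurosh_subgroup[OF free_basis_free_product free_basis_cyclic_generate K(1)])
    subgoal premises p for R J H x by (rule p(1)[OF p(2-8)])
    done
  note sg = free_product_subgroup[OF k(2)]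
  have "\<exists>p\<in>J. H p \<noteq> {\<one>}"
  proof (rule ccontr)
    assume "\<not> (\<exists>p\<in>J. H p \<noteq> {\<one>})"
    then have "(\<Union>p\<in>J. H p) \<subseteq> {\<one>}" by auto
    then have "K \<subseteq> {\<one>}" using generate_subgroup_incl[OF _ triv_subgroup] k(3) by blast
    then show False using K subgroup.one_closed[OF K(1)] by blast
  qed
  then obtain p where p: "p \<in> J" "H p \<noteq> {\<one>}" by blast
  \<comment> \<open>A Kurosh factor is either an intersection with a conjugate of the cyclic group
    of a basis element or infinite cyclic by itself.\<close>
  have "\<exists>t\<in>carrier G. H p \<subseteq> range (\<lambda>n::int. t [^] n) \<and> (\<forall>n::int. t [^] n = \<one> \<longrightarrow> n = 0)"
  proof (cases "p \<in> R")
    case True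
    obtain s c where sc: "p = (s, c)" by force
    have s: "s \<in> S" "x c \<in> carrier G" "H p = K \<inter> conjugate_by G (x c) (cyclic s)"
      using k(4) True sc by auto
    note sG = free_basis_closed[OF s(1)]
    let ?t = "x c \<otimes> s \<otimes> inv (x c)"
    have "n = 0" if "?t [^] n = \<one>" for n :: int
    proof -
      have "x c \<otimes> s [^] n \<otimes> inv (x c) = \<one>" using that conjugate_int_pow[OF s(2) sG] by simp
      then have "inv (x c) \<otimes> (x c \<otimes> s [^] n \<otimes> inv (x c)) \<otimes> x c = \<one>" using s(2) by simp
      then have "s [^] n = \<one>" using s(2) sG by (simp add: m_assoc inv_cancel_left)
      then show ?thesis using free_basis_infinite_order[OF s(1)] by blast
    qed
    moreover have "H p \<subseteq> range (\<lambda>n::int. ?t [^] n)"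
      using conjugate_by_cyclic[OF s(2) sG] s(3) by (simp add: cyclic_def)
    ultimately show ?thesis using s(2) sG by (intro bexI[of _ ?t]) auto
  next
    case False
    then show ?thesis using k(7)[of p] p(1) by blast
  qed
  then obtain f where f: "bool_hom G (H p) f" "\<exists>a\<in>H p. f a"
    using infinite_cyclic_bool_hom[OF _ _ bspec[OF sg p(1)] _ p(2)] by blast
  \<comment> \<open>Extend \<open>f\<close> by the zero homomorphism on the other factors.\<close>
  have "bool_hom G (H q) (if q = p then f else (\<lambda>_. False))" for q
    using f(1) by (auto simp: bool_hom_def)
  then obtain h where "bool_hom G K h" "\<And>q a. q \<in> J \<Longrightarrow> a \<in> H q \<Longrightarrow> h a = (if q = p then f else (\<lambda>_. False)) a"
    using free_product_bool_hom_extend[OF k(2), of "\<lambda>q. if q = p then f else (\<lambda>_. False)"] k(3) by blast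
  moreover have "H p \<subseteq> K" using k(3) p(1) by (auto intro: generate.incl)
  moreover obtain a where "a \<in> H p" "f a" using f(2) by blast
  ultimately have "bool_hom G K h" "a \<in> K" "h a" using p(1) by auto
  then show ?thesis by blast
qed

end

end

section \<open>Components and their conjugates\<close>

text \<open>The index \<open>None\<close> is reserved for a complement of the system, so it stays
  apart from the components whatever set \<open>C\<close> is.\<close>

definition component_family :: "'a set \<Rightarrow> 'a set option \<Rightarrow> 'a set" where
  "component_family C p = (case p of None \<Rightarrow> C | Some A \<Rightarrow> A)"

abbreviation component_index :: "'a set set \<Rightarrow> 'a set option set" where
  "component_index \<A> \<equiv> insert None (Some ` \<A>)"

lemma component_family_simps [simp]:
  "component_family C None = C" "component_family C (Some A) = A"
  by (simp_all add: component_family_def)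

text \<open>The components alone generate only a free factor; Kurosh's theorem and malnormality are
  applied to a decomposition of the whole group.\<close>

definition splitting :: "('a, 'm) monoid_scheme \<Rightarrow> 'a set set \<Rightarrow> 'a set \<Rightarrow> bool" where
  "splitting G \<A> C \<longleftrightarrow>
     generate_free_product G (component_index \<A>) (component_family C) \<and>
     generate G (\<Union>p\<in>component_index \<A>. component_family C p) = carrier G"

context group
begin

section \<open>Conjugate subgroups\<close>

lemma conjugate_by_mem:
  assumes "x \<in> carrier G" "A \<subseteq> carrier G"
  shows "y \<in> conjugate_by G x A \<longleftrightarrow> y \<in> carrier G \<and> inv x \<otimes> y \<otimes> x \<in> A"
proof
  assume "y \<in> conjugate_by G x A"
  then obtain a where a: "a \<in> A" "y = x \<otimes> a \<otimes> inv x" unfolding conjugate_by_def by blast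
  have c: "a \<in> carrier G" using a(1) assms(2) by blast
  have "inv x \<otimes> y \<otimes> x = a" unfolding a(2) using assms(1) c by (simp add: m_assoc inv_cancel_left)
  then show "y \<in> carrier G \<and> inv x \<otimes> y \<otimes> x \<in> A" using a c assms(1) by simp
next
  assume y: "y \<in> carrier G \<and> inv x \<otimes> y \<otimes> x \<in> A"
  then have "y = x \<otimes> (inv x \<otimes> y \<otimes> x) \<otimes> inv x"
    using assms(1) by (simp add: m_assoc inv_cancel_left)
  then show "y \<in> conjugate_by G x A" using y unfolding conjugate_by_def by blast
qed

lemma conjugate_by_closed: "x \<in> carrier G \<Longrightarrow> A \<subseteq> carrier G \<Longrightarrow> conjugate_by G x A \<subseteq> carrier G"
  using conjugate_by_mem by auto

lemma conjugate_by_mono: "A \<subseteq> B \<Longrightarrow> conjugate_by G x A \<subseteq> conjugate_by G x B"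
  by (auto simp: conjugate_by_def)

lemma conjugate_by_mult:
  assumes "x \<in> carrier G" "y \<in> carrier G" "A \<subseteq> carrier G"
  shows "conjugate_by G x (conjugate_by G y A) = conjugate_by G (x \<otimes> y) A"
proof -
  have "x \<otimes> (y \<otimes> a \<otimes> inv y) \<otimes> inv x = x \<otimes> y \<otimes> a \<otimes> inv (x \<otimes> y)" if "a \<in> A" for a
    using that assms by (simp add: m_assoc inv_mult_group subset_iff)
  then show ?thesis by (simp add: conjugate_by_def image_image cong: image_cong)
qed

lemma conjugate_by_one: "A \<subseteq> carrier G \<Longrightarrow> conjugate_by G \<one> A = A"
proof -
  assume "A \<subseteq> carrier G"
  then have "\<one> \<otimes> a \<otimes> inv \<one> = a" if "a \<in> A" for a using that by (simp add: subset_iff)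
  then show ?thesis by (simp add: conjugate_by_def cong: image_cong)
qed

lemma conjugate_by_inv:
  assumes "x \<in> carrier G" "A \<subseteq> carrier G"
  shows "conjugate_by G (inv x) (conjugate_by G x A) = A" "conjugate_by G x (conjugate_by G (inv x) A) = A"
  using assms conjugate_by_mult[of "inv x" x A] conjugate_by_mult[of x "inv x" A] conjugate_by_one by simp_all

lemma conjugate_by_subgroup_mem:
  assumes "subgroup A G" "a \<in> A"
  shows "conjugate_by G a A = A"
proof -
  have sub: "conjugate_by G b A \<subseteq> A" if "b \<in> A" for b
    using that subgroup.m_closed[OF assms(1)] subgroup.m_inv_closed[OF assms(1)]
    by (auto simp: conjugate_by_def)
  have c: "a \<in> carrier G" "A \<subseteq> carrier G" using subgroup.mem_carrier[OF assms(1)] assms(2) by auto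
  have "conjugate_by G a (conjugate_by G (inv a) A) \<subseteq> conjugate_by G a A"
    using sub[OF subgroup.m_inv_closed[OF assms]] by (rule conjugate_by_mono)
  then show ?thesis using sub[OF assms(2)] conjugate_by_inv(2)[OF c] by auto
qed

lemma conjugate_by_subgroup:
  assumes "x \<in> carrier G" "subgroup A G"
  shows "subgroup (conjugate_by G x A) G"
proof -
  have A: "A \<subseteq> carrier G" using subgroup.subset[OF assms(2)] .
  show ?thesis
  proof (rule subgroup.intro)
    show "conjugate_by G x A \<subseteq> carrier G" using conjugate_by_closed[OF assms(1) A] .
    show "\<one> \<in> conjugate_by G x A"
      using conjugate_by_mem[OF assms(1) A] subgroup.one_closed[OF assms(2)] assms(1) by simp
    fix y assume y: "y \<in> conjugate_by G x A"
    then have y': "y \<in> carrier G" "inv x \<otimes> y \<otimes> x \<in> A" using conjugate_by_mem[OF assms(1) A] by auto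
    have "inv x \<otimes> inv y \<otimes> x = inv (inv x \<otimes> y \<otimes> x)"
      using assms(1) y' by (simp add: inv_mult_group m_assoc)
    then show "inv y \<in> conjugate_by G x A"
      using conjugate_by_mem[OF assms(1) A] y' subgroup.m_inv_closed[OF assms(2)] by simp
    fix z assume "z \<in> conjugate_by G x A"
    then have z': "z \<in> carrier G" "inv x \<otimes> z \<otimes> x \<in> A" using conjugate_by_mem[OF assms(1) A] by auto
    have "inv x \<otimes> (y \<otimes> z) \<otimes> x = (inv x \<otimes> y \<otimes> x) \<otimes> (inv x \<otimes> z \<otimes> x)"
      using assms(1) y' z' by (simp add: m_assoc inv_cancel_left)
    then show "y \<otimes> z \<in> conjugate_by G x A"
      using conjugate_by_mem[OF assms(1) A] y' z' subgroup.m_closed[OF assms(2)] by simp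
  qed
qed

lemma conjugate_by_hom_image:
  assumes \<phi>: "\<phi> \<in> hom G G" and x: "x \<in> carrier G" "A \<subseteq> carrier G"
  shows "\<phi> ` conjugate_by G x A = conjugate_by G (\<phi> x) (\<phi> ` A)"
proof -
  have "\<phi> (x \<otimes> a \<otimes> inv x) = \<phi> x \<otimes> \<phi> a \<otimes> inv (\<phi> x)" if "a \<in> A" for a
  proof -
    interpret group_hom G G \<phi> using \<phi> is_group by (simp add: group_hom_def group_hom_axioms_def)
    have "a \<in> carrier G" using that x by blast
    then show ?thesis using x by simp
  qed
  then show ?thesis by (simp add: conjugate_by_def image_image cong: image_cong)
qed

section \<open>From indexed free products to free factor systems and back\<close>

lemma free_product_cong:
  assumes "generate_free_product G I H" "\<And>i. i \<in> I \<Longrightarrow> H i = H' i"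
  shows "generate_free_product G I H'"
  using assms nf_words_mono[of _ G I H' I H] by (auto simp: generate_free_product_nf)

text \<open>Group the factors into two blocks, those indexed by \<open>J0\<close> and the
  rest.\<close>

lemma free_factor_generate:
  assumes fp: "generate_free_product G J H" and gen: "generate G (\<Union>j\<in>J. H j) = carrier G" and J0: "J0 \<subseteq> J"
  shows "free_factor G (generate G (\<Union>j\<in>J0. H j))"
proof -
  define B where "B b = generate G (\<Union>j\<in>{j\<in>J. (j \<in> J0) = b}. H j)" for b
  have "generate_free_product G (UNIV :: bool set) B"
    unfolding B_def[abs_def] by (rule free_product_group[OF fp])
  moreover have "B = (\<lambda>b. if b then B True else B False)" by (simp add: fun_eq_iff)
  ultimately have fpB: "generate_free_product G (UNIV :: bool set) (\<lambda>b. if b then B True else B False)" by simp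
  have "{j\<in>J. (j \<in> J0) = True} = J0" using J0 by blast
  then have B1: "B True = generate G (\<Union>j\<in>J0. H j)" by (simp add: B_def)
  have sub: "B b \<subseteq> carrier G" for b
    unfolding B_def gen[symmetric] by (rule mono_generate) blast
  have "generate G (B True \<union> B False) = carrier G"
  proof
    show "generate G (B True \<union> B False) \<subseteq> carrier G" using sub by (intro generate_incl) blast
    have "H j \<subseteq> B (j \<in> J0)" if "j \<in> J" for j
    proof
      fix x assume "x \<in> H j"
      then have "x \<in> (\<Union>i\<in>{i\<in>J. (i \<in> J0) = (j \<in> J0)}. H i)" using that by auto
      then show "x \<in> B (j \<in> J0)" unfolding B_def by (rule generate.incl)
    qed
    moreover have "B b \<subseteq> B True \<union> B False" for b by (cases b) auto
    ultimately have "(\<Union>j\<in>J. H j) \<subseteq> B True \<union> B False" by (intro UN_least) (rule order_trans)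
    from mono_generate[OF this] show "carrier G \<subseteq> generate G (B True \<union> B False)" by (simp add: gen)
  qed
  then show ?thesis unfolding free_factor_def B1[symmetric] using fpB by blast
qed

lemma generate_subgroup_self: "subgroup A G \<Longrightarrow> generate G A = A"
  using generate_subgroup_incl[of A A] generate.incl[of _ A G] by blast

lemma free_factor_system_family:
  assumes fp: "generate_free_product G J H" and gen: "generate G (\<Union>j\<in>J. H j) = carrier G"
    and R: "R \<subseteq> J" "finite R" "R \<noteq> {}" "\<And>p. p \<in> R \<Longrightarrow> H p \<noteq> {\<one>}"
  shows "nontrivial_free_factor_system G (H ` R)"
  unfolding nontrivial_free_factor_system_def
proof (intro conjI ballI)
  note sg = free_product_subgroup[OF fp]
  show "finite (H ` R)" "H ` R \<noteq> {}" using R by auto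
  show "free_factor G A" if A: "A \<in> H ` R" for A
  proof -
    obtain p where p: "p \<in> R" "A = H p" using A by blast
    have "subgroup (H p) G" using sg p R(1) by blast
    then show ?thesis using free_factor_generate[OF fp gen, of "{p}"] p R(1) generate_subgroup_self by auto
  qed
  show "A \<noteq> {\<one>}" if "A \<in> H ` R" for A using that R(4) by auto
  \<comment> \<open>One index is chosen for each member, which turns the indexed family into a set
    of subgroups.\<close>
  define f where "f = inv_into R H"
  have f: "f A \<in> R" "H (f A) = A" if "A \<in> H ` R" for A
    unfolding f_def using that by (simp_all add: inv_into_into f_inv_into_f)
  have "inj_on f (H ` R)" using f(2) by (metis inj_onI)
  then have "generate_free_product G (H ` R) (\<lambda>A. H (f A))"
    using f(1) R(1) by (intro free_product_reindex[OF fp]) auto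
  then show "generate_free_product G (H ` R) (\<lambda>A. A)"
    by (rule free_product_cong) (rule f(2))
  show "free_factor G (generate G (\<Union>(H ` R)))" by (rule free_factor_generate[OF fp gen R(1)])
qed

text \<open>The generated free factor \<open>P\<close> has a complement \<open>C\<close>; refine the
  two-factor decomposition by the components of \<open>P\<close>.\<close>

lemma splitting_exists:
  assumes "nontrivial_free_factor_system G \<A>"
  obtains C where "splitting G \<A> C"
proof -
  define P where "P = generate G (\<Union>\<A>)"
  have \<A>: "generate_free_product G \<A> (\<lambda>A. A)" "free_factor G P"
    using assms by (auto simp: nontrivial_free_factor_system_def P_def)
  obtain C where C: "generate_free_product G (UNIV :: bool set) (\<lambda>b. if b then P else C)"
    "generate G (P \<union> C) = carrier G" using \<A>(2) unfolding free_factor_def by blast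
  have sgC: "subgroup C G" "subgroup P G"
    using bspec[OF free_product_subgroup[OF C(1)], of False] bspec[OF free_product_subgroup[OF C(1)], of True] by auto
  define J where "J b = (if b then Some ` \<A> else {None})" for b
  have "generate_free_product G (Sigma (UNIV :: bool set) J) (\<lambda>(b, p). component_family C p)"
  proof (rule free_product_refine[OF C(1)])
    fix b :: bool
    have the: "generate_free_product G (Some ` \<A>) (\<lambda>p. the p)"
      by (rule free_product_reindex[OF \<A>(1)]) (simp_all add: inj_on_def image_image)
    have 1: "generate_free_product G (Some ` \<A>) (component_family C)"
      by (rule free_product_cong[OF the]) (elim imageE, simp)
    have false: "generate_free_product G {None :: 'a set option} (\<lambda>_. if False then P else C)"
      by (rule free_product_reindex[OF C(1)]) simp_all
    have 2: "generate_free_product G {None} (component_family C)"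
      by (rule free_product_cong[OF false]) simp
    show "generate_free_product G (J b) (component_family C)" using 1 2 by (simp add: J_def)
    show "generate G (\<Union>p\<in>J b. component_family C p) = (if b then P else C)"
      using generate_subgroup_self[OF sgC(1)] by (simp add: J_def P_def)
  qed
  \<comment> \<open>The block of an index is determined by whether it is \<open>None\<close>, so the
    pairs produced by the refinement reduce to their second entries.\<close>
  from free_product_reindex[OF this, of "\<lambda>p. (p \<noteq> None, p)" "component_index \<A>"]
  have "generate_free_product G (component_index \<A>) (\<lambda>p. component_family C p)"
    by (simp add: J_def inj_on_def image_subset_iff)
  moreover have "generate G (\<Union>p\<in>component_index \<A>. component_family C p) = carrier G"
  proof -
    have U: "(\<Union>p\<in>component_index \<A>. component_family C p) = C \<union> \<Union>\<A>" by simp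
    have "\<Union>\<A> \<subseteq> P" unfolding P_def by (auto intro: generate.incl)
    then have sub: "C \<union> \<Union>\<A> \<subseteq> carrier G" using subgroup.subset[OF sgC(1)] subgroup.subset[OF sgC(2)] by blast
    have "P \<subseteq> generate G (C \<union> \<Union>\<A>)" unfolding P_def by (rule mono_generate) blast
    moreover have "C \<subseteq> generate G (C \<union> \<Union>\<A>)" by (auto intro: generate.incl)
    ultimately have "generate G (P \<union> C) \<subseteq> generate G (C \<union> \<Union>\<A>)"
      by (intro generate_subgroup_incl generate_is_subgroup[OF sub]) blast
    then show ?thesis using C(2) generate_incl[OF sub] U by auto
  qed
  ultimately show ?thesis using that by (simp add: splitting_def)
qed

section \<open>Malnormality of components\<close>

lemma component_subgroup:
  assumes "nontrivial_free_factor_system G \<A>" "A \<in> \<A>"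
  shows "subgroup A G"
  using assms by (auto simp: nontrivial_free_factor_system_def generate_free_product_def)

lemma component_nontrivial:
  assumes "nontrivial_free_factor_system G \<A>" "A \<in> \<A>"
  obtains a where "a \<in> A" "a \<noteq> \<one>" "a \<in> carrier G"
proof -
  have "A \<noteq> {\<one>}" using assms by (simp add: nontrivial_free_factor_system_def)
  then obtain a where "a \<in> A" "a \<noteq> \<one>" using subgroup.one_closed[OF component_subgroup[OF assms]] by auto
  then show ?thesis using that subgroup.mem_carrier[OF component_subgroup[OF assms]] by blast
qed

lemma component_malnormal:
  assumes "nontrivial_free_factor_system G \<A>" "A \<in> \<A>" "A' \<in> \<A>"
    and "x \<in> carrier G" "a \<in> A" "a \<noteq> \<one>" "x \<otimes> a \<otimes> inv x \<in> A'"
  shows "A = A'" "x \<in> A"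
proof -
  obtain C where C: "splitting G \<A> C" using splitting_exists[OF assms(1)] .
  have "Some A = Some A' \<and> x \<in> component_family C (Some A)"
    using C assms(2-) unfolding splitting_def
    by (intro free_product_malnormal[of "component_index \<A>" "component_family C" "Some A" "Some A'" x a]) auto
  then show "A = A'" "x \<in> A" by auto
qed

text \<open>Conjugating \<open>a\<close> back into \<open>A\<close> reduces this to
  \<open>component_malnormal\<close> with the conjugator \<open>inv y \<otimes> x\<close>.\<close>

lemma component_malnormal_conjugates:
  assumes ffs: "nontrivial_free_factor_system G \<A>" "A \<in> \<A>" "A' \<in> \<A>"
    and x: "x \<in> carrier G" "y \<in> carrier G"
    and a: "a \<in> conjugate_by G x A" "a \<in> conjugate_by G y A'" "a \<noteq> \<one>"
  shows "A = A'" "inv y \<otimes> x \<in> A"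
proof -
  note A = subgroup.subset[OF component_subgroup[OF ffs(1,2)]]
  note A' = subgroup.subset[OF component_subgroup[OF ffs(1,3)]]
  have 1: "a \<in> carrier G" "inv x \<otimes> a \<otimes> x \<in> A" using a(1) conjugate_by_mem[OF x(1) A] by auto
  have 2: "inv y \<otimes> a \<otimes> y \<in> A'" using a(2) conjugate_by_mem[OF x(2) A'] by auto
  have ne: "inv x \<otimes> a \<otimes> x \<noteq> \<one>"
  proof
    assume "inv x \<otimes> a \<otimes> x = \<one>"
    then have "x \<otimes> (inv x \<otimes> a \<otimes> x) \<otimes> inv x = \<one>" using x by simp
    then show False using x 1 a(3) by (simp add: m_assoc inv_cancel_left)
  qed
  have eq: "(inv y \<otimes> x) \<otimes> (inv x \<otimes> a \<otimes> x) \<otimes> inv (inv y \<otimes> x) = inv y \<otimes> a \<otimes> y"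
    using x 1 by (simp add: m_assoc inv_mult_group inv_cancel_left)
  show "A = A'" "inv y \<otimes> x \<in> A"
    using component_malnormal[OF ffs _ 1(2) ne, of "inv y \<otimes> x"] x 2 unfolding eq by auto
qed

section \<open>The carrying relation\<close>

lemma carries_refl: "\<forall>A\<in>\<A>. A \<subseteq> carrier G \<Longrightarrow> carries G \<A> \<A>"
  unfolding carries_def using conjugate_by_one by (metis one_closed order_refl)

lemma carries_trans:
  assumes "carries G \<A> \<B>" "carries G \<B> \<C>" "\<forall>A\<in>\<A>. A \<subseteq> carrier G"
  shows "carries G \<A> \<C>"
  unfolding carries_def
proof
  fix C assume "C \<in> \<C>"
  then obtain B x where B: "B \<in> \<B>" "x \<in> carrier G" "C \<subseteq> conjugate_by G x B"
    using assms(2) unfolding carries_def by blast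
  then obtain A y where A: "A \<in> \<A>" "y \<in> carrier G" "B \<subseteq> conjugate_by G y A"
    using assms(1) unfolding carries_def by blast
  have "C \<subseteq> conjugate_by G (x \<otimes> y) A"
    using order_trans[OF B(3) conjugate_by_mono[OF A(3), of x]]
      conjugate_by_mult[OF B(2) A(2) bspec[OF assms(3) A(1)]] by simp
  then show "\<exists>A\<in>\<A>. \<exists>x\<in>carrier G. C \<subseteq> conjugate_by G x A"
    using A B by (intro bexI[OF _ A(1)] bexI[of _ "x \<otimes> y"]) auto
qed

end

section \<open>Preimages of free factor systems\<close>

context group
begin

lemma injective_hom_one:
  assumes "\<psi> \<in> hom G G" "inj_on \<psi> (carrier G)" "g \<in> carrier G"
  shows "\<psi> g = \<one> \<longleftrightarrow> g = \<one>"
  using hom_one[OF assms(1) is_group is_group] inj_onD[OF assms(2), of g \<one>] assms(3) by auto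

text \<open>Injectivity keeps letters nontrivial, so normal forms map letter by letter to normal
  forms. The \<open>H j\<close> lie in the image because they generate it, so every letter
  lifts.\<close>

lemma free_product_pullback:
  assumes \<psi>: "\<psi> \<in> hom G G" "inj_on \<psi> (carrier G)"
    and fp: "generate_free_product G J H" and gen: "generate G (\<Union>j\<in>J. H j) = \<psi> ` carrier G"
  shows "generate_free_product G J (\<lambda>j. {g \<in> carrier G. \<psi> g \<in> H j})"
    and "generate G (\<Union>j\<in>J. {g \<in> carrier G. \<psi> g \<in> H j}) = carrier G"
proof -
  interpret \<psi>: group_hom G G \<psi> using \<psi>(1) is_group by (simp add: group_hom_def group_hom_axioms_def)
  define H' where "H' j = {g \<in> carrier G. \<psi> g \<in> H j}" for j
  note sg = free_product_subgroup[OF fp]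
  have sg': "subgroup (H' j) G" if j: "j \<in> J" for j
  proof (rule subgroup.intro)
    note sgj = bspec[OF sg j]
    show "H' j \<subseteq> carrier G" by (auto simp: H'_def)
    show "\<one> \<in> H' j" using subgroup.one_closed[OF sgj] by (simp add: H'_def)
    fix x assume x: "x \<in> H' j"
    then show "inv x \<in> H' j" using subgroup.m_inv_closed[OF sgj] by (simp add: H'_def)
    fix y assume "y \<in> H' j"
    then show "x \<otimes> y \<in> H' j" using x subgroup.m_closed[OF sgj] by (simp add: H'_def)
  qed
  have words: "map (apsnd \<psi>) w \<in> nf_words G J H \<and> word_value G w \<in> carrier G \<and>
      word_value G (map (apsnd \<psi>) w) = \<psi> (word_value G w)" if "w \<in> nf_words G J H'" for w
    using that
  proof (induction w)
    case (Cons p w)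
    obtain j a where p: "p = (j, a)" by force
    have "a \<in> H' j" and j: "j \<in> J" "a \<noteq> \<one>" "w \<in> nf_words G J H'" "w = [] \<or> fst (hd w) \<noteq> j"
      using Cons(2) p by (auto simp: nf_words_Cons)
    then have a: "a \<in> carrier G" "\<psi> a \<in> H j" by (auto simp: H'_def)
    have "\<psi> a \<noteq> \<one>" using injective_hom_one[OF \<psi> a(1)] j(2) by simp
    moreover have "map (apsnd \<psi>) w = [] \<or> fst (hd (map (apsnd \<psi>) w)) \<noteq> j" using j(4) by (cases w) auto
    ultimately show ?case using Cons.IH[OF j(3)] j a p by (simp add: nf_words_Cons)
  qed (simp_all)
  have "w = []" if w: "w \<in> nf_words G J H'" "word_value G w = \<one>" for w
  proof -
    have "map (apsnd \<psi>) w \<in> nf_words G J H" "word_value G (map (apsnd \<psi>) w) = \<one>"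
      using words[OF w(1)] w(2) by auto
    then have "map (apsnd \<psi>) w = []" using fp unfolding generate_free_product_nf by blast
    then show ?thesis by simp
  qed
  then have fp': "generate_free_product G J H'" using sg' by (simp add: generate_free_product_nf)
  have lift: "\<exists>g\<in>generate G (\<Union>j\<in>J. H' j). \<psi> g = k" if "k \<in> generate G (\<Union>j\<in>J. H j)" for k
    using sg that
  proof (induction k rule: generate_family_induct)
    case one
    show ?case by (rule bexI[OF _ generate.one]) simp
  next
    case (mult j a k)
    then obtain g where g: "g \<in> generate G (\<Union>j\<in>J. H' j)" "\<psi> g = k" by blast
    have gc: "g \<in> carrier G"
      using g(1) generate_in_carrier[OF generate_closed_family[OF free_product_subgroup[OF fp']]] by blast
    have "a \<in> generate G (\<Union>j\<in>J. H j)" using mult(1,2) by (auto intro: generate.incl)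
    then obtain b where b: "b \<in> carrier G" "\<psi> b = a" using gen by auto
    have "b \<in> (\<Union>j\<in>J. H' j)" using b mult(1,2) by (auto simp: H'_def)
    then have "b \<otimes> g \<in> generate G (\<Union>j\<in>J. H' j)" using g(1) by (rule generate.eng[OF generate.incl])
    then show ?case using b gc g(2) by (intro bexI[of _ "b \<otimes> g"]) simp_all
  qed
  have sub: "generate G (\<Union>j\<in>J. H' j) \<subseteq> carrier G"
    by (rule generate_incl[OF generate_closed_family[OF free_product_subgroup[OF fp']]])
  have "carrier G \<subseteq> generate G (\<Union>j\<in>J. H' j)"
  proof
    fix g assume g: "g \<in> carrier G"
    then obtain g' where g': "g' \<in> generate G (\<Union>j\<in>J. H' j)" "\<psi> g' = \<psi> g" using lift[of "\<psi> g"] gen by blast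
    then have "g' = g" using inj_onD[OF \<psi>(2) g'(2) subsetD[OF sub g'(1)] g] by simp
    then show "g \<in> generate G (\<Union>j\<in>J. H' j)" using g'(1) by simp
  qed
  then show "generate_free_product G J (\<lambda>j. {g \<in> carrier G. \<psi> g \<in> H j})"
    "generate G (\<Union>j\<in>J. {g \<in> carrier G. \<psi> g \<in> H j}) = carrier G"
    using fp' sub by (auto simp: H'_def[abs_def])
qed

text \<open>Kurosh's theorem for the subgroup \<open>\<psi> ` carrier G\<close>, pulled back along \<open>\<psi>\<close>.\<close>

theorem pullback_system:
  assumes S: "finite S" "free_basis G S"
    and \<A>: "nontrivial_free_factor_system G \<A>"
    and \<psi>: "\<psi> \<in> hom G G" "inj_on \<psi> (carrier G)"
    and B0: "A0 \<in> \<A>" "z0 \<in> carrier G" "B0 \<subseteq> carrier G" "\<psi> ` B0 \<subseteq> conjugate_by G z0 A0" "b0 \<in> B0" "b0 \<noteq> \<one>"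
  shows "\<exists>\<D>. nontrivial_free_factor_system G \<D> \<and>
    (\<forall>D\<in>\<D>. \<exists>A\<in>\<A>. \<exists>x\<in>carrier G. \<psi> ` D \<subseteq> conjugate_by G x A) \<and>
    (\<forall>B. \<forall>A\<in>\<A>. \<forall>z\<in>carrier G. B \<subseteq> carrier G \<and> \<psi> ` B \<subseteq> conjugate_by G z A \<and> (\<exists>b\<in>B. b \<noteq> \<one>) \<longrightarrow>
       (\<exists>D\<in>\<D>. \<exists>y\<in>carrier G. B \<subseteq> conjugate_by G y D))"
proof -
  interpret \<psi>: group_hom G G \<psi> using \<psi>(1) is_group by (simp add: group_hom_def group_hom_axioms_def)
  obtain C where C: "splitting G \<A> C" using splitting_exists[OF \<A>] .
  define K where "K = \<psi> ` carrier G"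
  have K: "subgroup K G" unfolding K_def by (rule \<psi>.img_is_subgroup)
  obtain R J :: "('a set option \<times> 'a set) set" and H x where k: "R \<subseteq> J" "generate_free_product G J H"
    "generate G (\<Union>p\<in>J. H p) = K"
    "\<And>i c. (i, c) \<in> R \<Longrightarrow> i \<in> component_index \<A> \<and> x c \<in> carrier G \<and>
       H (i, c) = K \<inter> conjugate_by G (x c) (component_family C i)"
    "\<And>i g. i \<in> component_index \<A> \<Longrightarrow> g \<in> carrier G \<Longrightarrow>
       \<exists>c. (i, c) \<in> R \<and> (\<exists>k\<in>K. \<exists>a\<in>component_family C i. g = k \<otimes> x c \<otimes> a)"
    apply (rule kurosh_subgroup[OF _ _ K])
      apply (rule conjunct1[OF C[unfolded splitting_def]])
     apply (rule conjunct2[OF C[unfolded splitting_def]])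
    subgoal premises p for R J H x by (rule p(1)[OF p(2-6)])
    done
  define H' where "H' p = {g \<in> carrier G. \<psi> g \<in> H p}" for p
  note pb = free_product_pullback[OF \<psi> k(2) k(3)[unfolded K_def], folded H'_def]
  \<comment> \<open>Only the double cosets of components count, not those of the complement, and
    only those with nontrivial preimage; finite generation leaves finitely many of them.\<close>
  define R' where "R' = {p\<in>R. fst p \<noteq> None \<and> H' p \<noteq> {\<one>}}"
  have Ssub: "S \<subseteq> carrier G" using S(2) by (simp add: free_basis_def)
  have fin: "finite R'"
    using finitely_generated_free_product[OF S(1) free_basis_generate[OF S(2)] Ssub pb]
    by (rule rev_finite_subset) (use k(1) in \<open>auto simp: R'_def\<close>)
  have carry: "\<exists>D\<in>H' ` R'. \<exists>y\<in>carrier G. B \<subseteq> conjugate_by G y D"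
    if A: "A \<in> \<A>" and z: "z \<in> carrier G" and B: "B \<subseteq> carrier G" "\<psi> ` B \<subseteq> conjugate_by G z A"
      and b: "b \<in> B" "b \<noteq> \<one>" for A z B b
  proof -
    have "Some A \<in> component_index \<A>" using A by simp
    from k(5)[OF this z] obtain c \<kappa> a where c: "(Some A, c) \<in> R" "\<kappa> \<in> K" "a \<in> A" "z = \<kappa> \<otimes> x c \<otimes> a"
      by auto
    obtain y where y: "y \<in> carrier G" "\<kappa> = \<psi> y" using c(2) by (auto simp: K_def)
    have xc: "x c \<in> carrier G" "H (Some A, c) = K \<inter> conjugate_by G (x c) A" using k(4)[OF c(1)] by auto
    note sA = component_subgroup[OF \<A> A]
    note cA = subgroup.subset[OF sA] subgroup.mem_carrier[OF sA c(3)]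
    \<comment> \<open>Conjugation by \<open>a\<close> preserves \<open>A\<close>, and
      \<open>\<kappa>\<close> is the image of \<open>y\<close>: up to conjugation by
      \<open>y\<close> in the source, \<open>z\<close> may be replaced by the double coset
      representative \<open>x c\<close>.\<close>
    have "conjugate_by G z A = conjugate_by G \<kappa> (conjugate_by G (x c) (conjugate_by G a A))"
      using conjugate_by_mult[of \<kappa> "x c" "conjugate_by G a A"] conjugate_by_mult[of "\<kappa> \<otimes> x c" a A]
        y xc cA c(4) conjugate_by_closed[OF cA(2,1)] by simp
    also have "conjugate_by G a A = A" by (rule conjugate_by_subgroup_mem[OF sA c(3)])
    finally have zA: "conjugate_by G z A = conjugate_by G \<kappa> (conjugate_by G (x c) A)" .
    have sub: "B \<subseteq> conjugate_by G y (H' (Some A, c))"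
    proof
      fix u assume u: "u \<in> B"
      then have uc: "u \<in> carrier G" using B(1) by blast
      have "\<psi> u \<in> conjugate_by G \<kappa> (conjugate_by G (x c) A)" using u B(2) zA by blast
      then have "inv \<kappa> \<otimes> \<psi> u \<otimes> \<kappa> \<in> conjugate_by G (x c) A"
        using conjugate_by_mem[of \<kappa> "conjugate_by G (x c) A"] conjugate_by_closed[OF xc(1) cA(1)] y by simp
      then have "\<psi> (inv y \<otimes> u \<otimes> y) \<in> conjugate_by G (x c) A" using y uc by simp
      moreover have "\<psi> (inv y \<otimes> u \<otimes> y) \<in> K" unfolding K_def using y(1) uc by blast
      ultimately have "inv y \<otimes> u \<otimes> y \<in> H' (Some A, c)" unfolding H'_def using xc(2) y(1) uc by simp
      moreover have "H' (Some A, c) \<subseteq> carrier G" by (auto simp: H'_def)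
      ultimately show "u \<in> conjugate_by G y (H' (Some A, c))"
        using conjugate_by_mem[OF y(1), of "H' (Some A, c)" u] uc by simp
    qed
    have "H' (Some A, c) \<noteq> {\<one>}"
    proof
      assume "H' (Some A, c) = {\<one>}"
      then have "b \<in> conjugate_by G y {\<one>}" using sub b(1) by auto
      then show False using b(2) y(1) by (simp add: conjugate_by_def)
    qed
    then have "(Some A, c) \<in> R'" using c(1) by (simp add: R'_def)
    then show ?thesis using sub y(1) by blast
  qed
  \<comment> \<open>The nontrivial set \<open>B0\<close>, which \<psi> sends into a conjugate of a
    component, supplies at least one member.\<close>
  have "R' \<noteq> {}" using carry[OF B0] by blast
  then have "nontrivial_free_factor_system G (H' ` R')"
    using k(1) by (intro free_factor_system_family[OF pb _ fin]) (auto simp: R'_def)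
  moreover have "\<exists>A\<in>\<A>. \<exists>y\<in>carrier G. \<psi> ` D \<subseteq> conjugate_by G y A" if D: "D \<in> H' ` R'" for D
  proof -
    obtain q where q: "q \<in> R'" "D = H' q" using D by blast
    obtain i c where "q = (i, c)" by force
    then have p: "(i, c) \<in> R" "i \<noteq> None" "D = H' (i, c)" using q by (auto simp: R'_def)
    obtain A where A: "i = Some A" "A \<in> \<A>" using k(4)[OF p(1)] p(2) by auto
    have "\<psi> ` D \<subseteq> conjugate_by G (x c) A" using k(4)[OF p(1)] p(3) A(1) by (auto simp: H'_def)
    then show ?thesis using k(4)[OF p(1)] A(2) by blast
  qed
  moreover have "\<forall>B. \<forall>A\<in>\<A>. \<forall>z\<in>carrier G. B \<subseteq> carrier G \<and> \<psi> ` B \<subseteq> conjugate_by G z A \<and> (\<exists>b\<in>B. b \<noteq> \<one>) \<longrightarrow>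
       (\<exists>D\<in>H' ` R'. \<exists>y\<in>carrier G. B \<subseteq> conjugate_by G y D)" 
    by (intro allI ballI impI, elim conjE bexE) (rule carry)
  ultimately show ?thesis by (intro exI[of _ "H' ` R'"]) simp
qed

section \<open>Homomorphisms that kill a system\<close>

lemma bool_hom_conjugate:
  assumes "bool_hom G (carrier G) h" "x \<in> carrier G" "a \<in> carrier G"
  shows "h (x \<otimes> a \<otimes> inv x) = h a"
  using assms bool_hom_inv[OF subgroup_self assms(1,2)] by (simp add: bool_hom_def) blast

text \<open>Vanishing on the components means vanishing on their normal closure. The value outside
  the carrier is fixed so that distinct members are distinct homomorphisms.\<close>

definition killing :: "'a set set \<Rightarrow> ('a \<Rightarrow> bool) set" where
  "killing \<D> = {h. bool_hom G (carrier G) h \<and> (\<forall>x. x \<notin> carrier G \<longrightarrow> \<not> h x) \<and> (\<forall>D\<in>\<D>. \<forall>x\<in>D. \<not> h x)}"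

lemma finite_killing:
  assumes "finite S" "free_basis G S"
  shows "finite (killing \<D>)"
proof -
  have "S \<subseteq> carrier G" using assms(2) by (simp add: free_basis_def)
  from finite_bool_homs[OF assms(1) free_basis_generate[OF assms(2)] this] show ?thesis
    by (rule rev_finite_subset) (auto simp: killing_def)
qed

text \<open>The target is abelian, so a homomorphism that kills a subgroup kills its conjugates and
  everything inside them.\<close>

lemma killing_antimono:
  assumes car: "carries G \<D>' \<D>" and sub: "\<forall>D\<in>\<D>'. D \<subseteq> carrier G"
  shows "killing \<D>' \<subseteq> killing \<D>"
proof
  fix h assume h: "h \<in> killing \<D>'"
  have hom: "bool_hom G (carrier G) h" using h by (simp add: killing_def)
  have "\<not> h d" if d: "D \<in> \<D>" "d \<in> D" for D d
  proof -
    obtain D' x where D': "D' \<in> \<D>'" "x \<in> carrier G" "D \<subseteq> conjugate_by G x D'"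
      using car d(1) unfolding carries_def by blast
    then obtain e where e: "e \<in> D'" "d = x \<otimes> e \<otimes> inv x" using d(2) unfolding conjugate_by_def by blast
    then show ?thesis using bool_hom_conjugate[OF hom D'(2), of e] sub D'(1) h by (auto simp: killing_def)
  qed
  then show "h \<in> killing \<D>" using h by (simp add: killing_def)
qed

end

section \<open>Ascending chains of free factor systems\<close>

context group
begin

text \<open>Kurosh's theorem for \<open>T\<close> in the splitting along \<open>\<D>\<close>. The
  hypothesis on \<open>killing\<close> leaves only intersections with conjugates of components; by
  malnormality of \<open>\<D>'\<close> a nontrivial intersection is a full conjugate of a component
  assigned to \<open>T\<close>, and each component contributes at most one double coset.\<close>

lemma carried_component_decomposition:
  assumes S: "free_basis G S"
    and \<D>: "nontrivial_free_factor_system G \<D>" and \<D>': "nontrivial_free_factor_system G \<D>'"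
    and P: "\<forall>E\<in>\<D>. P E \<in> \<D>' \<and> z E \<in> carrier G \<and> E \<subseteq> conjugate_by G (z E) (P E)"
    and kill: "killing \<D> \<subseteq> killing \<D>'" and T: "T \<in> \<D>'"
  shows "\<exists>J :: ('a set option \<times> 'a set) set. \<exists>H x. generate G (\<Union>p\<in>J. H p) = T \<and>
    (\<forall>p\<in>J. H p = {\<one>} \<or> (\<exists>E\<in>\<D>. \<exists>c. p = (Some E, c) \<and> x c \<in> carrier G \<and> P E = T \<and>
       H p = conjugate_by G (x c) E)) \<and>
    (\<forall>E c d. (Some E, c) \<in> J \<and> (Some E, d) \<in> J \<and> H (Some E, c) \<noteq> {\<one>} \<and> H (Some E, d) \<noteq> {\<one>} \<longrightarrow> c = d)"
proof -
  obtain C where C: "splitting G \<D> C" using splitting_exists[OF \<D>] .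
  obtain C' where C': "splitting G \<D>' C'" using splitting_exists[OF \<D>'] .
  note sT = component_subgroup[OF \<D>' T]
  obtain R J :: "('a set option \<times> 'a set) set" and H x where k: "R \<subseteq> J" "generate_free_product G J H"
    "generate G (\<Union>p\<in>J. H p) = T"
    "\<And>i c. (i, c) \<in> R \<Longrightarrow> i \<in> component_index \<D> \<and> x c \<in> carrier G \<and>
       H (i, c) = T \<inter> conjugate_by G (x c) (component_family C i)"
    "\<And>i g. i \<in> component_index \<D> \<Longrightarrow> g \<in> carrier G \<Longrightarrow>
       \<exists>c. (i, c) \<in> R \<and> (\<exists>k\<in>T. \<exists>a\<in>component_family C i. g = k \<otimes> x c \<otimes> a)"
    "\<And>i c d k a. (i, c) \<in> R \<Longrightarrow> (i, d) \<in> R \<Longrightarrow> k \<in> T \<Longrightarrow> a \<in> component_family C i \<Longrightarrow>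
       x d = k \<otimes> x c \<otimes> a \<Longrightarrow> c = d"
    apply (rule kurosh_subgroup[OF _ _ sT])
      apply (rule conjunct1[OF C[unfolded splitting_def]])
     apply (rule conjunct2[OF C[unfolded splitting_def]])
    subgoal premises p for R J H x by (rule p(1)[OF p(2-7)])
    done
  note sg = free_product_subgroup[OF k(2)]
  have HT: "H p \<subseteq> T" if "p \<in> J" for p
    unfolding k(3)[symmetric] using that by (auto intro: generate.incl)
  have TG: "T \<subseteq> carrier G" using subgroup.subset[OF sT] .
  text \<open>A nontrivial factor of \<open>T\<close> other than a conjugate of a component of \<open>\<D>\<close> would support a
    homomorphism to the group of order two that kills \<open>\<D>\<close> but not \<open>T\<close>.\<close>
  have other: "H p = {\<one>}" if p: "p \<in> J" and npR: "\<not> (p \<in> R \<and> fst p \<noteq> None)" for p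
  proof (rule ccontr)
    assume "H p \<noteq> {\<one>}"
    then obtain f where f: "bool_hom G (H p) f" "\<exists>a\<in>H p. f a"
      using nontrivial_subgroup_bool_hom[OF S bspec[OF sg p]] by blast
    have "bool_hom G (H q) (if q = p then f else (\<lambda>_. False))" for q
      using f(1) by (auto simp: bool_hom_def)
    from free_product_bool_hom_extend[OF k(2) this]
    obtain hT where hT: "bool_hom G T hT"
      "\<And>q a. q \<in> J \<Longrightarrow> a \<in> H q \<Longrightarrow> hT a = (if q = p then f else (\<lambda>_. False)) a"
      unfolding k(3) by blast
    \<comment> \<open>Extend \<open>hT\<close> by zero over the complement and the other components
      of \<open>\<D>'\<close>.\<close>
    have fam: "bool_hom G (component_family C' q) (if q = Some T then hT else (\<lambda>_. False))" for q
      using hT(1) by (auto simp: bool_hom_def)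
    obtain h where h: "bool_hom G (carrier G) h"
      "\<And>q a. q \<in> component_index \<D>' \<Longrightarrow> a \<in> component_family C' q \<Longrightarrow>
         h a = (if q = Some T then hT else (\<lambda>_. False)) a"
      using free_product_bool_hom_extend[OF conjunct1[OF C'[unfolded splitting_def]] fam]
      unfolding conjunct2[OF C'[unfolded splitting_def]] by blast
    have hT': "h a = hT a" if "a \<in> T" for a using h(2)[of "Some T" a] T that by simp
    have h0: "\<not> h a" if "T' \<in> \<D>'" "T' \<noteq> T" "a \<in> T'" for T' a
      using h(2)[of "Some T'" a] that by simp
    have "\<not> h e" if E: "E \<in> \<D>" and e: "e \<in> E" for E e
    proof -
      note PE = bspec[OF P E]
      note sE = component_subgroup[OF \<D> E]
      have ec: "e \<in> carrier G" using subgroup.mem_carrier[OF sE e] .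
      have sP: "P E \<subseteq> carrier G" using subgroup.subset[OF component_subgroup[OF \<D>']] PE by blast
      define g where "g = inv (z E)"
      have g: "g \<in> carrier G" using PE by (simp add: g_def)
      have "e \<in> conjugate_by G (z E) (P E)" using PE e by blast
      then have ge: "g \<otimes> e \<otimes> inv g \<in> P E" using conjugate_by_mem[OF _ sP, of "z E" e] PE by (simp add: g_def)
      have heq: "h e = h (g \<otimes> e \<otimes> inv g)" using bool_hom_conjugate[OF h(1) g ec] by simp
      \<comment> \<open>Up to conjugation, \<open>e\<close> lies in another component of
        \<open>\<D>'\<close>, where \<open>h\<close> vanishes, or in a Kurosh factor of
        \<open>T\<close> other than \<open>H p\<close>, where \<open>hT\<close> vanishes.\<close>
      show ?thesis
      proof (cases "P E = T")
        case False
        then show ?thesis using h0[OF _ False ge] PE heq by blast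
      next
        case True
        have "Some E \<in> component_index \<D>" using E by simp
        from k(5)[OF this g] obtain c \<kappa> a where c: "(Some E, c) \<in> R" "\<kappa> \<in> T" "a \<in> E" "g = \<kappa> \<otimes> x c \<otimes> a"
          by auto
        have xc: "x c \<in> carrier G" "H (Some E, c) = T \<inter> conjugate_by G (x c) E" using k(4)[OF c(1)] by auto
        have cl: "\<kappa> \<in> carrier G" "a \<in> carrier G" using c(2,3) TG subgroup.mem_carrier[OF sE] by auto
        define u where "u = x c \<otimes> (a \<otimes> e \<otimes> inv a) \<otimes> inv (x c)"
        have ug: "g \<otimes> e \<otimes> inv g = \<kappa> \<otimes> u \<otimes> inv \<kappa>"
          unfolding c(4) u_def using cl xc(1) ec by (simp add: m_assoc inv_mult_group)
        have uc: "u \<in> carrier G" unfolding u_def using cl xc(1) ec by simp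
        have "inv \<kappa> \<otimes> (g \<otimes> e \<otimes> inv g) \<otimes> \<kappa> \<in> T"
          using ge True subgroup.m_closed[OF sT] subgroup.m_inv_closed[OF sT] c(2) by simp
        then have uT: "u \<in> T" unfolding ug using cl uc by (simp add: m_assoc inv_cancel_left)
        have "a \<otimes> e \<otimes> inv a \<in> E" using subgroup.m_closed[OF sE] subgroup.m_inv_closed[OF sE] c(3) e by simp
        then have "u \<in> conjugate_by G (x c) E" unfolding u_def conjugate_by_def by blast
        then have uH: "u \<in> H (Some E, c)" using xc(2) uT by simp
        have "(Some E, c) \<noteq> p" using npR c(1) by auto
        then have "\<not> hT u" using hT(2)[OF subsetD[OF k(1) c(1)] uH] by simp
        moreover have "h e = h u" unfolding heq ug by (rule bool_hom_conjugate[OF h(1) cl(1) uc])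
        ultimately show ?thesis using hT'[OF uT] by simp
      qed
    qed
    moreover have "E \<subseteq> carrier G" if "E \<in> \<D>" for E using subgroup.subset[OF component_subgroup[OF \<D> that]] .
    \<comment> \<open>Make \<open>h\<close> false outside the carrier, as membership in
      \<open>killing\<close> demands.\<close>
    moreover have "bool_hom G (carrier G) (\<lambda>y. y \<in> carrier G \<and> h y)" using h(1) by (auto simp: bool_hom_def)
    ultimately have "(\<lambda>y. y \<in> carrier G \<and> h y) \<in> killing \<D>" by (simp add: killing_def)
    then have "(\<lambda>y. y \<in> carrier G \<and> h y) \<in> killing \<D>'" using kill by blast
    then have *: "\<not> (y \<in> carrier G \<and> h y)" if "y \<in> T" for y using that T by (auto simp: killing_def)
    obtain a where a: "a \<in> H p" "f a" using f(2) by blast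
    have aT: "a \<in> T" using a(1) HT[OF p] by blast
    then have "h a" using hT'[OF aT] hT(2)[OF p a(1)] a(2) by simp
    then show False using *[OF aT] aT TG by blast
  qed
  have main: "\<exists>E\<in>\<D>. \<exists>c. p = (Some E, c) \<and> (Some E, c) \<in> R \<and> x c \<in> carrier G \<and> P E = T \<and> H p = conjugate_by G (x c) E"
    if p: "p \<in> J" and Hp: "H p \<noteq> {\<one>}" for p
  proof -
    have pR: "p \<in> R" "fst p \<noteq> None" using other[OF p] Hp by auto
    obtain E c where p': "p = (Some E, c)" using pR(2) by (metis not_None_eq prod.collapse)
    have E: "E \<in> \<D>" and xc: "x c \<in> carrier G" and HE: "H p = T \<inter> conjugate_by G (x c) E"
      using k(4)[of "Some E" c] pR(1) p' by auto
    note PE = bspec[OF P E]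
    have sP: "P E \<subseteq> carrier G" using subgroup.subset[OF component_subgroup[OF \<D>']] PE by blast
    obtain u where u: "u \<in> H p" "u \<noteq> \<one>" using Hp subgroup.one_closed[OF bspec[OF sg p]] by auto
    have conj: "conjugate_by G (x c) E \<subseteq> conjugate_by G (x c \<otimes> z E) (P E)"
      using conjugate_by_mono[of E "conjugate_by G (z E) (P E)" "x c"] PE conjugate_by_mult[OF xc _ sP, of "z E"] by simp
    have "u \<in> conjugate_by G (x c \<otimes> z E) (P E)" using u(1) HE conj by blast
    moreover have "u \<in> conjugate_by G \<one> T" using u(1) HE conjugate_by_one[OF TG] by blast
    \<comment> \<open>The nontrivial element \<open>u\<close> lies both in \<open>T\<close> and in a
      conjugate of \<open>P E\<close>; malnormality identifies the two components and puts the
      conjugator into \<open>T\<close>.\<close>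
    ultimately have PT: "P E = T" and "inv \<one> \<otimes> (x c \<otimes> z E) \<in> P E"
      using component_malnormal_conjugates[OF \<D>' _ T _ one_closed _ _ u(2), of "P E" "x c \<otimes> z E"] PE xc by auto
    then have "x c \<otimes> z E \<in> T" using PE xc by simp
    then have "conjugate_by G (x c) E \<subseteq> T"
      using conj conjugate_by_subgroup_mem[OF sT] PT by simp
    then have "H p = conjugate_by G (x c) E" using HE by blast
    then show ?thesis using E p' xc PT pR(1) by blast
  qed
  have uniq: "c = d" if c: "(Some E, c) \<in> J" "H (Some E, c) \<noteq> {\<one>}" and d: "(Some E, d) \<in> J" "H (Some E, d) \<noteq> {\<one>}" for E c d
  proof -
    have c': "E \<in> \<D>" "(Some E, c) \<in> R" "x c \<in> carrier G" "H (Some E, c) = conjugate_by G (x c) E"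
      using main[OF c] by auto
    have d': "(Some E, d) \<in> R" "x d \<in> carrier G" "H (Some E, d) = conjugate_by G (x d) E"
      using main[OF d] by auto
    obtain e where e: "e \<in> E" "e \<noteq> \<one>" "e \<in> carrier G" using component_nontrivial[OF \<D> c'(1)] .
    define u where "u = x c \<otimes> e \<otimes> inv (x c)"
    define y where "y = x d \<otimes> inv (x c)"
    have "u \<in> H (Some E, c)" unfolding c'(4) u_def conjugate_by_def using e(1) by blast
    then have uT: "u \<in> T" using HT[OF c(1)] by blast
    have "x d \<otimes> e \<otimes> inv (x d) \<in> H (Some E, d)" unfolding d'(3) conjugate_by_def using e(1) by blast
    then have "x d \<otimes> e \<otimes> inv (x d) \<in> T" using HT[OF d(1)] by blast
    moreover have "y \<otimes> u \<otimes> inv y = x d \<otimes> e \<otimes> inv (x d)"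
      unfolding y_def u_def using c'(3) d'(2) e(3) by (simp add: m_assoc inv_mult_group inv_cancel_left)
    moreover have "u \<noteq> \<one>"
    proof
      assume "u = \<one>"
      then have "inv (x c) \<otimes> u \<otimes> x c = \<one>" using c'(3) by simp
      then show False unfolding u_def using c'(3) e by (simp add: m_assoc inv_cancel_left)
    qed
    \<comment> \<open>\<open>y\<close> conjugates a nontrivial element of \<open>T\<close> into
      \<open>T\<close>. Once it lies in \<open>T\<close>, \<open>x c\<close> and \<open>x d\<close>
      represent the same double coset.\<close>
    ultimately have "y \<in> T"
      using component_malnormal(2)[OF \<D>' T T _ uT, of y] c'(3) d'(2) by (simp add: y_def)
    moreover have "x d = y \<otimes> x c \<otimes> \<one>" unfolding y_def using c'(3) d'(2) by (simp add: m_assoc)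
    ultimately show "c = d"
      using k(6)[OF c'(2) d'(1), of y \<one>] subgroup.one_closed[OF component_subgroup[OF \<D> c'(1)]] by simp
  qed
  show ?thesis
  proof (rule exI[of _ J], rule exI[of _ H], rule exI[of _ x], intro conjI ballI allI impI)
    show "generate G (\<Union>p\<in>J. H p) = T" by (rule k(3))
    show "H p = {\<one>} \<or> (\<exists>E\<in>\<D>. \<exists>c. p = (Some E, c) \<and> x c \<in> carrier G \<and> P E = T \<and>
       H p = conjugate_by G (x c) E)" if "p \<in> J" for p
      using main[OF that] by blast
    show "c = d" if "(Some E, c) \<in> J \<and> (Some E, d) \<in> J \<and> H (Some E, c) \<noteq> {\<one>} \<and> H (Some E, d) \<noteq> {\<one>}"
      for E c d using uniq[of E c d] that by simp
  qed
qed

text \<open>The ascending chain condition: homomorphisms to the group of order two and the number of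
  components detect whether a free factor system is strictly enlarged.\<close>

theorem carries_reverse:
  assumes S: "free_basis G S"
    and \<D>: "nontrivial_free_factor_system G \<D>" and \<D>': "nontrivial_free_factor_system G \<D>'"
    and car: "carries G \<D>' \<D>" and kill: "killing \<D> \<subseteq> killing \<D>'" and card: "card \<D> \<le> card \<D>'"
  shows "carries G \<D> \<D>'"
proof -
  have "\<forall>E\<in>\<D>. \<exists>A z. A \<in> \<D>' \<and> z \<in> carrier G \<and> E \<subseteq> conjugate_by G z A"
    using car unfolding carries_def by blast
  then obtain P z where P: "\<forall>E\<in>\<D>. P E \<in> \<D>' \<and> z E \<in> carrier G \<and> E \<subseteq> conjugate_by G (z E) (P E)"
    by metis
  note dec = carried_component_decomposition[OF S \<D> \<D>' P kill]
  have nontriv: "\<exists>p\<in>J. H p \<noteq> {\<one>}" if T: "T \<in> \<D>'" and gen: "generate G (\<Union>p\<in>J. H p) = T"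
    for T and J :: "('a set option \<times> 'a set) set" and H
  proof (rule ccontr)
    assume "\<not> (\<exists>p\<in>J. H p \<noteq> {\<one>})"
    then have "(\<Union>p\<in>J. H p) \<subseteq> {\<one>}" by auto
    then have "T \<subseteq> {\<one>}" using generate_subgroup_incl[OF _ triv_subgroup] gen by blast
    then show False using component_nontrivial[OF \<D>' T] by blast
  qed
  \<comment> \<open>The nontrivial group \<open>T\<close> needs a nontrivial factor, and such a
    factor comes from a component assigned to \<open>T\<close>.\<close>
  have surj: "\<D>' \<subseteq> P ` \<D>"
  proof
    fix T assume T: "T \<in> \<D>'"
    from dec[OF T] obtain J :: "('a set option \<times> 'a set) set" and H x where
      JH: "generate G (\<Union>p\<in>J. H p) = T"
      "\<forall>p\<in>J. H p = {\<one>} \<or> (\<exists>E\<in>\<D>. \<exists>c. p = (Some E, c) \<and> x c \<in> carrier G \<and> P E = T \<and> H p = conjugate_by G (x c) E)"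
      by (elim exE conjE) (rule that)
    obtain p where "p \<in> J" "H p \<noteq> {\<one>}" using nontriv[OF T JH(1)] by blast
    then show "T \<in> P ` \<D>" using JH(2) by blast
  qed
  have fin: "finite \<D>" using \<D> by (simp add: nontrivial_free_factor_system_def)
  \<comment> \<open>Surjectivity together with the inequality of cardinalities makes
    \<open>P\<close> injective on \<open>\<D>\<close>.\<close>
  have "card \<D>' \<le> card (P ` \<D>)" using card_mono[OF finite_imageI[OF fin] surj] .
  then have "card (P ` \<D>) = card \<D>" using card card_image_le[OF fin, of P] by simp
  then have inj: "inj_on P \<D>" using eq_card_imp_inj_on[OF fin] by blast
  show ?thesis
    unfolding carries_def
  proof
    fix T assume T: "T \<in> \<D>'"
    from dec[OF T] obtain J :: "('a set option \<times> 'a set) set" and H x where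
      JH: "generate G (\<Union>p\<in>J. H p) = T"
      "\<forall>p\<in>J. H p = {\<one>} \<or> (\<exists>E\<in>\<D>. \<exists>c. p = (Some E, c) \<and> x c \<in> carrier G \<and> P E = T \<and> H p = conjugate_by G (x c) E)"
      "\<forall>E c d. (Some E, c) \<in> J \<and> (Some E, d) \<in> J \<and> H (Some E, c) \<noteq> {\<one>} \<and> H (Some E, d) \<noteq> {\<one>} \<longrightarrow> c = d"
      by (elim exE conjE) (rule that)
    obtain p where p: "p \<in> J" "H p \<noteq> {\<one>}" using nontriv[OF T JH(1)] by blast
    then obtain E c where E: "E \<in> \<D>" "p = (Some E, c)" "x c \<in> carrier G" "P E = T" "H p = conjugate_by G (x c) E"
      using JH(2) by blast
    have sc: "subgroup (H p) G" unfolding E(5) by (rule conjugate_by_subgroup[OF E(3) component_subgroup[OF \<D> E(1)]])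
    \<comment> \<open>Injectivity of \<open>P\<close> and uniqueness of the double coset leave
      \<open>H p\<close> as the only nontrivial factor of \<open>T\<close>.\<close>
    have "H q \<subseteq> H p" if q: "q \<in> J" for q
    proof (cases "H q = {\<one>}")
      case True
      then show ?thesis using subgroup.one_closed[OF sc] by simp
    next
      case False
      then obtain E' d where E': "E' \<in> \<D>" "q = (Some E', d)" "P E' = T" using JH(2) q by blast
      then have "E' = E" using inj_onD[OF inj, of E' E] E by simp
      then have "d = c" using JH(3) q p False E' E by blast
      then show ?thesis using \<open>E' = E\<close> E E' by simp
    qed
    then have "(\<Union>q\<in>J. H q) \<subseteq> H p" by blast
    then have "T \<subseteq> H p" using generate_subgroup_incl[OF _ sc] JH(1) by blast
    then show "\<exists>A\<in>\<D>. \<exists>y\<in>carrier G. T \<subseteq> conjugate_by G y A" using E by blast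
  qed
qed

end

section \<open>Absorbed systems\<close>

text \<open>Pure order theory: a maximal element is carried by the greatest one and hence equivalent
  to it.\<close>

lemma maximal_absorbed_if_greatest:
  assumes "absorbed_system G \<phi> \<A> \<D>" "\<And>\<E>. absorbed_system G \<phi> \<A> \<E> \<Longrightarrow> carries G \<D> \<E>"
  shows "maximal_absorbed_system G \<phi> \<A> \<D> \<and>
    (\<forall>\<B>. maximal_absorbed_system G \<phi> \<A> \<B> \<longrightarrow> system_equiv G \<B> \<D>)"
  using assms unfolding maximal_absorbed_system_def system_equiv_def by blast

locale injective_endomorphism = group G for G (structure) +
  fixes S :: "'a set" and \<phi> :: "'a \<Rightarrow> 'a"
  assumes S: "finite S" "free_basis G S"
    and \<phi>: "\<phi> \<in> hom G G" "inj_on \<phi> (carrier G)"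
begin

section \<open>Iterates and absorption\<close>

lemma funpow_hom: "\<phi> ^^ k \<in> hom G G"
  using \<phi>(1) by (induction k) (auto simp: hom_def Pi_iff)

lemma funpow_inj: "inj_on (\<phi> ^^ k) (carrier G)"
proof (induction k)
  case (Suc k)
  have "(\<phi> ^^ k) ` carrier G \<subseteq> carrier G" using funpow_hom[of k] by (auto simp: hom_def)
  then have "inj_on (\<phi> \<circ> \<phi> ^^ k) (carrier G)"
    using comp_inj_on[OF Suc inj_on_subset[OF \<phi>(2)]] by blast
  then show ?case by (simp only: funpow.simps)
qed simp

lemma funpow_closed: "x \<in> carrier G \<Longrightarrow> (\<phi> ^^ k) x \<in> carrier G"
  using funpow_hom[of k] by (auto simp: hom_def)

text \<open>Carrying of an iterate, isolated for a single subset so that exponents can be raised one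
  component at a time.\<close>

definition absorbs :: "'a set set \<Rightarrow> nat \<Rightarrow> 'a set \<Rightarrow> bool" where
  "absorbs \<A> k B \<longleftrightarrow> (\<exists>A\<in>\<A>. \<exists>x\<in>carrier G. (\<phi> ^^ k) ` B \<subseteq> conjugate_by G x A)"

lemma carries_image_iff: "carries G \<A> (image_system (\<phi> ^^ k) \<B>) \<longleftrightarrow> (\<forall>B\<in>\<B>. absorbs \<A> k B)"
  by (simp add: carries_def image_system_def absorbs_def)

lemma image_conjugate_subset:
  assumes "invariant_system G \<phi> \<A>" "\<forall>A\<in>\<A>. A \<subseteq> carrier G" "A \<in> \<A>" "x \<in> carrier G"
  shows "\<exists>A'\<in>\<A>. \<exists>y\<in>carrier G. \<phi> ` conjugate_by G x A \<subseteq> conjugate_by G y A'"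
proof -
  obtain A' y where A': "A' \<in> \<A>" "y \<in> carrier G" "\<phi> ` A \<subseteq> conjugate_by G y A'"
    using assms(1,3) unfolding invariant_system_def carries_def image_system_def by blast
  have px: "\<phi> x \<in> carrier G" using \<phi>(1) assms(4) by (auto simp: hom_def)
  have "\<phi> ` conjugate_by G x A = conjugate_by G (\<phi> x) (\<phi> ` A)"
    using conjugate_by_hom_image[OF \<phi>(1) assms(4)] assms(2,3) by blast
  also have "\<dots> \<subseteq> conjugate_by G (\<phi> x) (conjugate_by G y A')" by (rule conjugate_by_mono[OF A'(3)])
  also have "\<dots> = conjugate_by G (\<phi> x \<otimes> y) A'"
    using conjugate_by_mult[OF px A'(2)] assms(2) A'(1) by blast
  finally show ?thesis using A'(1,2) px by blast
qed

lemma absorbs_Suc: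
  assumes "invariant_system G \<phi> \<A>" "\<forall>A\<in>\<A>. A \<subseteq> carrier G" "absorbs \<A> k B"
  shows "absorbs \<A> (Suc k) B"
proof -
  obtain A x where A: "A \<in> \<A>" "x \<in> carrier G" "(\<phi> ^^ k) ` B \<subseteq> conjugate_by G x A"
    using assms(3) unfolding absorbs_def by blast
  have "(\<phi> ^^ Suc k) ` B \<subseteq> \<phi> ` conjugate_by G x A"
    using image_mono[OF A(3), of \<phi>] by (simp add: image_comp)
  then show ?thesis unfolding absorbs_def
    using image_conjugate_subset[OF assms(1,2) A(1,2)] by (meson order_trans)
qed

lemma absorbs_mono:
  assumes "invariant_system G \<phi> \<A>" "\<forall>A\<in>\<A>. A \<subseteq> carrier G" "absorbs \<A> k B" "k \<le> l"
  shows "absorbs \<A> l B"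
  using assms(4,3) by (induction l rule: dec_induct) (auto intro: absorbs_Suc[OF assms(1,2)])

context
  fixes \<A> assumes \<A>: "nontrivial_free_factor_system G \<A>" and fixed: "fixed_system G \<phi> \<A>"
begin

lemma inv_\<A>: "invariant_system G \<phi> \<A>"
  using fixed by (simp add: fixed_system_def)

lemma sub_\<A>: "\<forall>A\<in>\<A>. A \<subseteq> carrier G"
  using subgroup.subset[OF component_subgroup[OF \<A>]] by blast

lemma absorbs_component:
  assumes "A \<in> \<A>" shows "absorbs \<A> k A"
proof -
  have "absorbs \<A> 0 A" unfolding absorbs_def
    using assms conjugate_by_one[of A] sub_\<A> by (intro bexI[OF _ assms] bexI[of _ \<one>]) auto
  then show ?thesis by (rule absorbs_mono[OF inv_\<A> sub_\<A>]) simp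
qed

text \<open>An absorbed system carries the nontrivial components of \<open>\<A>\<close>, which the
  trivial system cannot do.\<close>

lemma absorbed_nontrivial:
  assumes "absorbed_system G \<phi> \<A> \<B>"
  shows "nontrivial_free_factor_system G \<B>"
proof (rule ccontr)
  assume "\<not> nontrivial_free_factor_system G \<B>"
  then have \<B>: "\<B> = {{\<one>}}" using assms by (simp add: absorbed_system_def free_factor_system_def)
  obtain A where A: "A \<in> \<A>" using \<A> unfolding nontrivial_free_factor_system_def by blast
  obtain x where x: "x \<in> carrier G" "A \<subseteq> conjugate_by G x {\<one>}"
    using assms A \<B> unfolding absorbed_system_def carries_def by blast
  obtain a where a: "a \<in> A" "a \<noteq> \<one>" "a \<in> carrier G" using component_nontrivial[OF \<A> A] .
  have "a \<in> conjugate_by G x {\<one>}" using x(2) a(1) by blast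
  then show False using a(2) x(1) by (simp add: conjugate_by_def)
qed

section \<open>The greatest absorbed system\<close>

text \<open>For invariance, the image of a component \<open>D\<close> under \<phi> is again sent by
  \<open>\<phi> ^^ k\<close> into a conjugate of a component of \<open>\<A>\<close>, because
  iterates commute and \<open>\<A>\<close> is invariant; hence the system of preimages carries
  it.\<close>

lemma absorbed_pullback:
  "\<exists>\<D>. absorbed_system G \<phi> \<A> \<D> \<and>
    (\<forall>\<E>. nontrivial_free_factor_system G \<E> \<and> (\<forall>E\<in>\<E>. absorbs \<A> k E) \<longrightarrow> carries G \<D> \<E>)"
proof -
  obtain A0 where A0: "A0 \<in> \<A>" using \<A> unfolding nontrivial_free_factor_system_def by blast
  obtain a0 where a0: "a0 \<in> A0" "a0 \<noteq> \<one>" "a0 \<in> carrier G" using component_nontrivial[OF \<A> A0] .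
  obtain A1 z1 where A1: "A1 \<in> \<A>" "z1 \<in> carrier G" "(\<phi> ^^ k) ` A0 \<subseteq> conjugate_by G z1 A1"
    using absorbs_component[OF A0, of k] unfolding absorbs_def by blast
  obtain \<D> where \<D>: "nontrivial_free_factor_system G \<D>"
    "\<forall>D\<in>\<D>. \<exists>A\<in>\<A>. \<exists>x\<in>carrier G. (\<phi> ^^ k) ` D \<subseteq> conjugate_by G x A"
    "\<forall>B. \<forall>A\<in>\<A>. \<forall>z\<in>carrier G. B \<subseteq> carrier G \<and> (\<phi> ^^ k) ` B \<subseteq> conjugate_by G z A \<and> (\<exists>b\<in>B. b \<noteq> \<one>) \<longrightarrow>
       (\<exists>D\<in>\<D>. \<exists>y\<in>carrier G. B \<subseteq> conjugate_by G y D)"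
    using pullback_system[OF S \<A> funpow_hom funpow_inj A1(1,2) bspec[OF sub_\<A> A0] A1(3) a0(1,2)]
    by (elim exE conjE) (rule that)
  have carry: "\<exists>D\<in>\<D>. \<exists>y\<in>carrier G. B \<subseteq> conjugate_by G y D"
    if B: "B \<subseteq> carrier G" "absorbs \<A> k B" "b \<in> B" "b \<noteq> \<one>" for B b
  proof -
    obtain A x where "A \<in> \<A>" "x \<in> carrier G" "(\<phi> ^^ k) ` B \<subseteq> conjugate_by G x A"
      using B(2) unfolding absorbs_def by blast
    then show ?thesis using \<D>(3) B by blast
  qed
  have carries: "carries G \<D> \<E>"
    if \<E>: "nontrivial_free_factor_system G \<E>" "\<forall>E\<in>\<E>. absorbs \<A> k E" for \<E>
    unfolding carries_def
  proof
    fix E assume E: "E \<in> \<E>"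
    obtain e where e: "e \<in> E" "e \<noteq> \<one>" "e \<in> carrier G" using component_nontrivial[OF \<E>(1) E] .
    show "\<exists>A\<in>\<D>. \<exists>x\<in>carrier G. E \<subseteq> conjugate_by G x A"
      using carry[OF subgroup.subset[OF component_subgroup[OF \<E>(1) E]] bspec[OF \<E>(2) E] e(1,2)] .
  qed
  have "invariant_system G \<phi> \<D>"
    unfolding invariant_system_def carries_def image_system_def
  proof
    fix B assume "B \<in> (`) \<phi> ` \<D>"
    then obtain D where D: "D \<in> \<D>" "B = \<phi> ` D" by blast
    obtain d where d: "d \<in> D" "d \<noteq> \<one>" "d \<in> carrier G" using component_nontrivial[OF \<D>(1) D(1)] .
    have sD: "D \<subseteq> carrier G" using subgroup.subset[OF component_subgroup[OF \<D>(1) D(1)]] .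
    have BG: "B \<subseteq> carrier G" using sD D(2) \<phi>(1) by (auto simp: hom_def)
    have "absorbs \<A> k D" using \<D>(2) D(1) by (simp add: absorbs_def)
    then have "absorbs \<A> (Suc k) D" by (rule absorbs_Suc[OF inv_\<A> sub_\<A>])
    \<comment> \<open>The additional application of \<phi> is moved from the outside to the
      inside.\<close>
    moreover have "(\<phi> ^^ Suc k) ` D = (\<phi> ^^ k) ` B"
      unfolding D(2) funpow_Suc_right by (simp only: image_comp)
    ultimately have "absorbs \<A> k B" by (simp only: absorbs_def)
    moreover have "\<phi> d \<in> B" using D(2) d(1) by blast
    moreover have "\<phi> d \<noteq> \<one>" using injective_hom_one[OF \<phi> d(3)] d(2) by simp
    ultimately show "\<exists>D\<in>\<D>. \<exists>x\<in>carrier G. B \<subseteq> conjugate_by G x D" by (rule carry[OF BG])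
  qed
  moreover have "carries G \<D> \<A>" using carries[OF \<A>] absorbs_component by blast
  moreover have "carries G \<A> (image_system (\<phi> ^^ k) \<D>)"
    unfolding carries_image_iff absorbs_def by (rule \<D>(2))
  ultimately have "absorbed_system G \<phi> \<A> \<D>"
    using \<D>(1) by (auto simp: absorbed_system_def free_factor_system_def)
  then show ?thesis using carries by blast
qed

lemma absorbed_self: "absorbed_system G \<phi> \<A> \<A>"
  unfolding absorbed_system_def
proof (intro conjI exI)
  show "free_factor_system G \<A>" using \<A> by (simp add: free_factor_system_def)
  show "carries G \<A> (image_system (\<phi> ^^ 0) \<A>)" unfolding carries_image_iff using absorbs_component by blast
qed (rule inv_\<A>, rule carries_refl[OF sub_\<A>])

theorem greatest_absorbed:
  "\<exists>\<D>. absorbed_system G \<phi> \<A> \<D> \<and> (\<forall>\<E>. absorbed_system G \<phi> \<A> \<E> \<longrightarrow> carries G \<D> \<E>)"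
proof -
  let ?P = "absorbed_system G \<phi> \<A>"
  obtain \<D>0 where \<D>0: "?P \<D>0" "\<forall>\<E>. ?P \<E> \<longrightarrow> card (killing \<D>0) \<le> card (killing \<E>)"
    using ex_has_least_nat[of ?P, OF absorbed_self, of "\<lambda>\<D>. card (killing \<D>)"] by blast
  let ?Q = "\<lambda>\<D>. ?P \<D> \<and> card (killing \<D>) = card (killing \<D>0)"
  have "?Q \<D>0" using \<D>0(1) by simp
  from ex_has_least_nat[of ?Q, OF this, of card]
  obtain \<D> where \<D>: "?P \<D>" "card (killing \<D>) = card (killing \<D>0)" "\<forall>\<E>. ?Q \<E> \<longrightarrow> card \<D> \<le> card \<E>"
    by blast
  note ffs\<D> = absorbed_nontrivial[OF \<D>(1)]
  have "carries G \<D> \<E>" if \<E>: "?P \<E>" for \<E>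
  proof -
    note ffs\<E> = absorbed_nontrivial[OF \<E>]
    obtain k where k: "\<forall>D\<in>\<D>. absorbs \<A> k D"
      using \<D>(1) unfolding absorbed_system_def carries_image_iff by blast
    obtain l where l: "\<forall>E\<in>\<E>. absorbs \<A> l E"
      using \<E> unfolding absorbed_system_def carries_image_iff by blast
    \<comment> \<open>A common exponent yields one absorbed system carrying both \<open>\<D>\<close>
      and \<open>\<E>\<close>; minimality of the two counts then shows that \<open>\<D>\<close>
      carries it.\<close>
    obtain \<D>' where \<D>': "?P \<D>'"
      "\<forall>\<E>. nontrivial_free_factor_system G \<E> \<and> (\<forall>E\<in>\<E>. absorbs \<A> (max k l) E) \<longrightarrow> carries G \<D>' \<E>"
      using absorbed_pullback[of "max k l"] by blast
    note ffs\<D>' = absorbed_nontrivial[OF \<D>'(1)]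
    have "\<forall>D\<in>\<D>. absorbs \<A> (max k l) D" "\<forall>E\<in>\<E>. absorbs \<A> (max k l) E"
      using k l absorbs_mono[OF inv_\<A> sub_\<A>] by (meson max.cobounded1 max.cobounded2)+
    then have car: "carries G \<D>' \<D>" "carries G \<D>' \<E>" using \<D>'(2) ffs\<D> ffs\<E> by blast+
    have sub: "\<forall>D\<in>\<D>'. D \<subseteq> carrier G" using subgroup.subset[OF component_subgroup[OF ffs\<D>']] by blast
    have km: "killing \<D>' \<subseteq> killing \<D>" by (rule killing_antimono[OF car(1) sub])
    have "card (killing \<D>) \<le> card (killing \<D>')" using \<D>0(2) \<D>'(1) \<D>(2) by simp
    then have eq: "killing \<D>' = killing \<D>"
      using card_seteq[OF finite_killing[OF S] km] by simp
    then have "card \<D> \<le> card \<D>'" using \<D>(2,3) \<D>'(1) by simp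
    then have "carries G \<D> \<D>'"
      using carries_reverse[OF S(2) ffs\<D> ffs\<D>' car(1)] eq by simp
    then show ?thesis
      using carries_trans[OF _ car(2)] subgroup.subset[OF component_subgroup[OF ffs\<D>]] by blast
  qed
  then show ?thesis using \<D>(1) by blast
qed

section \<open>Conjugates of the components inside an absorbed system\<close>

text \<open>A fixed system gives equality with a conjugate at each step, where invariance would give
  only inclusion; the equality is what later forces two subgroups to coincide.\<close>

lemma funpow_component:
  assumes "A \<in> \<A>"
  shows "\<exists>A'\<in>\<A>. \<exists>x\<in>carrier G. (\<phi> ^^ k) ` A = conjugate_by G x A'"
proof (induction k)
  case 0
  show ?case using assms conjugate_by_one[OF bspec[OF sub_\<A> assms]]
    by (intro bexI[OF _ assms] bexI[of _ \<one>]) simp_all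
next
  case (Suc k)
  then obtain A' x where A': "A' \<in> \<A>" "x \<in> carrier G" "(\<phi> ^^ k) ` A = conjugate_by G x A'" by blast
  obtain \<sigma> where \<sigma>: "bij_betw \<sigma> \<A> \<A>" "\<forall>A\<in>\<A>. \<exists>x\<in>carrier G. \<phi> ` A = conjugate_by G x (\<sigma> A)"
    using fixed unfolding fixed_system_def by blast
  have "\<sigma> A' \<in> \<A>" using bij_betw_apply[OF \<sigma>(1) A'(1)] .
  moreover obtain y where "y \<in> carrier G" "\<phi> ` A' = conjugate_by G y (\<sigma> A')"
    using bspec[OF \<sigma>(2) A'(1)] by (rule bexE)
  ultimately have y: "\<sigma> A' \<in> \<A>" "y \<in> carrier G" "\<phi> ` A' = conjugate_by G y (\<sigma> A')" by auto
  have px: "\<phi> x \<in> carrier G" using \<phi>(1) A'(2) by (auto simp: hom_def)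
  have "(\<phi> ^^ Suc k) ` A = \<phi> ` ((\<phi> ^^ k) ` A)" by (simp add: image_comp)
  also have "\<dots> = conjugate_by G (\<phi> x) (conjugate_by G y (\<sigma> A'))"
    unfolding A'(3) y(3)[symmetric] by (rule conjugate_by_hom_image[OF \<phi>(1) A'(2) bspec[OF sub_\<A> A'(1)]])
  also have "\<dots> = conjugate_by G (\<phi> x \<otimes> y) (\<sigma> A')"
    by (rule conjugate_by_mult[OF px y(2) bspec[OF sub_\<A> y(1)]])
  finally show ?case using y(1,2) px by blast
qed

text \<open>If \<open>A\<close> lies in a conjugate \<open>B'\<close> of a component of an absorbed system, then \<open>(\<phi> ^^ k) ` B'\<close> lies
  in a conjugate of a component that meets \<open>(\<phi> ^^ k) ` A\<close> nontrivially; as \<open>\<A>\<close> is malnormal,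
  that conjugate is \<open>(\<phi> ^^ k) ` A\<close> itself.\<close>

lemma component_conjugate_mem:
  assumes abs: "absorbed_system G \<phi> \<A> \<B>" and A: "A \<in> \<A>"
  shows "\<exists>x\<in>carrier G. conjugate_by G x A \<in> \<B>"
proof -
  note ffs\<B> = absorbed_nontrivial[OF abs]
  obtain k where k: "\<forall>B\<in>\<B>. absorbs \<A> k B"
    using abs unfolding absorbed_system_def carries_image_iff by blast
  obtain B y where B: "B \<in> \<B>" "y \<in> carrier G" "A \<subseteq> conjugate_by G y B"
    using abs A unfolding absorbed_system_def carries_def by blast
  have BG: "B \<subseteq> carrier G" using subgroup.subset[OF component_subgroup[OF ffs\<B> B(1)]] .
  obtain A' z where A': "A' \<in> \<A>" "z \<in> carrier G" "(\<phi> ^^ k) ` B \<subseteq> conjugate_by G z A'"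
    using k B(1) unfolding absorbs_def by blast
  obtain A'' w where A'': "A'' \<in> \<A>" "w \<in> carrier G" "(\<phi> ^^ k) ` A = conjugate_by G w A''"
    using funpow_component[OF A, of k] by blast
  note cA' = bspec[OF sub_\<A> A'(1)]
  define v where "v = (\<phi> ^^ k) y \<otimes> z"
  have v: "v \<in> carrier G" unfolding v_def using funpow_closed[OF B(2)] A'(2) by simp
  have "(\<phi> ^^ k) ` conjugate_by G y B = conjugate_by G ((\<phi> ^^ k) y) ((\<phi> ^^ k) ` B)"
    by (rule conjugate_by_hom_image[OF funpow_hom B(2) BG])
  also have "\<dots> \<subseteq> conjugate_by G ((\<phi> ^^ k) y) (conjugate_by G z A')" by (rule conjugate_by_mono[OF A'(3)])
  also have "\<dots> = conjugate_by G v A'"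
    unfolding v_def by (rule conjugate_by_mult[OF funpow_closed[OF B(2)] A'(2) cA'])
  finally have Bv: "(\<phi> ^^ k) ` conjugate_by G y B \<subseteq> conjugate_by G v A'" .
  obtain a where a: "a \<in> A" "a \<noteq> \<one>" "a \<in> carrier G" using component_nontrivial[OF \<A> A] .
  have ne: "(\<phi> ^^ k) a \<noteq> \<one>" using injective_hom_one[OF funpow_hom funpow_inj a(3)] a(2) by simp
  have a1: "(\<phi> ^^ k) a \<in> conjugate_by G w A''" using a(1) A''(3) by blast
  have a2: "(\<phi> ^^ k) a \<in> conjugate_by G v A'" using a(1) B(3) Bv by blast
  have eq: "A'' = A'" "inv v \<otimes> w \<in> A''"
    using component_malnormal_conjugates[OF \<A> A''(1) A'(1) A''(2) v a1 a2 ne] by auto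
  \<comment> \<open>The element \<open>inv v \<otimes> w\<close> lies in the component and preserves
    it, so conjugation by \<open>w\<close> and by \<open>v\<close> give the same subgroup.\<close>
  have "conjugate_by G w A' = conjugate_by G v (conjugate_by G (inv v \<otimes> w) A')"
    using conjugate_by_mult[OF v _ cA', of "inv v \<otimes> w"] v A''(2) by (simp add: m_assoc inv_cancel_left)
  also have "conjugate_by G (inv v \<otimes> w) A' = A'"
    using conjugate_by_subgroup_mem[OF component_subgroup[OF \<A> A'(1)]] eq by simp
  finally have "(\<phi> ^^ k) ` conjugate_by G y B \<subseteq> (\<phi> ^^ k) ` A" using Bv A''(3) eq(1) by simp
  then have "conjugate_by G y B \<subseteq> A"
    using inj_on_image_mem_iff[OF funpow_inj _ bspec[OF sub_\<A> A]] conjugate_by_closed[OF B(2) BG] by blast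
  then have "A = conjugate_by G y B" using B(3) by blast
  then have "conjugate_by G (inv y) A = B" using conjugate_by_inv(1)[OF B(2) BG] by simp
  then show ?thesis using B(1,2) by (intro bexI[of _ "inv y"]) auto
qed

text \<open>Arbitrarily chosen conjugates of the components need not generate their free product;
  lying in the common system \<open>\<B>\<close> guarantees it. The permutation is transported along
  the conjugations.\<close>

lemma maximal_fixed_conjugates:
  assumes max: "maximal_fixed_system G \<phi> \<A>" and \<B>: "nontrivial_free_factor_system G \<B>"
    and x: "\<forall>A\<in>\<A>. x A \<in> carrier G" "(\<lambda>A. conjugate_by G (x A) A) ` \<A> \<subseteq> \<B>"
  shows "maximal_fixed_system G \<phi> ((\<lambda>A. conjugate_by G (x A) A) ` \<A>)"
proof -
  define g where "g A = conjugate_by G (x A) A" for A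
  have fin: "finite \<A>" "\<A> \<noteq> {}" using \<A> by (auto simp: nontrivial_free_factor_system_def)
  have inv_g: "conjugate_by G (inv (x A)) (g A) = A" if "A \<in> \<A>" for A
    unfolding g_def using conjugate_by_inv(1) x(1) sub_\<A> that by blast
  have gG: "\<forall>B\<in>g ` \<A>. B \<subseteq> carrier G" unfolding g_def using conjugate_by_closed x(1) sub_\<A> by blast
  \<comment> \<open>By malnormality, conjugates of distinct components share no nontrivial element,
    so they remain distinct.\<close>
  have inj: "inj_on g \<A>"
  proof (rule inj_onI)
    fix A A' assume A: "A \<in> \<A>" "A' \<in> \<A>" "g A = g A'"
    obtain a where a: "a \<in> A" "a \<noteq> \<one>" "a \<in> carrier G" using component_nontrivial[OF \<A> A(1)] .
    have xA: "x A \<in> carrier G" using x(1) A(1) by blast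
    define b where "b = x A \<otimes> a \<otimes> inv (x A)"
    have b: "b \<in> g A" unfolding b_def g_def conjugate_by_def using a(1) by blast
    have "b \<noteq> \<one>"
    proof
      assume "b = \<one>"
      then have "inv (x A) \<otimes> b \<otimes> x A = \<one>" using xA by simp
      then show False unfolding b_def using xA a by (simp add: m_assoc inv_cancel_left)
    qed
    then show "A = A'"
      using component_malnormal_conjugates(1)[OF \<A> A(1,2) xA _ _ _ \<open>b \<noteq> \<one>\<close>, of "x A'"] b A(2,3) x(1)
      by (simp add: g_def)
  qed
  have ffs: "nontrivial_free_factor_system G (g ` \<A>)"
  proof -
    obtain C where C: "splitting G \<B> C" using splitting_exists[OF \<B>] .
    have sub: "g ` \<A> \<subseteq> \<B>" using x(2) by (simp add: g_def)
    have "nontrivial_free_factor_system G (component_family C ` Some ` g ` \<A>)"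
      using C fin sub \<B> unfolding splitting_def
      by (intro free_factor_system_family[where J = "component_index \<B>"])
        (auto simp: nontrivial_free_factor_system_def)
    then show ?thesis by (simp add: image_image)
  qed
  obtain \<sigma> where \<sigma>: "bij_betw \<sigma> \<A> \<A>" "\<forall>A\<in>\<A>. \<exists>x\<in>carrier G. \<phi> ` A = conjugate_by G x (\<sigma> A)"
    using fixed unfolding fixed_system_def by blast
  \<comment> \<open>The permutation of the components, transported to the chosen conjugates;
    conjugating back and forth only changes the conjugators.\<close>
  define \<tau> where "\<tau> = g \<circ> \<sigma> \<circ> inv_into \<A> g"
  have bij_g: "bij_betw g \<A> (g ` \<A>)" using inj by (simp add: bij_betw_def)
  have bij: "bij_betw \<tau> (g ` \<A>) (g ` \<A>)"
    unfolding \<tau>_def by (intro bij_betw_trans[OF bij_betw_inv_into[OF bij_g]] bij_betw_trans[OF \<sigma>(1) bij_g, unfolded comp_assoc])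
  have im: "\<exists>y\<in>carrier G. \<phi> ` B = conjugate_by G y (\<tau> B)" if B: "B \<in> g ` \<A>" for B
  proof -
    obtain A where A: "A \<in> \<A>" "B = g A" using B by blast
    have \<tau>B: "\<tau> B = g (\<sigma> A)" using A inj by (simp add: \<tau>_def inv_into_f_f)
    have \<sigma>A: "\<sigma> A \<in> \<A>" using bij_betw_apply[OF \<sigma>(1) A(1)] .
    obtain y where y: "y \<in> carrier G" "\<phi> ` A = conjugate_by G y (\<sigma> A)"
      using bspec[OF \<sigma>(2) A(1)] by (rule bexE)
    have xA: "x A \<in> carrier G" "x (\<sigma> A) \<in> carrier G" using x(1) A(1) \<sigma>A by auto
    have px: "\<phi> (x A) \<in> carrier G" using \<phi>(1) xA by (auto simp: hom_def)
    have cl: "g (\<sigma> A) \<subseteq> carrier G" using gG \<sigma>A by blast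
    have "\<phi> ` B = conjugate_by G (\<phi> (x A)) (conjugate_by G y (\<sigma> A))"
      unfolding A(2) g_def y(2)[symmetric] by (rule conjugate_by_hom_image[OF \<phi>(1) xA(1) bspec[OF sub_\<A> A(1)]])
    also have "\<dots> = conjugate_by G (\<phi> (x A) \<otimes> y) (\<sigma> A)"
      by (rule conjugate_by_mult[OF px y(1) bspec[OF sub_\<A> \<sigma>A]])
    also have "\<dots> = conjugate_by G (\<phi> (x A) \<otimes> y) (conjugate_by G (inv (x (\<sigma> A))) (g (\<sigma> A)))"
      by (simp add: inv_g[OF \<sigma>A])
    also have "\<dots> = conjugate_by G (\<phi> (x A) \<otimes> y \<otimes> inv (x (\<sigma> A))) (g (\<sigma> A))"
      by (rule conjugate_by_mult[OF _ _ cl]) (use px y(1) xA in simp_all)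
    finally show ?thesis unfolding \<tau>B using px y(1) xA by blast
  qed
  have "invariant_system G \<phi> (g ` \<A>)"
    unfolding invariant_system_def carries_def image_system_def
  proof
    fix B' assume "B' \<in> (`) \<phi> ` g ` \<A>"
    then obtain B where B: "B \<in> g ` \<A>" "B' = \<phi> ` B" by blast
    obtain y where y: "y \<in> carrier G" "\<phi> ` B = conjugate_by G y (\<tau> B)"
      using im[OF B(1)] by (rule bexE)
    show "\<exists>A\<in>g ` \<A>. \<exists>y\<in>carrier G. B' \<subseteq> conjugate_by G y A"
      by (intro bexI[OF _ bij_betw_apply[OF bij B(1)]] bexI[OF _ y(1)]) (simp add: B(2) y(2))
  qed
  then have fix_g: "fixed_system G \<phi> (g ` \<A>)" using bij im unfolding fixed_system_def by blast
  have "carries G (g ` \<A>) \<A>"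
    unfolding carries_def
  proof
    fix A assume A: "A \<in> \<A>"
    have "inv (x A) \<in> carrier G" using x(1) A by simp
    then show "\<exists>B\<in>g ` \<A>. \<exists>y\<in>carrier G. A \<subseteq> conjugate_by G y B" using inv_g[OF A] A by blast
  qed
  then have "carries G (g ` \<A>) \<C>" if "free_factor_system G \<C>" "fixed_system G \<phi> \<C>" for \<C>
    using carries_trans[OF _ _ gG] max that unfolding maximal_fixed_system_def by blast
  then have "maximal_fixed_system G \<phi> (g ` \<A>)"
    using ffs fix_g unfolding maximal_fixed_system_def free_factor_system_def by blast
  then show ?thesis by (simp add: g_def[abs_def])
qed

end

text \<open>An iterate of an injective endomorphism cannot send a nontrivial component into a
  conjugate of the trivial subgroup.\<close>

lemma absorbed_trivial:
  assumes "absorbed_system G \<phi> {{\<one>}} \<B>"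
  shows "\<B> = {{\<one>}}"
proof (rule ccontr)
  assume "\<B> \<noteq> {{\<one>}}"
  then have \<B>: "nontrivial_free_factor_system G \<B>"
    using assms by (simp add: absorbed_system_def free_factor_system_def)
  obtain k where k: "\<forall>B\<in>\<B>. absorbs {{\<one>}} k B"
    using assms unfolding absorbed_system_def carries_image_iff by blast
  obtain B where B: "B \<in> \<B>" using \<B> unfolding nontrivial_free_factor_system_def by blast
  obtain b where b: "b \<in> B" "b \<noteq> \<one>" "b \<in> carrier G" using component_nontrivial[OF \<B> B] .
  obtain x where "x \<in> carrier G" "(\<phi> ^^ k) ` B \<subseteq> conjugate_by G x {\<one>}"
    using k B unfolding absorbs_def by blast
  then have "(\<phi> ^^ k) b = \<one>" using b(1) by (auto simp: conjugate_by_def)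
  then show False using injective_hom_one[OF funpow_hom funpow_inj b(3)] b(2) by simp
qed

end

theorem proposition0p2p4:
  fixes F :: "('a, 'm) monoid_scheme" and \<phi> :: "'a \<Rightarrow> 'a" and \<A> :: "'a set set"
  assumes "free_group_finite_rank_ge2 F"
    and "\<phi> \<in> hom F F" and "inj_on \<phi> (carrier F)"
    and "maximal_fixed_system F \<phi> \<A>"
  shows "(\<exists>\<A>'. maximal_absorbed_system F \<phi> \<A> \<A>' \<and>
            (\<forall>\<B>. maximal_absorbed_system F \<phi> \<A> \<B> \<longrightarrow> system_equiv F \<B> \<A>')) \<and>
         (\<forall>\<A>'. maximal_absorbed_system F \<phi> \<A> \<A>' \<longrightarrow>
            (\<exists>x. (\<forall>A\<in>\<A>. x A \<in> carrier F) \<and>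
                 maximal_fixed_system F \<phi> ((\<lambda>A. conjugate_by F (x A) A) ` \<A>) \<and>
                 (\<lambda>A. conjugate_by F (x A) A) ` \<A> \<subseteq> \<A>'))"
proof -
  obtain S where S: "group F" "finite S" "free_basis F S"
    using assms(1) unfolding free_group_finite_rank_ge2_def by blast
  interpret injective_endomorphism F S \<phi>
    using S assms(2,3) by (intro injective_endomorphism.intro injective_endomorphism_axioms.intro)
  have fixed: "fixed_system F \<phi> \<A>" and ffs: "free_factor_system F \<A>"
    using assms(4) by (auto simp: maximal_fixed_system_def)
  show ?thesis
  proof (cases "nontrivial_free_factor_system F \<A>")
    case True
    obtain \<D> where \<D>: "absorbed_system F \<phi> \<A> \<D>" "\<And>\<E>. absorbed_system F \<phi> \<A> \<E> \<Longrightarrow> carries F \<D> \<E>"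
      using greatest_absorbed[OF True fixed] by blast
    \<comment> \<open>This is shown for every maximal absorbed system and not only for
      \<open>\<D>\<close>, because equivalent systems need not be equal as sets.\<close>
    have conjugates: "\<exists>x. (\<forall>A\<in>\<A>. x A \<in> carrier F) \<and>
                 maximal_fixed_system F \<phi> ((\<lambda>A. conjugate_by F (x A) A) ` \<A>) \<and>
                 (\<lambda>A. conjugate_by F (x A) A) ` \<A> \<subseteq> \<A>'"
      if "maximal_absorbed_system F \<phi> \<A> \<A>'" for \<A>'
    proof -
      have abs: "absorbed_system F \<phi> \<A> \<A>'" using that by (simp add: maximal_absorbed_system_def)
      obtain x where x: "\<forall>A\<in>\<A>. x A \<in> carrier F \<and> conjugate_by F (x A) A \<in> \<A>'"
        using component_conjugate_mem[OF True fixed abs] by metis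
      then have x': "\<forall>A\<in>\<A>. x A \<in> carrier F" "(\<lambda>A. conjugate_by F (x A) A) ` \<A> \<subseteq> \<A>'" by auto
      then show ?thesis
        using maximal_fixed_conjugates[OF True fixed assms(4) absorbed_nontrivial[OF True fixed abs] x'] by blast
    qed
    have best: "maximal_absorbed_system F \<phi> \<A> \<D> \<and>
        (\<forall>\<B>. maximal_absorbed_system F \<phi> \<A> \<B> \<longrightarrow> system_equiv F \<B> \<D>)"
      by (rule maximal_absorbed_if_greatest[OF \<D>(1)]) (rule \<D>(2))
    show ?thesis
      by (rule conjI, rule exI, rule best, intro allI impI, rule conjugates)
  next
    case False
    \<comment> \<open>If \<open>\<A>\<close> is trivial, it is its own only absorbed system, and the
      identity serves as conjugator.\<close>
    then have \<A>: "\<A> = {{\<one>\<^bsub>F\<^esub>}}" using ffs by (simp add: free_factor_system_def)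
    have refl: "carries F \<A> \<A>" using \<A> by (intro carries_refl) simp
    have "image_system (\<phi> ^^ 0) \<A> = \<A>" by (simp add: image_system_def)
    then have abs: "absorbed_system F \<phi> \<A> \<A>"
      unfolding absorbed_system_def using ffs fixed refl by (metis fixed_system_def)
    have triv: "\<B> = \<A>" if "absorbed_system F \<phi> \<A> \<B>" for \<B>
      using absorbed_trivial that \<A> by simp
    have conj: "conjugate_by F \<one>\<^bsub>F\<^esub> A = A" if "A \<in> \<A>" for A
      using that \<A> conjugate_by_one by simp
    have conjugates: "\<exists>x. (\<forall>A\<in>\<A>. x A \<in> carrier F) \<and>
                 maximal_fixed_system F \<phi> ((\<lambda>A. conjugate_by F (x A) A) ` \<A>) \<and>
                 (\<lambda>A. conjugate_by F (x A) A) ` \<A> \<subseteq> \<A>'"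
      if "maximal_absorbed_system F \<phi> \<A> \<A>'" for \<A>'
    proof -
      have "\<A>' = \<A>" using that triv by (simp add: maximal_absorbed_system_def)
      then show ?thesis using assms(4) conj by (intro exI[of _ "\<lambda>_. \<one>\<^bsub>F\<^esub>"]) (simp cong: image_cong)
    qed
    have greatest: "carries F \<A> \<E>" if "absorbed_system F \<phi> \<A> \<E>" for \<E>
      using triv[OF that] refl by simp
    have best: "maximal_absorbed_system F \<phi> \<A> \<A> \<and>
        (\<forall>\<B>. maximal_absorbed_system F \<phi> \<A> \<B> \<longrightarrow> system_equiv F \<B> \<A>)"
      by (rule maximal_absorbed_if_greatest[OF abs]) (rule greatest)
    show ?thesis
      by (rule conjI, rule exI, rule best, intro allI impI, rule conjugates)
  qed
qed

end
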